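(* Let $\mathcal{F}$ be a finite alphabet with $F=|\mathcal{F}|$. For any $n,m,t$ and any $c$ (with $1\le c\le n$), there is an efficient average-case $$\left(\mathsf{Edit}_{\mathcal{F}}(n),\ m,\ m-\left\lceil\tfrac nc\right\rceil\log_2(n-c+1)-(2c-1)\,t\,\lceil\log_2(F^c+1)\rceil,\ t\right)\text{-secure sketch}.$$
   Context: $\mathsf{Edit}_{\mathcal{F}}(n)$ is the space of strings of length $n$ over $\mathcal{F}$, with $\mathsf{dis}$ the smallest number of character insertions and deletions transforming one string into the other. Average min-entropy: $\tilde{\mathbf{H}}_\infty(A\mid B)=-\log_2\big(\mathbb{E}_{b\leftarrow B}[\max_a\Pr[A=a\mid B=b]]\big)$. An average-case $(\mathcal{M},m,\tilde m,t)$-secure sketch is a pair of randomized procedures: $\mathsf{SS}$ maps $w\in\mathcal{M}$ to a bit string; $\mathsf{Rec}$ takes $w'\in\mathcal{M}$ and a bit string; correctness: if $\mathsf{dis}(w,w')\le t$ then $\mathsf{Rec}(w',\mathsf{SS}(w))=w$; security: for any random variables $W$ over $\mathcal{M}$ and $I$ over $\{0,1\}^*$ with $\tilde{\mathbf{H}}_\infty(W\mid I)\ge m$, $\tilde{\mathbf{H}}_\infty(W\mid(\mathsf{SS}(W),I))\ge\tilde m$. Efficient means $\mathsf{SS}$ and $\mathsf{Rec}$ run in expected polynomial time. *)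

theory Defs
  imports
    "HOL-Probability.Probability"
    "HOL-Computational_Algebra.Polynomial"
    "HOL-Library.Log_Nat"
begin

section \<open>Edit distance\<close>

definition Edit :: "'a set \<Rightarrow> nat \<Rightarrow> 'a list set" where
  "Edit A n = {w. set w \<subseteq> A \<and> length w = n}"

inductive edit_step :: "'a set \<Rightarrow> 'a list \<Rightarrow> 'a list \<Rightarrow> bool" for A where
  insertion: "a \<in> A \<Longrightarrow> edit_step A (u @ v) (u @ a # v)"
| deletion: "edit_step A (u @ a # v) (u @ v)"

definition edit_dist :: "'a set \<Rightarrow> 'a list \<Rightarrow> 'a list \<Rightarrow> nat" where
  "edit_dist A w w' = (LEAST k. (edit_step A ^^ k) w w')"

section \<open>Average-case secure sketches\<close>

text \<open>The argument is the joint distribution of the pair \<open>(A, B)\<close>.\<close>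

definition avg_min_entropy :: "('a \<times> 'b) pmf \<Rightarrow> real" where
  "avg_min_entropy D =
     - log 2 (measure_pmf.expectation (map_pmf snd D)
                (\<lambda>b. SUP a. \<P>(x in measure_pmf D. fst x = a \<bar> snd x = b)))"

text \<open>Nothing is required of \<open>Rec w' s\<close> when \<open>s\<close> is not a sketch of a point close to \<open>w'\<close>.
  In the security condition \<open>D\<close> is the joint distribution of \<open>(W, I)\<close>; the coins of \<open>SS\<close> are
  independent of it.\<close>

definition average_case_secure_sketch ::
  "'w set \<Rightarrow> ('w \<Rightarrow> 'w \<Rightarrow> nat) \<Rightarrow> real \<Rightarrow> real \<Rightarrow> nat \<Rightarrow>
   ('w \<Rightarrow> bool list pmf) \<Rightarrow> ('w \<Rightarrow> bool list \<Rightarrow> 'w pmf) \<Rightarrow> bool" where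
  "average_case_secure_sketch M dis m m' t SS Rec \<longleftrightarrow>
     (\<forall>w\<in>M. \<forall>w'\<in>M. dis w w' \<le> t \<longrightarrow> bind_pmf (SS w) (\<lambda>s. Rec w' s) = return_pmf w) \<and>
     (\<forall>D :: ('w \<times> bool list) pmf.
        fst ` set_pmf D \<subseteq> M \<longrightarrow> avg_min_entropy D \<ge> m \<longrightarrow>
        avg_min_entropy
          (bind_pmf D (\<lambda>(w, i). map_pmf (\<lambda>s. (w, (s, i))) (SS w))) \<ge> m')"

section \<open>Randomized programs and their running time\<close>

text \<open>Efficiency is stated for a small randomized while-language on binary trees whose leaves are
  natural numbers. Every construct is charged the number of bits of the data it reads, and every
  basic operation also that of its result (the logarithmic cost criterion). So the
  basic arithmetic operations can be simulated on a Turing machine in time polynomial in their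
  charge, and expected polynomial time is the usual notion.\<close>

datatype val = VNat nat | VPair val val

primrec vsize :: "val \<Rightarrow> nat" where
  "vsize (VNat k) = 1 + floorlog 2 k"
| "vsize (VPair x y) = 1 + vsize x + vsize y"

datatype arith = Add | Sub | Mul | Div | Mod | Less

primrec arith_fun :: "arith \<Rightarrow> nat \<Rightarrow> nat \<Rightarrow> nat" where
  "arith_fun Add a b = a + b"
| "arith_fun Sub a b = a - b"
| "arith_fun Mul a b = a * b"
| "arith_fun Div a b = a div b"
| "arith_fun Mod a b = a mod b"
| "arith_fun Less a b = of_bool (a < b)"

datatype basic = Ident | Const nat | Fst | Snd | IsPair | Arith arith

text \<open>Ill-typed arguments give \<open>VNat 0\<close>.\<close>

primrec basic_fun :: "basic \<Rightarrow> val \<Rightarrow> val" where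
  "basic_fun Ident x = x"
| "basic_fun (Const k) x = VNat k"
| "basic_fun Fst x = (case x of VPair y z \<Rightarrow> y | _ \<Rightarrow> VNat 0)"
| "basic_fun Snd x = (case x of VPair y z \<Rightarrow> z | _ \<Rightarrow> VNat 0)"
| "basic_fun IsPair x = (case x of VPair y z \<Rightarrow> VNat 1 | _ \<Rightarrow> VNat 0)"
| "basic_fun (Arith f) x =
     (case x of VPair (VNat a) (VNat b) \<Rightarrow> VNat (arith_fun f a b) | _ \<Rightarrow> VNat 0)"

text \<open>A program maps one value to another: \<open>Fork p q\<close> runs both programs on the input and pairs
  the results, \<open>Cond b p q\<close> branches on the result of \<open>b\<close>, and \<open>While b p\<close> applies \<open>p\<close> as long as
  \<open>b\<close> gives a result other than \<open>VNat 0\<close>. \<open>Coin\<close> is a fair coin toss.\<close>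

datatype prog =
    Basic basic
  | Coin
  | Seq prog prog
  | Fork prog prog
  | Cond prog prog prog
  | While prog prog

partial_function (spmf) loop ::
  "(val \<Rightarrow> (val \<times> nat) spmf) \<Rightarrow> (val \<Rightarrow> (val \<times> nat) spmf) \<Rightarrow> val \<Rightarrow> (val \<times> nat) spmf" where
  "loop b f x =
     bind_spmf (b x) (\<lambda>(v, i).
       if v = VNat 0 then return_spmf (x, vsize x + i)
       else bind_spmf (f x) (\<lambda>(y, j).
              bind_spmf (loop b f y) (\<lambda>(z, k). return_spmf (z, vsize x + i + j + k))))"

text \<open>Joint distribution of output and running time. The missing mass is the probability
  of non-termination.\<close>

primrec run :: "prog \<Rightarrow> val \<Rightarrow> (val \<times> nat) spmf" where
  "run (Basic f) x = return_spmf (basic_fun f x, vsize x + vsize (basic_fun f x))"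
| "run Coin x =
     map_spmf (\<lambda>b. (VNat (of_bool b), vsize x + vsize (VNat (of_bool b)))) coin_spmf"
| "run (Seq p q) x =
     bind_spmf (run p x) (\<lambda>(y, i). bind_spmf (run q y) (\<lambda>(z, j).
       return_spmf (z, vsize x + i + j)))"
| "run (Fork p q) x =
     bind_spmf (run p x) (\<lambda>(y, i). bind_spmf (run q x) (\<lambda>(z, j).
       return_spmf (VPair y z, vsize x + i + j)))"
| "run (Cond b p q) x =
     bind_spmf (run b x) (\<lambda>(v, i).
       bind_spmf (if v = VNat 0 then run q x else run p x) (\<lambda>(y, j).
         return_spmf (y, vsize x + i + j)))"
| "run (While b p) x = loop (run b) (run p) x"

text \<open>The first conjunct entails termination with probability one.\<close>

definition runs_in_expected_time :: "prog \<Rightarrow> nat poly \<Rightarrow> val \<Rightarrow> val pmf \<Rightarrow> bool" where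
  "runs_in_expected_time P T x D \<longleftrightarrow>
     map_spmf fst (run P x) = spmf_of_pmf D \<and>
     (\<integral>\<^sup>+ r. of_nat (snd r) \<partial>measure_spmf (run P x)) \<le> of_nat (poly T (vsize x))"

section \<open>Efficient sketches for strings\<close>

definition vlist :: "val list \<Rightarrow> val" where
  "vlist xs = foldr VPair xs (VNat 0)"

definition enc_bits :: "bool list \<Rightarrow> val" where
  "enc_bits s = vlist (map (\<lambda>b. VNat (of_bool b)) s)"

definition enc_string :: "('a \<Rightarrow> nat) \<Rightarrow> 'a list \<Rightarrow> val" where
  "enc_string code w = vlist (map (\<lambda>a. VNat (code a)) w)"

text \<open>The programs \<open>P\<close> and \<open>Q\<close> get the list \<open>params\<close> of parameters of the sketch, in binary,
  followed by the proper arguments. \<open>Q\<close> has to be fast on every bit string, not only on sketches.\<close>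

definition implements_sketch ::
  "prog \<Rightarrow> prog \<Rightarrow> nat poly \<Rightarrow> nat list \<Rightarrow> ('a \<Rightarrow> nat) \<Rightarrow> 'a list set \<Rightarrow>
   ('a list \<Rightarrow> bool list pmf) \<Rightarrow> ('a list \<Rightarrow> bool list \<Rightarrow> 'a list pmf) \<Rightarrow> bool" where
  "implements_sketch P Q T params code M SS Rec \<longleftrightarrow>
     (\<forall>w\<in>M. runs_in_expected_time P T
        (vlist (map VNat params @ [enc_string code w]))
        (map_pmf enc_bits (SS w))) \<and>
     (\<forall>w'\<in>M. \<forall>s. runs_in_expected_time Q T
        (vlist (map VNat params @ [enc_string code w', enc_bits s]))
        (map_pmf (enc_string code) (Rec w' s)))"

end

theory Submission
  imports Defs "HOL-Library.Z2" "HOL-Algebra.Algebraic_Closure_Type"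
begin

text \<open>The budget is tight. Shingles are numbers from 1 to F^c, their bit length
  \<open>al\<close> is exactly the ceiling in the claim, and a unit of the symmetric difference may
  cost exactly \<open>al\<close> bits. The splitting \<open>al = d0 + L * d\<close> meets this: the
  hash set needs one odd syndrome of \<open>d0\<close> bits per unit, and each of the
  \<open>L\<close> layers one syndrome of \<open>d\<close> bits per unit, because an erasure uses up
  one syndrome and a wrong guess two. Both fields have polynomial size, unlike
  GF(2^\<open>al\<close>) in general, so moduli, inverses, error positions and good coins can be
  found by exhaustive search. The price is that coins can be bad. At most \<open>J0\<close> of the
  \<open>q = 2 ^ d0\<close> coins are, and replacing them raises the bound on the number of sketches
  by a factor of at most \<open>1 + J0 * (J0 + 1) / q\<close>; the excluded rank lists pay for it
  with a factor \<open>1 - 1 / m ^ 2\<close>, where \<open>m = n - c + 1\<close>. The exponent 6 in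
  the field size is chosen such that \<open>J0 * (J0 + 1) * m ^ 2 \<le> q\<close>. The loss counts
  values of the sketch and not bits, so the bit format may be wasteful.\<close>

text \<open>The sketch is one for the set of \<open>c\<close>-shingles (substrings of length \<open>c\<close>): an insertion or deletion
  changes the symmetric difference of these sets by at most \<open>2 c - 1\<close>. To save the logarithmic overhead
  of generic set reconciliation, the shingles are hashed injectively into a field GF(2^\<open>d0\<close>) that is just large
  enough, with public coins \<open>a\<close>. The sketch consists of \<open>a\<close>, odd power sums of the hash set (BCH syndromes), Reed-Solomon
  syndromes of the remaining bits of the shingles in the order of their hash values, and the ranks of the hash values
  of the blocks of \<open>c\<close> characters that make up the string. Given a close string, the hash set is decoded first. A hash
  value with exactly one shingle of the close string above it gives a guess for the remaining bits, all others are
  erasures; the number of erasures plus twice the number of wrong guesses is at most the symmetric difference.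

  The coins are independent of the string and cost no entropy, so the loss is at most the logarithm of the
  number of values of the rest of the sketch. If the hash function is not injective on the shingles, it is replaced by
  the first one that is. This increases the loss slightly, which is made up for by the fact that not all lists of
  ranks occur.\<close>

section \<open>Deterministic polynomial-time programs\<close>

text \<open>Every value has positive size, so the base is at least 2 and a single exponent absorbs
  constants, sums and products.\<close>

definition poly_bounded :: "('x \<Rightarrow> val) \<Rightarrow> ('x \<Rightarrow> nat) \<Rightarrow> bool" where
  "poly_bounded e f \<longleftrightarrow> (\<exists>C. \<forall>x. f x \<le> (vsize (e x) + 1) ^ C)"

text \<open>The encodings \<open>e\<close> and \<open>e'\<close> represent inputs and outputs. A function takes a whole environment as its
  input, so that terms with several free variables are composed by the rules below.\<close>

definition polytime :: "('x \<Rightarrow> val) \<Rightarrow> ('y \<Rightarrow> val) \<Rightarrow> ('x \<Rightarrow> 'y) \<Rightarrow> bool" where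
  "polytime e e' f \<longleftrightarrow> poly_bounded e (\<lambda>x. vsize (e' (f x))) \<and>
     (\<exists>P b. poly_bounded e b \<and> (\<forall>x. \<exists>k\<le>b x. run P (e x) = return_spmf (e' (f x), k)))"

abbreviation eN :: "nat \<Rightarrow> val" where "eN \<equiv> VNat"

definition eB :: "bool \<Rightarrow> val" where "eB b = VNat (of_bool b)"

definition eP :: "('a \<Rightarrow> val) \<Rightarrow> ('b \<Rightarrow> val) \<Rightarrow> 'a \<times> 'b \<Rightarrow> val" where
  "eP e1 e2 p = VPair (e1 (fst p)) (e2 (snd p))"

definition eL :: "('a \<Rightarrow> val) \<Rightarrow> 'a list \<Rightarrow> val" where "eL e xs = vlist (map e xs)"

lemma eL_simps [simp]: "eL e [] = VNat 0" "eL e (x # xs) = VPair (e x) (eL e xs)"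
  by (simp_all add: eL_def vlist_def)

lemma vsize_eL: "vsize (eL e xs) = 1 + sum_list (map (\<lambda>x. 1 + vsize (e x)) xs)"
  by (induction xs) (auto simp: floorlog_def)

lemma vsize_ge_1 [simp]: "Suc 0 \<le> vsize v"
  by (cases v) auto

section \<open>Polynomial bounds and the basic program constructs\<close>

lemma pbI: "(\<And>x. f x \<le> (vsize (e x) + 1) ^ C) \<Longrightarrow> poly_bounded e f"
  unfolding poly_bounded_def by blast

lemma pb_mono: "poly_bounded e g \<Longrightarrow> (\<And>x. f x \<le> g x) \<Longrightarrow> poly_bounded e f"
  unfolding poly_bounded_def by (meson le_trans)

lemma pb_const: "poly_bounded e (\<lambda>x. k)"
proof (rule pbI)
  fix x
  have "k \<le> 2 ^ k" by (simp add: less_imp_le)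
  also have "\<dots> \<le> (vsize (e x) + 1) ^ k" by (intro power_mono) auto
  finally show "k \<le> (vsize (e x) + 1) ^ k" .
qed

lemma pb_mult: assumes "poly_bounded e f" "poly_bounded e g" shows "poly_bounded e (\<lambda>x. f x * g x)"
proof -
  obtain C D where "\<And>x. f x \<le> (vsize (e x) + 1) ^ C" "\<And>x. g x \<le> (vsize (e x) + 1) ^ D"
    using assms unfolding poly_bounded_def by blast
  then have "f x * g x \<le> (vsize (e x) + 1) ^ (C + D)" for x
    unfolding power_add by (rule mult_le_mono)
  then show ?thesis by (rule pbI)
qed

lemma pb_add: assumes "poly_bounded e f" "poly_bounded e g" shows "poly_bounded e (\<lambda>x. f x + g x)"
proof -
  obtain C D where C: "\<And>x. f x \<le> (vsize (e x) + 1) ^ C" and D: "\<And>x. g x \<le> (vsize (e x) + 1) ^ D"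
    using assms unfolding poly_bounded_def by blast
  have "f x + g x \<le> (vsize (e x) + 1) ^ (C + D + 1)" for x
  proof -
    let ?v = "vsize (e x) + 1"
    have "f x \<le> ?v ^ (C + D)" using C[of x] by (rule order_trans) (auto intro: power_increasing)
    moreover have "g x \<le> ?v ^ (C + D)" using D[of x] by (rule order_trans) (auto intro: power_increasing)
    ultimately have "f x + g x \<le> 2 * ?v ^ (C + D)" by simp
    also have "\<dots> \<le> ?v * ?v ^ (C + D)" by (intro mult_right_mono) auto
    finally show ?thesis by simp
  qed
  then show ?thesis by (rule pbI)
qed

lemma pb_power: "poly_bounded e f \<Longrightarrow> poly_bounded e (\<lambda>x. f x ^ k)"
  by (induction k) (auto intro: pb_const pb_mult)

lemma pb_size: "poly_bounded e (\<lambda>x. vsize (e x))"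
  by (rule pbI[of _ _ 1]) simp

lemma pb_comp: assumes "poly_bounded e' k" "poly_bounded e (\<lambda>x. vsize (e' (g x)))" shows "poly_bounded e (\<lambda>x. k (g x))"
proof -
  obtain C where C: "\<And>x. k x \<le> (vsize (e' x) + 1) ^ C" using assms(1) unfolding poly_bounded_def by blast
  show ?thesis
    by (rule pb_mono[OF pb_power[OF pb_add[OF assms(2) pb_const[of _ 1]], of C]]) (rule C)
qed

lemma pb_diff: "poly_bounded e f \<Longrightarrow> poly_bounded e (\<lambda>x. f x - g x)" for f :: "'a \<Rightarrow> nat"
  by (erule pb_mono) simp
lemma pb_div: "poly_bounded e f \<Longrightarrow> poly_bounded e (\<lambda>x. f x div g x)" for f :: "'a \<Rightarrow> nat"
  by (erule pb_mono) simp

lemmas pb_intros = pb_const pb_mult pb_add pb_power pb_diff pb_div pb_size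

lemma pt_size: "polytime e e' f \<Longrightarrow> poly_bounded e (\<lambda>x. vsize (e' (f x)))"
  unfolding polytime_def by blast

lemma ptE:
  assumes "polytime e e' f"
  obtains P b where "poly_bounded e b" "\<And>x. \<exists>k\<le>b x. run P (e x) = return_spmf (e' (f x), k)"
  using assms unfolding polytime_def by blast

lemma ptI:
  assumes "poly_bounded e s" "poly_bounded e b" "\<And>x. vsize (e' (f x)) \<le> s x" "\<And>x. \<exists>k\<le>b x. run P (e x) = return_spmf (e' (f x), k)"
  shows "polytime e e' f"
  unfolding polytime_def using assms(2,4) pb_mono[OF assms(1), of "\<lambda>x. vsize (e' (f x))"] assms(3) by blast

lemma pt_basic:
  assumes "polytime e e1 f" "\<And>x. basic_fun B (e1 (f x)) = e2 (g x)" "\<And>x. vsize (e2 (g x)) \<le> vsize (e1 (f x)) + c"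
  shows "polytime e e2 g"
proof -
  obtain P b where b: "poly_bounded e b" and P: "\<And>x. \<exists>k\<le>b x. run P (e x) = return_spmf (e1 (f x), k)"
    using assms(1) by (rule ptE) blast
  note s = pt_size[OF assms(1)]
  show ?thesis
  proof (rule ptI[where P = "Seq P (Basic B)"])
    show "poly_bounded e (\<lambda>x. vsize (e1 (f x)) + c)" by (intro pb_intros s)
    show "poly_bounded e (\<lambda>x. vsize (e x) + b x + (2 * vsize (e1 (f x)) + c))" by (intro pb_intros s b)
    show "vsize (e2 (g x)) \<le> vsize (e1 (f x)) + c" for x by (rule assms)
    fix x
    obtain k where "k \<le> b x" "run P (e x) = return_spmf (e1 (f x), k)" using P by blast
    then show "\<exists>k\<le>vsize (e x) + b x + (2 * vsize (e1 (f x)) + c). run (Seq P (Basic B)) (e x) = return_spmf (e2 (g x), k)"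
      using assms(3)[of x] by (auto simp: assms(2))
  qed
qed

lemma pt_id: "polytime e e (\<lambda>x. x)"
  by (rule ptI[where P = "Basic Ident" and s = "\<lambda>x. vsize (e x)" and b = "\<lambda>x. 2 * vsize (e x)"])
     (auto intro!: pb_intros)

lemma pt_const_nat: "polytime e eN (\<lambda>x. k)"
  by (rule pt_basic[OF pt_id, where B = "Const k" and c = "vsize (VNat k)"]) auto

lemma pt_comp:
  assumes "polytime e1 e2 f" "polytime e e1 g" shows "polytime e e2 (\<lambda>x. f (g x))"
proof -
  obtain P b where b: "poly_bounded e1 b" and P: "\<And>x. \<exists>k\<le>b x. run P (e1 x) = return_spmf (e2 (f x), k)"
    using assms(1) by (rule ptE) blast
  obtain Q c where c: "poly_bounded e c" and Q: "\<And>x. \<exists>k\<le>c x. run Q (e x) = return_spmf (e1 (g x), k)"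
    using assms(2) by (rule ptE) blast
  note s = pt_size[OF assms(2)]
  show ?thesis
  proof (rule ptI[where P = "Seq Q P"])
    show "poly_bounded e (\<lambda>x. vsize (e2 (f (g x))))" by (rule pb_comp[OF pt_size[OF assms(1)] s])
    show "poly_bounded e (\<lambda>x. vsize (e x) + c x + b (g x))" by (intro pb_intros c pb_comp[OF b s])
    fix x
    obtain k where "k \<le> c x" "run Q (e x) = return_spmf (e1 (g x), k)" using Q by blast
    moreover obtain k' where "k' \<le> b (g x)" "run P (e1 (g x)) = return_spmf (e2 (f (g x)), k')" using P by blast
    ultimately show "\<exists>k\<le>vsize (e x) + c x + b (g x). run (Seq Q P) (e x) = return_spmf (e2 (f (g x)), k)"
      by auto
  qed auto
qed

lemma pt_Pair:
  assumes "polytime e e1 f" "polytime e e2 g" shows "polytime e (eP e1 e2) (\<lambda>x. (f x, g x))"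
proof -
  obtain P b where b: "poly_bounded e b" and P: "\<And>x. \<exists>k\<le>b x. run P (e x) = return_spmf (e1 (f x), k)"
    using assms(1) by (rule ptE) blast
  obtain Q c where c: "poly_bounded e c" and Q: "\<And>x. \<exists>k\<le>c x. run Q (e x) = return_spmf (e2 (g x), k)"
    using assms(2) by (rule ptE) blast
  show ?thesis
  proof (rule ptI[where P = "Fork P Q"])
    show "poly_bounded e (\<lambda>x. 1 + vsize (e1 (f x)) + vsize (e2 (g x)))" by (intro pb_intros assms[THEN pt_size])
    show "poly_bounded e (\<lambda>x. vsize (e x) + b x + c x)" by (intro pb_intros c b)
    fix x
    obtain k where "k \<le> c x" "run Q (e x) = return_spmf (e2 (g x), k)" using Q by blast
    moreover obtain k' where "k' \<le> b x" "run P (e x) = return_spmf (e1 (f x), k')" using P by blast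
    ultimately show "\<exists>k\<le>vsize (e x) + b x + c x. run (Fork P Q) (e x) = return_spmf (eP e1 e2 (f x, g x), k)"
      by (auto simp: eP_def)
  qed (auto simp: eP_def)
qed

lemma pt_fst: "polytime e (eP e1 e2) f \<Longrightarrow> polytime e e1 (\<lambda>x. fst (f x))"
  by (erule pt_basic[where B = Fst and c = 0]) (auto simp: eP_def)

lemma pt_snd: "polytime e (eP e1 e2) f \<Longrightarrow> polytime e e2 (\<lambda>x. snd (f x))"
  by (erule pt_basic[where B = Snd and c = 0]) (auto simp: eP_def)

lemma less_two_power_floorlog: "a < 2 ^ floorlog 2 a"
  by (rule floorlog_leD) auto

lemma floorlog_le: "a < 2 ^ k \<Longrightarrow> floorlog 2 a \<le> k"
  using floorlog_leI by fastforce

text \<open>For arguments of \<open>i\<close> and \<open>j\<close> bits a product is below 2^(i+j)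
  and a sum below twice that; every other result is at most the first argument or at most 1.\<close>

lemma floorlog_arith: "floorlog 2 (arith_fun h a b) \<le> floorlog 2 a + floorlog 2 b + 1"
proof (rule floorlog_le)
  define i j where "i = floorlog 2 a" and "j = floorlog 2 b"
  have ij: "a < 2 ^ i" "b < 2 ^ j" unfolding i_def j_def by (rule less_two_power_floorlog)+
  define p where "p = (2::nat) ^ (i + j)"
  have "(2::nat) ^ i \<le> p" "(2::nat) ^ j \<le> p" "1 \<le> p" unfolding p_def by (auto intro: power_increasing)
  then have p: "a < p" "b < p" "1 \<le> p" using ij by auto
  have m: "a * b < p"
    unfolding p_def power_add using ij by (intro mult_strict_mono) auto
  have d: "a div b < p" "a mod b < p" using p(1) by (meson div_le_dividend mod_less_eq_dividend le_less_trans)+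
  have "arith_fun h a b < 2 * p"
    using p m d by (cases h) auto
  then show "arith_fun h a b < 2 ^ (floorlog 2 a + floorlog 2 b + 1)" by (simp add: i_def j_def p_def)
qed

lemma pt_arith:
  assumes "polytime e eN f" "polytime e eN g" shows "polytime e eN (\<lambda>x. arith_fun h (f x) (g x))"
  by (rule pt_basic[OF pt_Pair[OF assms], where B = "Arith h" and c = 1])
     (use floorlog_arith[of h "f x" "g x" for x] in \<open>auto simp: eP_def intro: le_SucI\<close>)

lemmas pt_add = pt_arith[of _ _ _ Add, simplified]
lemmas pt_diff = pt_arith[of _ _ _ Sub, simplified]
lemmas pt_mult = pt_arith[of _ _ _ Mul, simplified]
lemmas pt_div = pt_arith[of _ _ _ Div, simplified]
lemmas pt_mod = pt_arith[of _ _ _ arith.Mod, simplified]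

lemma pt_less: assumes "polytime e eN f" "polytime e eN g" shows "polytime e eB (\<lambda>x. f x < g x)"
  using pt_arith[OF assms, of Less] unfolding polytime_def eB_def by simp

lemma pt_Suc: "polytime e eN f \<Longrightarrow> polytime e eN (\<lambda>x. Suc (f x))"
  using pt_add[OF _ pt_const_nat[of e 1]] by simp

lemma pt_const_bool: "polytime e eB (\<lambda>x. b)"
  using pt_const_nat[of e "of_bool b"] unfolding polytime_def eB_def .

lemma pt_Nil: "polytime e (eL e') (\<lambda>x. [])"
  using pt_const_nat[of e 0] unfolding polytime_def by simp

lemma pt_Cons: "polytime e e' f \<Longrightarrow> polytime e (eL e') g \<Longrightarrow> polytime e (eL e') (\<lambda>x. f x # g x)"
  using pt_Pair[of e e' f "eL e'" g] unfolding polytime_def by (simp add: eP_def)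

lemma pt_if:
  assumes "polytime e eB b" "polytime e e' f" "polytime e e' g" shows "polytime e e' (\<lambda>x. if b x then f x else g x)"
proof -
  obtain P k where k: "poly_bounded e k" and P: "\<And>x. \<exists>i\<le>k x. run P (e x) = return_spmf (eB (b x), i)"
    using assms(1) by (rule ptE) blast
  obtain Q l where l: "poly_bounded e l" and Q: "\<And>x. \<exists>i\<le>l x. run Q (e x) = return_spmf (e' (f x), i)"
    using assms(2) by (rule ptE) blast
  obtain R m where m: "poly_bounded e m" and R: "\<And>x. \<exists>i\<le>m x. run R (e x) = return_spmf (e' (g x), i)"
    using assms(3) by (rule ptE) blast
  show ?thesis
  proof (rule ptI[where P = "Cond P Q R"])
    show "poly_bounded e (\<lambda>x. vsize (e' (f x)) + vsize (e' (g x)))" by (intro pb_intros assms(2,3)[THEN pt_size])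
    show "poly_bounded e (\<lambda>x. vsize (e x) + k x + (l x + m x))" by (intro pb_intros k l m)
    fix x
    obtain i where "i \<le> k x" "run P (e x) = return_spmf (eB (b x), i)" using P by blast
    moreover obtain i' where "i' \<le> l x" "run Q (e x) = return_spmf (e' (f x), i')" using Q by blast
    moreover obtain i'' where "i'' \<le> m x" "run R (e x) = return_spmf (e' (g x), i'')" using R by blast
    ultimately show "\<exists>i\<le>vsize (e x) + k x + (l x + m x).
       run (Cond P Q R) (e x) = return_spmf (e' (if b x then f x else g x), i)"
      by (auto simp: eB_def)
  qed auto
qed

lemma pt_not: assumes "polytime e eB b" shows "polytime e eB (\<lambda>x. \<not> b x)"
proof -
  have eq: "(\<lambda>x. \<not> b x) = (\<lambda>x. if b x then False else True)" by auto
  show ?thesis unfolding eq by (intro pt_if pt_const_bool assms)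
qed
lemma pt_conj: assumes "polytime e eB b" "polytime e eB c" shows "polytime e eB (\<lambda>x. b x \<and> c x)"
proof -
  have eq: "(\<lambda>x. b x \<and> c x) = (\<lambda>x. if b x then c x else False)" by auto
  show ?thesis unfolding eq by (intro pt_if pt_const_bool assms)
qed
lemma pt_disj: assumes "polytime e eB b" "polytime e eB c" shows "polytime e eB (\<lambda>x. b x \<or> c x)"
proof -
  have eq: "(\<lambda>x. b x \<or> c x) = (\<lambda>x. if b x then True else c x)" by auto
  show ?thesis unfolding eq by (intro pt_if pt_const_bool assms)
qed
lemma pt_imp: assumes "polytime e eB b" "polytime e eB c" shows "polytime e eB (\<lambda>x. b x \<longrightarrow> c x)"
  unfolding imp_conv_disj by (intro pt_disj pt_not assms)
lemma pt_le: assumes "polytime e eN f" "polytime e eN g" shows "polytime e eB (\<lambda>x. f x \<le> g x)"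
  using pt_not[OF pt_less[OF assms(2,1)]] by (simp add: not_less)
lemma pt_eq: assumes "polytime e eN f" "polytime e eN g" shows "polytime e eB (\<lambda>x. f x = g x)"
proof -
  have eq: "(\<lambda>x. f x = g x) = (\<lambda>x. f x \<le> g x \<and> g x \<le> f x)" by auto
  show ?thesis unfolding eq by (intro pt_conj pt_le assms)
qed
lemma pt_of_bool: "polytime e eB b \<Longrightarrow> polytime e eN (\<lambda>x. of_bool (b x))"
  unfolding polytime_def eB_def by simp
lemma pt_min: assumes "polytime e eN f" "polytime e eN g" shows "polytime e eN (\<lambda>x. min (f x) (g x))"
  unfolding min_def by (intro pt_if pt_le assms)

text \<open>An empty list is a leaf and a nonempty one a pair, so \<open>IsPair\<close> decides the
  case. The list is recomputed for the test, the head and the tail, since programs have no variables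
  that could store it.\<close>

lemma pt_case_list:
  assumes l: "polytime e (eL e1) l" and n: "polytime e e2 n"
    and c: "polytime (eP (eP e e1) (eL e1)) e2 (\<lambda>p. c (fst (fst p)) (snd (fst p)) (snd p))"
  shows "polytime e e2 (\<lambda>x. case l x of [] \<Rightarrow> n x | y # ys \<Rightarrow> c x y ys)"
proof -
  obtain P k where k: "poly_bounded e k" and P: "\<And>x. \<exists>i\<le>k x. run P (e x) = return_spmf (eL e1 (l x), i)"
    using l by (rule ptE) blast
  obtain Q q where q: "poly_bounded e q" and Q: "\<And>x. \<exists>i\<le>q x. run Q (e x) = return_spmf (e2 (n x), i)"
    using n by (rule ptE) blast
  obtain R r where r: "poly_bounded (eP (eP e e1) (eL e1)) r"
     and R: "\<And>x. \<exists>i\<le>r x. run R (eP (eP e e1) (eL e1) x) = return_spmf (e2 (c (fst (fst x)) (snd (fst x)) (snd x)), i)"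
    using c by (rule ptE) blast
  obtain C where C: "\<And>x. r x \<le> (vsize (eP (eP e e1) (eL e1) x) + 1) ^ C" using r unfolding poly_bounded_def by blast
  obtain D where D: "\<And>p. vsize (e2 (c (fst (fst p)) (snd (fst p)) (snd p))) \<le> (vsize (eP (eP e e1) (eL e1) p) + 1) ^ D"
    using pt_size[OF c] unfolding poly_bounded_def by blast
  let ?s = "\<lambda>x. vsize (e x) + vsize (eL e1 (l x)) + 2"
  have s: "poly_bounded e ?s" by (intro pb_intros pt_size[OF l])
  show ?thesis
  proof (rule ptI[where P = "Cond (Seq P (Basic IsPair)) (Seq (Fork (Fork (Basic Ident) (Seq P (Basic Fst))) (Seq P (Basic Snd))) R) Q"])
    show "poly_bounded e (\<lambda>x. vsize (e2 (n x)) + ?s x ^ D)" by (intro pb_intros pt_size[OF n] s)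
    show "poly_bounded e (\<lambda>x. 20 * ?s x + 6 * k x + q x + ?s x ^ C)" by (intro pb_intros k q s)
    fix x
    show "vsize (e2 (case l x of [] \<Rightarrow> n x | y # ys \<Rightarrow> c x y ys)) \<le> vsize (e2 (n x)) + ?s x ^ D"
    proof (cases "l x")
      case (Cons y ys)
      have "vsize (e2 (c x y ys)) \<le> (vsize (eP (eP e e1) (eL e1) ((x, y), ys)) + 1) ^ D" using D[of "((x, y), ys)"] by simp
      also have "\<dots> \<le> ?s x ^ D" using Cons by (intro power_mono) (auto simp: eP_def)
      finally show ?thesis using Cons by simp
    qed auto
    obtain i where i: "i \<le> k x" "run P (e x) = return_spmf (eL e1 (l x), i)" using P by blast
    obtain j where j: "j \<le> q x" "run Q (e x) = return_spmf (e2 (n x), j)" using Q by blast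
    show "\<exists>m\<le>20 * ?s x + 6 * k x + q x + ?s x ^ C. run (Cond (Seq P (Basic IsPair)) (Seq (Fork (Fork (Basic Ident) (Seq P (Basic Fst))) (Seq P (Basic Snd))) R) Q) (e x) =
           return_spmf (e2 (case l x of [] \<Rightarrow> n x | y # ys \<Rightarrow> c x y ys), m)"
    proof (cases "l x")
      case Nil
      have "floorlog 2 0 = 0" by (simp add: floorlog_def)
      then show ?thesis using i j Nil by (auto)
    next
      case (Cons y ys)
      obtain h where h: "h \<le> r ((x, y), ys)" "run R (eP (eP e e1) (eL e1) ((x,y),ys)) = return_spmf (e2 (c x y ys), h)" using R[of "((x,y),ys)"] by auto
      have "h \<le> (vsize (eP (eP e e1) (eL e1) ((x, y), ys)) + 1) ^ C" using h(1) C[of "((x,y),ys)"] by simp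
      also have "\<dots> \<le> ?s x ^ C" using Cons by (intro power_mono) (auto simp: eP_def)
      finally have hs: "h \<le> ?s x ^ C" .
      have fl: "floorlog 2 (Suc 0) = 1" by (simp add: floorlog_def)
      show ?thesis using i h(2) hs fl Cons unfolding eP_def by (auto simp del: power_Suc)
    qed
  qed
qed

text \<open>\<open>Xm\<close> bounds the state size and the cost of test and body in all rounds, so
  each of the \<open>k + 1\<close> unfoldings costs at most \<open>3 * Xm\<close>.\<close>

lemma loop_det:
  assumes "\<And>i. i \<le> k \<Longrightarrow> \<exists>j\<le>Xm. run Pb (es ((f ^^ i) s)) = return_spmf (eB (b ((f ^^ i) s)), j)"
    and "\<And>i. i < k \<Longrightarrow> \<exists>j\<le>Xm. run Pf (es ((f ^^ i) s)) = return_spmf (es ((f ^^ Suc i) s), j)"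
    and "\<And>i. i \<le> k \<Longrightarrow> vsize (es ((f ^^ i) s)) \<le> Xm"
    and "\<And>i. i < k \<Longrightarrow> b ((f ^^ i) s)" and "\<not> b ((f ^^ k) s)"
  shows "\<exists>j\<le>(k + 1) * (3 * Xm). loop (run Pb) (run Pf) (es s) = return_spmf (es ((f ^^ k) s), j)"
  using assms
proof (induction k arbitrary: s)
  case 0
  obtain j where "j \<le> Xm" "run Pb (es s) = return_spmf (eB (b s), j)" using "0.prems"(1)[of 0] by auto
  moreover have "vsize (es s) \<le> Xm" using "0.prems"(3)[of 0] by simp
  ultimately show ?case using "0.prems"(5) by (subst loop.simps) (auto simp: eB_def)
next
  case (Suc k)
  obtain j1 where j1: "j1 \<le> Xm" "run Pb (es s) = return_spmf (eB (b s), j1)" using Suc.prems(1)[of 0] by auto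
  obtain j2 where j2: "j2 \<le> Xm" "run Pf (es s) = return_spmf (es (f s), j2)" using Suc.prems(2)[of 0] by auto
  have j3: "vsize (es s) \<le> Xm" using Suc.prems(3)[of 0] by simp
  have b: "b s" using Suc.prems(4)[of 0] by simp
  have shift: "(f ^^ i) (f s) = (f ^^ Suc i) s" for i by (simp add: funpow_swap1)
  have "\<exists>j\<le>(k + 1) * (3 * Xm). loop (run Pb) (run Pf) (es (f s)) = return_spmf (es ((f ^^ k) (f s)), j)"
  proof (rule Suc.IH)
    fix i assume i: "i < k"
    show "\<exists>j\<le>Xm. run Pf (es ((f ^^ i) (f s))) = return_spmf (es ((f ^^ Suc i) (f s)), j)"
      using Suc.prems(2)[of "Suc i"] i unfolding shift by simp
    show "b ((f ^^ i) (f s))" using Suc.prems(4)[of "Suc i"] i unfolding shift by simp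
  next
    fix i assume i: "i \<le> k"
    show "\<exists>j\<le>Xm. run Pb (es ((f ^^ i) (f s))) = return_spmf (eB (b ((f ^^ i) (f s))), j)"
      using Suc.prems(1)[of "Suc i"] i unfolding shift by simp
    show "vsize (es ((f ^^ i) (f s))) \<le> Xm" using Suc.prems(3)[of "Suc i"] i unfolding shift by simp
  next
    show "\<not> b ((f ^^ k) (f s))" using Suc.prems(5) unfolding shift by simp
  qed
  then obtain j where j: "j \<le> (k + 1) * (3 * Xm)"
    "loop (run Pb) (run Pf) (es (f s)) = return_spmf (es ((f ^^ Suc k) s), j)" unfolding shift by blast
  show ?case
    by (subst loop.simps) (use j1 j2 j3 b j in \<open>auto simp: eB_def algebra_simps\<close>)
qed

text \<open>Iterating a polynomial-time step can make the state grow exponentially. Hence the number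
  of rounds and the size of all intermediate states have to be bounded in terms of the initial
  environment.\<close>

lemma pt_while:
  assumes b: "polytime es eB b" and f: "polytime es es f" and s0: "polytime e es s0" and K: "poly_bounded e K" and B: "poly_bounded e B"
    and sz: "\<And>x i. i \<le> K x \<Longrightarrow> vsize (es ((f ^^ i) (s0 x))) \<le> B x"
    and cont: "\<And>x i. i < K x \<Longrightarrow> b ((f ^^ i) (s0 x))" and stop: "\<And>x. \<not> b ((f ^^ K x) (s0 x))"
  shows "polytime e es (\<lambda>x. (f ^^ K x) (s0 x))"
proof -
  obtain Pb kb where kb: "poly_bounded es kb" and Pb: "\<And>x. \<exists>k\<le>kb x. run Pb (es x) = return_spmf (eB (b x), k)"
    using b by (rule ptE) blast
  obtain Pf kf where kf: "poly_bounded es kf" and Pf: "\<And>x. \<exists>k\<le>kf x. run Pf (es x) = return_spmf (es (f x), k)"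
    using f by (rule ptE) blast
  obtain P0 k0 where k0: "poly_bounded e k0" and P0: "\<And>x. \<exists>k\<le>k0 x. run P0 (e x) = return_spmf (es (s0 x), k)"
    using s0 by (rule ptE) blast
  obtain C where C: "\<And>x. kb x \<le> (vsize (es x) + 1) ^ C" using kb unfolding poly_bounded_def by blast
  obtain D where D: "\<And>x. kf x \<le> (vsize (es x) + 1) ^ D" using kf unfolding poly_bounded_def by blast
  define Xm where "Xm x = B x + (B x + 1) ^ C + (B x + 1) ^ D" for x
  have Xm: "poly_bounded e Xm" unfolding Xm_def by (intro pb_intros B)
  show ?thesis
  proof (rule ptI[where P = "Seq P0 (While Pb Pf)"])
    show "poly_bounded e B" by (rule B)
    show "vsize (es ((f ^^ K x) (s0 x))) \<le> B x" for x by (rule sz) simp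
    show "poly_bounded e (\<lambda>x. vsize (e x) + k0 x + (K x + 1) * (3 * Xm x))" by (intro pb_intros k0 K Xm)
    fix x
      have *: "(\<exists>j\<le>Xm x. run Pb (es ((f ^^ i) (s0 x))) = return_spmf (eB (b ((f ^^ i) (s0 x))), j)) \<and>
        (\<exists>j\<le>Xm x. run Pf (es ((f ^^ i) (s0 x))) = return_spmf (es ((f ^^ Suc i) (s0 x)), j)) \<and>
        vsize (es ((f ^^ i) (s0 x))) \<le> Xm x" if i: "i \<le> K x" for i
      proof -
      let ?s = "(f ^^ i) (s0 x)"
      have "(vsize (es ?s) + 1) ^ E \<le> (B x + 1) ^ E" for E using sz[OF i] by (intro power_mono) auto
      then have "kb ?s \<le> Xm x" "kf ?s \<le> Xm x" using C[of ?s] D[of ?s] unfolding Xm_def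
        by (meson le_trans trans_le_add1 trans_le_add2)+
      then have "\<exists>j\<le>Xm x. run Pb (es ?s) = return_spmf (eB (b ?s), j)"
        "\<exists>j\<le>Xm x. run Pf (es ?s) = return_spmf (es ((f ^^ Suc i) (s0 x)), j)"
        using Pb[of ?s] Pf[of ?s] by (auto intro: le_trans)
      moreover have "vsize (es ?s) \<le> Xm x" using sz[OF i] unfolding Xm_def by simp
      ultimately show ?thesis by blast
      qed
    have "\<exists>j\<le>(K x + 1) * (3 * Xm x). loop (run Pb) (run Pf) (es (s0 x)) = return_spmf (es ((f ^^ K x) (s0 x)), j)"
    proof (rule loop_det[where b = b])
      show "\<exists>j\<le>Xm x. run Pf (es ((f ^^ i) (s0 x))) = return_spmf (es ((f ^^ Suc i) (s0 x)), j)" if "i < K x" for i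
        using *[of i] that by simp
    qed (use * cont stop in auto)
    then show "\<exists>k\<le>vsize (e x) + k0 x + (K x + 1) * (3 * Xm x).
       run (Seq P0 (While Pb Pf)) (e x) = return_spmf (es ((f ^^ K x) (s0 x)), k)"
      using P0[of x] by (auto intro: add_le_mono)
  qed
qed

section \<open>Polynomial-time operations on lists and numbers\<close>

lemma pt_tl: "polytime e (eL e1) l \<Longrightarrow> polytime e (eL e1) (\<lambda>x. tl (l x))"
  using pt_case_list[of e e1 l "eL e1" "\<lambda>x. []" "\<lambda>x y ys. ys"] pt_snd[OF pt_id, of "eP e e1" "eL e1"] pt_Nil[of e e1]
  by (simp add: tl_def)

lemma pt_null: assumes "polytime e (eL e1) l" shows "polytime e eB (\<lambda>x. l x = [])"
proof -
  have "(\<lambda>x. l x = []) = (\<lambda>x. case l x of [] \<Rightarrow> True | y # ys \<Rightarrow> False)"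
    by (rule ext) (simp split: list.split)
  then show ?thesis using pt_case_list[OF assms pt_const_bool pt_const_bool] by (simp only:)
qed

definition hd_or :: "'a \<Rightarrow> 'a list \<Rightarrow> 'a" where "hd_or d xs = (case xs of [] \<Rightarrow> d | y # ys \<Rightarrow> y)"

lemma pt_hd_or: "polytime e (eL e1) l \<Longrightarrow> polytime e e1 d \<Longrightarrow> polytime e e1 (\<lambda>x. hd_or (d x) (l x))"
  unfolding hd_or_def by (rule pt_case_list) (assumption | rule pt_fst pt_snd pt_id)+

text \<open>The environment is carried along in the state, because a loop body sees nothing but its
  own argument.\<close>

definition fold_step :: "('x \<Rightarrow> 'a \<Rightarrow> 's \<Rightarrow> 's) \<Rightarrow> ('x \<times> 'a list) \<times> 's \<Rightarrow> ('x \<times> 'a list) \<times> 's" where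
  "fold_step g p = (case snd (fst p) of [] \<Rightarrow> p | y # ys \<Rightarrow> ((fst (fst p), ys), g (fst (fst p)) y (snd p)))"

lemma fold_step_pow: "i \<le> length l \<Longrightarrow> (fold_step g ^^ i) ((x, l), s) = ((x, drop i l), fold (g x) (take i l) s)"
proof (induction i)
  case (Suc i)
  then have "drop i l = l ! i # drop (Suc i) l" "take (Suc i) l = take i l @ [l ! i]"
    by (simp_all add: Cons_nth_drop_Suc take_Suc_conv_app_nth)
  with Suc show ?case by (simp add: fold_step_def)
qed simp

lemma vsize_eL_append: "vsize (eL e (xs @ ys)) + 1 = vsize (eL e xs) + vsize (eL e ys)"
  by (simp add: vsize_eL)

text \<open>The size assumption ranges over all prefixes \<open>ys\<close> of the list, that is,
  over all intermediate accumulators.\<close>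

lemma pt_fold:
  assumes l: "polytime e (eL eA) l" and s0: "polytime e eS s0"
    and g: "polytime (eP (eP e eA) eS) eS (\<lambda>p. g (fst (fst p)) (snd (fst p)) (snd p))"
    and B: "poly_bounded e B" and sz: "\<And>x ys zs. l x = ys @ zs \<Longrightarrow> vsize (eS (fold (g x) ys (s0 x))) \<le> B x"
  shows "polytime e eS (\<lambda>x. fold (g x) (l x) (s0 x))"
proof -
  let ?es = "eP (eP e (eL eA)) eS"
  have "polytime e ?es (\<lambda>x. (fold_step g ^^ length (l x)) ((x, l x), s0 x))"
  proof (rule pt_while[where b = "\<lambda>p. \<not> snd (fst p) = []" and B = "\<lambda>x. 2 + vsize (e x) + vsize (eL eA (l x)) + B x"])
    show "polytime ?es eB (\<lambda>p. \<not> snd (fst p) = [])" by (intro pt_not pt_null pt_snd pt_fst) (rule pt_id)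
    have "polytime (eP (eP ?es eA) (eL eA)) (eP (eP e (eL eA)) eS) (\<lambda>q. ((fst (fst (fst (fst q))), snd q), g (fst (fst (fst (fst q)))) (snd (fst q)) (snd (fst (fst q)))))"
      by (intro pt_Pair pt_comp[OF g, of _ "\<lambda>q. ((fst (fst (fst (fst q))), snd (fst q)), snd (fst (fst q)))", simplified])
         (rule pt_Pair pt_fst pt_snd pt_id)+
    then show "polytime ?es ?es (fold_step g)" unfolding fold_step_def
      by (intro pt_case_list pt_id) (assumption | rule pt_fst pt_snd pt_id)+
    show "polytime e ?es (\<lambda>x. ((x, l x), s0 x))" by (intro pt_Pair pt_id l s0)
    show "poly_bounded e (\<lambda>x. length (l x))"
      by (rule pb_mono[OF pt_size[OF l]]) (auto simp: vsize_eL sum_list_Suc)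
    show "poly_bounded e (\<lambda>x. 2 + vsize (e x) + vsize (eL eA (l x)) + B x)" by (intro pb_intros pt_size[OF l] B)
    fix x i assume i: "i \<le> length (l x)"
    have "vsize (eL eA (drop i (l x))) \<le> vsize (eL eA (l x))"
      using vsize_eL_append[of eA "take i (l x)" "drop i (l x)"] vsize_ge_1[of "eL eA (take i (l x))"] unfolding append_take_drop_id by linarith
    moreover have "vsize (eS (fold (g x) (take i (l x)) (s0 x))) \<le> B x" by (rule sz[of _ _ "drop i (l x)"]) simp
    ultimately show "vsize (?es ((fold_step g ^^ i) ((x, l x), s0 x))) \<le> 2 + vsize (e x) + vsize (eL eA (l x)) + B x"
      by (simp add: fold_step_pow[OF i] eP_def)
  qed (auto simp: fold_step_pow)
  from pt_snd[OF this] show ?thesis by (simp add: fold_step_pow)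
qed

lemma vsize_mem: "y \<in> set l \<Longrightarrow> vsize (e y) < vsize (eL e l)"
  by (induction l) auto

lemma pb_length: "polytime e (eL eA) l \<Longrightarrow> poly_bounded e (\<lambda>x. length (l x))"
  by (drule pt_size, erule pb_mono) (auto simp: vsize_eL sum_list_Suc)

lemma pt_rev: assumes "polytime e (eL eA) l" shows "polytime e (eL eA) (\<lambda>x. rev (l x))"
proof -
  have "polytime e (eL eA) (\<lambda>x. fold (\<lambda>y s. y # s) (l x) [])"
  proof (rule pt_fold[OF assms])
    show "poly_bounded e (\<lambda>x. vsize (eL eA (l x)))" by (rule pt_size[OF assms])
    show "vsize (eL eA (fold (#) ys [])) \<le> vsize (eL eA (l x))" if "l x = ys @ zs" for x ys zs
      using that by (simp add: fold_Cons_rev vsize_eL rev_map[symmetric] sum_list_rev)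
  qed (rule pt_Cons pt_fst pt_snd pt_id pt_Nil)+
  then show ?thesis by (simp add: fold_Cons_rev)
qed

lemma pt_append: assumes "polytime e (eL eA) k" "polytime e (eL eA) l" shows "polytime e (eL eA) (\<lambda>x. k x @ l x)"
proof -
  have "polytime e (eL eA) (\<lambda>x. fold (\<lambda>y s. y # s) (rev (k x)) (l x))"
  proof (rule pt_fold[OF pt_rev[OF assms(1)] assms(2)])
    show "poly_bounded e (\<lambda>x. vsize (eL eA (k x)) + vsize (eL eA (l x)))" by (intro pb_intros assms[THEN pt_size])
    show "vsize (eL eA (fold (#) ys (l x))) \<le> vsize (eL eA (k x)) + vsize (eL eA (l x))" if "rev (k x) = ys @ zs" for x ys zs
    proof -
      have "k x = rev zs @ rev ys" using that by (metis rev_append rev_rev_ident)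
      then show ?thesis by (simp add: fold_Cons_rev vsize_eL rev_map[symmetric] sum_list_rev)
    qed
  qed (rule pt_Cons pt_fst pt_snd pt_id pt_Nil)+
  then show ?thesis by (simp add: fold_Cons_rev)
qed

lemma pt_map:
  assumes l: "polytime e (eL e1) l" and h: "polytime (eP e e1) e2 (\<lambda>p. h (fst p) (snd p))"
  shows "polytime e (eL e2) (\<lambda>x. map (h x) (l x))"
proof -
  obtain C where C: "\<And>p. vsize (e2 (h (fst p) (snd p))) \<le> (vsize (eP e e1 p) + 1) ^ C"
    using pt_size[OF h] unfolding poly_bounded_def by blast
  let ?Xm = "\<lambda>x. (vsize (e x) + vsize (eL e1 (l x)) + 2) ^ C"
  have el: "vsize (e2 (h x y)) \<le> ?Xm x" if "y \<in> set (l x)" for x y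
  proof -
    have "vsize (e2 (h x y)) \<le> (vsize (eP e e1 (x, y)) + 1) ^ C" using C[of "(x, y)"] by simp
    also have "\<dots> \<le> ?Xm x" using vsize_mem[OF that, of e1] by (intro power_mono) (auto simp: eP_def)
    finally show ?thesis .
  qed
  have eq: "fold (\<lambda>y s. h x y # s) ys s = rev (map (h x) ys) @ s" for x ys s
    by (induction ys arbitrary: s) auto
  have "polytime e (eL e2) (\<lambda>x. rev (fold (\<lambda>y s. h x y # s) (l x) []))"
  proof (rule pt_rev, rule pt_fold[OF l])
    show "poly_bounded e (\<lambda>x. 1 + vsize (eL e1 (l x)) * (1 + ?Xm x))" by (intro pb_intros pt_size[OF l])
    show "vsize (eL e2 (fold (\<lambda>y s. h x y # s) ys [])) \<le> 1 + vsize (eL e1 (l x)) * (1 + ?Xm x)" if "l x = ys @ zs" for x ys zs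
    proof -
      have "sum_list (map (\<lambda>y. 1 + vsize (e2 (h x y))) ys) \<le> sum_list (map (\<lambda>y. 1 + ?Xm x) ys)"
        using el[of _ x] that by (intro sum_list_mono) auto
      also have "\<dots> = length ys * (1 + ?Xm x)" by (simp only: sum_list_triv map_replicate_const sum_list_replicate of_nat_id)
      also have "\<dots> \<le> vsize (eL e1 (l x)) * (1 + ?Xm x)" using that
        by (intro mult_right_mono) (auto simp: vsize_eL sum_list_Suc)
      finally show ?thesis unfolding eq by (simp add: vsize_eL rev_map[symmetric] sum_list_rev o_def)
    qed
    show "polytime (eP (eP e e1) (eL e2)) (eL e2) (\<lambda>p. h (fst (fst p)) (snd (fst p)) # snd p)"
      by (rule pt_Cons) (rule pt_comp[OF h, of _ fst, simplified], (rule pt_fst pt_snd pt_id)+)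
  qed (rule pt_Nil)
  then show ?thesis by (simp add: eq)
qed

lemma pt_filter:
  assumes l: "polytime e (eL e1) l" and h: "polytime (eP e e1) eB (\<lambda>p. h (fst p) (snd p))"
  shows "polytime e (eL e1) (\<lambda>x. filter (h x) (l x))"
proof -
  have eq: "fold (\<lambda>y s. if h x y then y # s else s) ys s = rev (filter (h x) ys) @ s" for x ys s
    by (induction ys arbitrary: s) auto
  have "polytime e (eL e1) (\<lambda>x. rev (fold (\<lambda>y s. if h x y then y # s else s) (l x) []))"
  proof (rule pt_rev, rule pt_fold[OF l])
    show "poly_bounded e (\<lambda>x. vsize (eL e1 (l x)))" by (rule pt_size[OF l])
    show "vsize (eL e1 (fold (\<lambda>y s. if h x y then y # s else s) ys [])) \<le> vsize (eL e1 (l x))" if "l x = ys @ zs" for x ys zs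
    proof -
      have "sum_list (map f (filter (h x) ys)) \<le> sum_list (map f ys)" for f :: "_ \<Rightarrow> nat"
        by (induction ys) auto
      then show ?thesis unfolding eq that by (simp add: vsize_eL rev_map[symmetric] sum_list_rev trans_le_add1)
    qed
    show "polytime (eP (eP e e1) (eL e1)) (eL e1) (\<lambda>p. if h (fst (fst p)) (snd (fst p)) then snd (fst p) # snd p else snd p)"
      by (rule pt_if) (rule pt_comp[OF h, of _ fst, simplified], (rule pt_Cons pt_fst pt_snd pt_id)+)
  qed (rule pt_Nil)
  then show ?thesis by (simp add: eq)
qed

lemma pt_bex:
  assumes l: "polytime e (eL e1) l" and h: "polytime (eP e e1) eB (\<lambda>p. h (fst p) (snd p))"
  shows "polytime e eB (\<lambda>x. \<exists>y\<in>set (l x). h x y)"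
  using pt_not[OF pt_null[OF pt_filter[OF assms]]] by (simp add: filter_empty_conv)

lemma pt_ball:
  assumes l: "polytime e (eL e1) l" and h: "polytime (eP e e1) eB (\<lambda>p. h (fst p) (snd p))"
  shows "polytime e eB (\<lambda>x. \<forall>y\<in>set (l x). h x y)"
  using pt_null[OF pt_filter[OF l pt_not[OF h]]] by (simp add: filter_empty_conv)

lemma pt_concat: assumes "polytime e (eL (eL eA)) l" shows "polytime e (eL eA) (\<lambda>x. concat (l x))"
proof -
  have eq: "fold (\<lambda>y s. s @ y) ys s = s @ concat ys" for ys and s :: "'c list"
    by (induction ys arbitrary: s) auto
  have "polytime e (eL eA) (\<lambda>x. fold (\<lambda>y s. s @ y) (l x) [])"
  proof (rule pt_fold[OF assms])
    show "poly_bounded e (\<lambda>x. vsize (eL (eL eA) (l x)))" by (rule pt_size[OF assms])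
    have "vsize (eL eA (concat ys)) \<le> vsize (eL (eL eA) ys)" for ys
    proof (induction ys)
      case (Cons y ys)
      then show ?case using vsize_eL_append[of eA y "concat ys"] by simp
    qed simp
    moreover have "vsize (eL (eL eA) ys) \<le> vsize (eL (eL eA) (ys @ zs))" for ys zs
      using vsize_eL_append[of "eL eA" ys zs] vsize_ge_1[of "eL (eL eA) zs"] by linarith
    ultimately show "vsize (eL eA (fold (\<lambda>y s. s @ y) ys [])) \<le> vsize (eL (eL eA) (l x))" if "l x = ys @ zs" for x ys zs
      unfolding eq that append_Nil by (meson le_trans)
  qed (rule pt_append pt_fst pt_snd pt_id pt_Nil)+
  then show ?thesis by (simp add: eq)
qed

lemma vsize_VNat_mono: "a \<le> b \<Longrightarrow> vsize (VNat a) \<le> vsize (VNat b)"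
  by (simp add: floorlog_mono)

lemma pb_vsize_nat: "poly_bounded e (\<lambda>x. f x) \<Longrightarrow> poly_bounded e (\<lambda>x. vsize (VNat (f x)))"
proof (rule pb_mono[where g = "\<lambda>x. 1 + f x"])
  show "vsize (VNat (f x)) \<le> 1 + f x" for x
    using floorlog_le[of "f x" "f x"] less_exp[of "f x"] by simp
qed (intro pb_intros)

text \<open>The list has as many elements as the value of \<open>a x\<close>, which can be
  exponential in its binary length; so the value itself must be polynomially bounded. Counting
  downwards yields the list in the right order.\<close>

lemma pt_upt: assumes a: "polytime e eN a" and b: "poly_bounded e a" shows "polytime e (eL eN) (\<lambda>x. [0..<a x])"
proof -
  let ?f = "\<lambda>(p :: nat \<times> nat list). (fst p - Suc 0, (fst p - Suc 0) # snd p)"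
  have it: "i \<le> k \<Longrightarrow> (?f ^^ i) (k, []) = (k - i, [k - i..<k])" for i k
    by (induction i) (auto simp: upt_conv_Cons Suc_diff_Suc)
  have "polytime e (eP eN (eL eN)) (\<lambda>x. (?f ^^ a x) (a x, []))"
  proof (rule pt_while[where b = "\<lambda>p. 0 < fst p" and B = "\<lambda>x. 2 + vsize (VNat (a x)) + a x * (1 + vsize (VNat (a x)))"])
    show "polytime (eP eN (eL eN)) eB (\<lambda>p. 0 < fst p)" by (intro pt_less pt_const_nat) (rule pt_fst pt_id)+
    show "polytime (eP eN (eL eN)) (eP eN (eL eN)) ?f"
      by (rule pt_Pair pt_diff pt_const_nat pt_Cons pt_fst pt_snd pt_id)+
    show "polytime e (eP eN (eL eN)) (\<lambda>x. (a x, []))" by (intro pt_Pair a pt_Nil)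
    show "poly_bounded e (\<lambda>x. 2 + vsize (VNat (a x)) + a x * (1 + vsize (VNat (a x))))" by (intro pb_intros b pb_vsize_nat[OF b])
    show "vsize (eP eN (eL eN) ((?f ^^ i) (a x, []))) \<le> 2 + vsize (VNat (a x)) + a x * (1 + vsize (VNat (a x)))" if i: "i \<le> a x" for x i
    proof -
      have "sum_list (map (\<lambda>y. 1 + vsize (VNat y)) [a x - i..<a x]) \<le> sum_list (map (\<lambda>y. 1 + vsize (VNat (a x))) [a x - i..<a x])"
        by (intro sum_list_mono add_left_mono vsize_VNat_mono) auto
      also have "\<dots> = i * (1 + vsize (VNat (a x)))" using i by (simp add: map_replicate_const sum_list_replicate)
      also have "\<dots> \<le> a x * (1 + vsize (VNat (a x)))" using i by (intro mult_right_mono) auto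
      finally have "vsize (eL eN [a x - i..<a x]) \<le> 1 + a x * (1 + vsize (VNat (a x)))" by (simp add: vsize_eL)
      moreover have "vsize (VNat (a x - i)) \<le> vsize (VNat (a x))" by (rule vsize_VNat_mono) simp
      ultimately show ?thesis unfolding it[OF i] eP_def by simp
    qed
  qed (auto simp: it b)
  from pt_snd[OF this] show ?thesis by (simp add: it)
qed

lemma pt_floorlog: assumes a: "polytime e eN a" shows "polytime e eN (\<lambda>x. floorlog 2 (a x))"
proof -
  let ?f = "\<lambda>(p :: nat \<times> nat). (fst p div 2, Suc (snd p))"
  have it: "(?f ^^ i) (k, j) = (k div 2 ^ i, j + i)" for i k j
    by (induction i) (auto simp: div_mult2_eq[symmetric] mult.commute)
  have less: "0 < k div 2 ^ i \<longleftrightarrow> i < floorlog 2 k" for k i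
  proof -
    have "0 < k div 2 ^ i \<longleftrightarrow> \<not> k < 2 ^ i" by (auto simp: div_greater_zero_iff)
    then show ?thesis using floorlog_le_iff[of 2 k i] by auto
  qed
  have "polytime e (eP eN eN) (\<lambda>x. (?f ^^ floorlog 2 (a x)) (a x, 0))"
  proof (rule pt_while[where b = "\<lambda>p. 0 < fst p" and B = "\<lambda>x. 1 + vsize (VNat (a x)) + vsize (VNat (vsize (VNat (a x))))"])
    show "polytime (eP eN eN) eB (\<lambda>p. 0 < fst p)" by (intro pt_less pt_const_nat) (rule pt_fst pt_id)+
    show "polytime (eP eN eN) (eP eN eN) ?f"
      by (rule pt_Pair pt_div pt_const_nat pt_Suc pt_fst pt_snd pt_id)+
    show "polytime e (eP eN eN) (\<lambda>x. (a x, 0))" by (intro pt_Pair a pt_const_nat)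
    show "poly_bounded e (\<lambda>x. 1 + vsize (VNat (a x)) + vsize (VNat (vsize (VNat (a x)))))" by (intro pb_intros pb_vsize_nat pt_size[OF a])
    show "poly_bounded e (\<lambda>x. floorlog 2 (a x))" by (rule pb_mono[OF pt_size[OF a]]) simp
    show "vsize (eP eN eN ((?f ^^ i) (a x, 0))) \<le> 1 + vsize (VNat (a x)) + vsize (VNat (vsize (VNat (a x))))" if i: "i \<le> floorlog 2 (a x)" for x i
      unfolding it eP_def using vsize_VNat_mono[of "a x div 2 ^ i" "a x"] vsize_VNat_mono[of i "vsize (VNat (a x))"] i by simp
  qed (simp_all add: it less)
  from pt_snd[OF this] show ?thesis by (simp add: it)
qed

lemma pt_sum_list: assumes "polytime e (eL eN) l" shows "polytime e eN (\<lambda>x. sum_list (l x))"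
proof -
  have eq: "fold (\<lambda>y s. y + s) ys s = sum_list ys + (s::nat)" for ys s
    by (induction ys arbitrary: s) auto
  have sz: "vsize (VNat (sum_list ys)) \<le> vsize (eL eN ys)" for ys
  proof (induction ys)
    case (Cons y ys)
    then show ?case using floorlog_arith[of Add y "sum_list ys"] by simp
  qed (simp add: floorlog_def)
  have "polytime e eN (\<lambda>x. fold (\<lambda>y s. y + s) (l x) 0)"
  proof (rule pt_fold[OF assms])
    show "poly_bounded e (\<lambda>x. vsize (eL eN (l x)))" by (rule pt_size[OF assms])
    show "vsize (VNat (fold (+) ys 0)) \<le> vsize (eL eN (l x))" if "l x = ys @ zs" for x ys zs
    proof -
      have "vsize (eL eN ys) \<le> vsize (eL eN (ys @ zs))"
        using vsize_eL_append[of eN ys zs] vsize_ge_1[of "eL eN zs"] by linarith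
      then show ?thesis unfolding eq that using sz[of ys] by simp
    qed
  qed (rule pt_add pt_fst pt_snd pt_id pt_const_nat)+
  then show ?thesis by (simp add: eq)
qed

lemma pt_sum:
  assumes "polytime e eN f" "poly_bounded e f" "polytime (eP e eN) eN (\<lambda>p. g (fst p) (snd p))"
  shows "polytime e eN (\<lambda>x. \<Sum>i<f x. g x i)"
  using pt_sum_list[OF pt_map[OF pt_upt[OF assms(1,2)] assms(3)]]
  by (simp add: interv_sum_list_conv_sum_set_nat atLeast0LessThan)

lemma pt_length: assumes "polytime e (eL eA) l" shows "polytime e eN (\<lambda>x. length (l x))"
  using pt_sum_list[OF pt_map[OF assms pt_const_nat[of _ 1]]] by (simp add: sum_list_triv)

lemma pt_ex_less:
  assumes "polytime e eN f" "poly_bounded e f" "polytime (eP e eN) eB (\<lambda>p. g (fst p) (snd p))"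
  shows "polytime e eB (\<lambda>x. \<exists>i<f x. g x i)"
  using pt_bex[OF pt_upt[OF assms(1,2)] assms(3)] by (simp add: Bex_def)

lemma pt_all_less:
  assumes "polytime e eN f" "poly_bounded e f" "polytime (eP e eN) eB (\<lambda>p. g (fst p) (snd p))"
  shows "polytime e eB (\<lambda>x. \<forall>i<f x. g x i)"
  using pt_ball[OF pt_upt[OF assms(1,2)] assms(3)] by (simp add: Ball_def)

lemma pt_power: assumes a: "polytime e eN a" and k: "polytime e eN k" "poly_bounded e k" shows "polytime e eN (\<lambda>x. a x ^ k x)"
proof -
  have eq: "fold (\<lambda>_ s. c * s) ys s = c ^ length ys * (s::nat)" for c s and ys :: "nat list"
    by (induction ys arbitrary: s) auto
  have "polytime e eN (\<lambda>x. fold (\<lambda>_ s. a x * s) [0..<k x] 1)"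
  proof (rule pt_fold[OF pt_upt[OF k]])
    show "poly_bounded e (\<lambda>x. 2 + vsize (VNat (a x)) * k x)" by (intro pb_intros pt_size[OF a] k)
    show "vsize (VNat (fold (\<lambda>_ s. a x * s) ys 1)) \<le> 2 + vsize (VNat (a x)) * k x" if "[0..<k x] = ys @ zs" for x ys zs
    proof -
      have l: "length ys \<le> k x" using arg_cong[OF that, of length] by simp
      have "a x ^ length ys \<le> (2 ^ floorlog 2 (a x)) ^ length ys" using less_two_power_floorlog[of "a x"] by (intro power_mono) auto
      also have "\<dots> = 2 ^ (floorlog 2 (a x) * length ys)" by (simp add: power_mult)
      also have "\<dots> < 2 ^ (floorlog 2 (a x) * length ys + 1)" by simp
      finally have "floorlog 2 (a x ^ length ys) \<le> floorlog 2 (a x) * length ys + 1" by (rule floorlog_le)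
      also have "\<dots> \<le> vsize (VNat (a x)) * k x + 1" using l by (intro add_right_mono mult_le_mono) auto
      finally show ?thesis unfolding eq by simp
    qed
    show "polytime (eP (eP e eN) eN) eN (\<lambda>p. a (fst (fst p)) * snd p)"
      by (rule pt_mult) (rule pt_comp[OF a] pt_fst pt_snd pt_id)+
  qed (rule pt_const_nat)
  then show ?thesis by (simp add: eq)
qed

definition nth_or :: "'a \<Rightarrow> 'a list \<Rightarrow> nat \<Rightarrow> 'a" where "nth_or d xs i = hd_or d (drop i xs)"

lemma nth_or_nth [simp]: "i < length xs \<Longrightarrow> nth_or d xs i = xs ! i"
  by (simp add: nth_or_def hd_or_def Cons_nth_drop_Suc[symmetric])
lemma nth_or_out [simp]: "length xs \<le> i \<Longrightarrow> nth_or d xs i = d"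
  by (simp add: nth_or_def hd_or_def)

text \<open>The fold runs over the list and not up to the index, whose value may be exponential in
  the size of the input.\<close>

lemma pt_drop: assumes l: "polytime e (eL eA) l" and i: "polytime e eN i" shows "polytime e (eL eA) (\<lambda>x. drop (i x) (l x))"
proof -
  let ?g = "\<lambda>(_::'c) (p :: nat \<times> 'c list). (fst p - 1, if fst p = 0 then snd p else tl (snd p))"
  have eq: "fold ?g ys (k, zs) = (k - length ys, drop (min k (length ys)) zs)" for ys k zs
  proof (induction ys arbitrary: k zs)
    case (Cons y ys)
    then show ?case by (cases k) (auto simp: drop_Suc)
  qed auto
  have "polytime e (eP eN (eL eA)) (\<lambda>x. fold ?g (l x) (i x, l x))"
  proof (rule pt_fold[OF l])
    show "polytime e (eP eN (eL eA)) (\<lambda>x. (i x, l x))" by (intro pt_Pair i l)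
    show "poly_bounded e (\<lambda>x. 1 + vsize (VNat (i x)) + vsize (eL eA (l x)))" by (intro pb_intros pt_size[OF l] pt_size[OF i])
    show "vsize (eP eN (eL eA) (fold ?g ys (i x, l x))) \<le> 1 + vsize (VNat (i x)) + vsize (eL eA (l x))" for x ys
    proof -
      have "vsize (eL eA (drop k (l x))) \<le> vsize (eL eA (l x))" for k
        using vsize_eL_append[of eA "take k (l x)" "drop k (l x)"] vsize_ge_1[of "eL eA (take k (l x))"]
        unfolding append_take_drop_id by linarith
      moreover have "vsize (VNat (i x - length ys)) \<le> vsize (VNat (i x))" by (rule vsize_VNat_mono) simp
      ultimately show ?thesis unfolding eq by (simp add: eP_def add_mono)
    qed
    show "polytime (eP (eP e eA) (eP eN (eL eA))) (eP eN (eL eA))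
       (\<lambda>p. (fst (snd p) - 1, if fst (snd p) = 0 then snd (snd p) else tl (snd (snd p))))"
      by (rule pt_Pair pt_diff pt_const_nat pt_if pt_eq pt_tl pt_fst pt_snd pt_id)+
  qed
  from pt_snd[OF this] have "polytime e (eL eA) (\<lambda>x. drop (min (i x) (length (l x))) (l x))" unfolding eq snd_conv .
  moreover have "(\<lambda>x. drop (min (i x) (length (l x))) (l x)) = (\<lambda>x. drop (i x) (l x))" by (auto simp: min_def)
  ultimately show ?thesis by simp
qed

lemma pt_nth_or: "polytime e (eL eA) l \<Longrightarrow> polytime e eA d \<Longrightarrow> polytime e eN i \<Longrightarrow> polytime e eA (\<lambda>x. nth_or (d x) (l x) (i x))"
  unfolding nth_or_def by (intro pt_hd_or pt_drop)

section \<open>Binary fields\<close>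

definition digit :: "nat \<Rightarrow> nat \<Rightarrow> nat \<Rightarrow> nat" where "digit B a i = a div B ^ i mod B"

definition undigits :: "nat \<Rightarrow> nat \<Rightarrow> (nat \<Rightarrow> nat) \<Rightarrow> nat" where "undigits B d c = (\<Sum>i<d. c i * B ^ i)"

lemma digit_less: "0 < B \<Longrightarrow> digit B a i < B"
  by (simp add: digit_def)

lemma undigits_Suc: "undigits B (Suc d) c = c 0 + B * undigits B d (\<lambda>i. c (Suc i))"
  unfolding undigits_def sum.lessThan_Suc_shift sum_distrib_left by (simp add: algebra_simps)

lemma digit_Suc: "digit B a (Suc i) = digit B (a div B) i"
  by (simp add: digit_def div_mult2_eq)

lemma undigits_less: assumes "\<And>i. i < d \<Longrightarrow> c i < B" shows "undigits B d c < B ^ d"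
  using assms
proof (induction d arbitrary: c)
  case (Suc d)
  have "c 0 < B" using Suc.prems by blast
  moreover have "undigits B d (\<lambda>i. c (Suc i)) < B ^ d" using Suc.prems by (intro Suc.IH) auto
  then have "undigits B d (\<lambda>i. c (Suc i)) + 1 \<le> B ^ d" by simp
  then have "B * (undigits B d (\<lambda>i. c (Suc i)) + 1) \<le> B * B ^ d" by (rule mult_left_mono) simp
  ultimately show ?case by (simp add: undigits_Suc)
qed (simp add: undigits_def)

lemma digit_undigits: assumes "\<And>i. i < d \<Longrightarrow> c i < B" "i < d" shows "digit B (undigits B d c) i = c i"
  using assms
proof (induction d arbitrary: c i)
  case (Suc d)
  have c0: "c 0 < B" using Suc.prems by blast
  show ?case
  proof (cases i)
    case 0
    then show ?thesis using c0 by (simp add: digit_def undigits_Suc)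
  next
    case (Suc j)
    have "undigits B (Suc d) c div B = undigits B d (\<lambda>i. c (Suc i))" using c0 by (simp add: undigits_Suc)
    then show ?thesis using Suc.IH[of "\<lambda>i. c (Suc i)" j] Suc.prems Suc by (simp add: digit_Suc)
  qed
qed simp

lemma undigits_digit: "a < B ^ d \<Longrightarrow> undigits B d (digit B a) = a"
proof (induction d arbitrary: a)
  case (Suc d)
  have "a div B < B ^ d" using Suc.prems by (metis less_mult_imp_div_less mult.commute power_Suc)
  then have "undigits B d (digit B (a div B)) = a div B" by (rule Suc.IH)
  then show ?case by (simp add: undigits_Suc digit_Suc) (simp add: digit_def)
qed (simp add: undigits_def)

lemma digit_eq_imp_eq: assumes "a < B ^ d" "b < B ^ d" "\<And>i. i < d \<Longrightarrow> digit B a i = digit B b i" shows "a = b"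
proof -
  have "undigits B d (digit B a) = undigits B d (digit B b)" unfolding undigits_def using assms(3) by simp
  then show ?thesis using assms by (simp add: undigits_digit)
qed

lemma digit_zero [simp]: "digit B 0 i = 0" by (simp add: digit_def)

text \<open>An element of GF(2^d) is a number below 2^d, whose binary digits are the coordinates in the
  basis 1, \<open>\<theta>\<close>, ..., \<open>\<theta>\<close>^(d-1). The number \<open>f\<close> represents \<open>\<theta>\<close>^d.\<close>

definition fadd :: "nat \<Rightarrow> nat \<Rightarrow> nat \<Rightarrow> nat" where
  "fadd d a b = undigits 2 d (\<lambda>i. (digit 2 a i + digit 2 b i) mod 2)"

text \<open>Multiplication by \<open>\<theta>\<close>: doubling shifts the coordinates,
  \<open>fadd\<close> ignores the digit that leaves at position \<open>d\<close>, and that digit is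
  put back as a multiple of \<open>f\<close>.\<close>

definition mulx :: "nat \<Rightarrow> nat \<Rightarrow> nat \<Rightarrow> nat" where
  "mulx d f y = fadd d (2 * y) (digit 2 y (d - 1) * f)"

text \<open>Horner's scheme in \<open>\<theta>\<close>, from the highest digit of \<open>a\<close>
  downwards.\<close>

definition fmul :: "nat \<Rightarrow> nat \<Rightarrow> nat \<Rightarrow> nat \<Rightarrow> nat" where
  "fmul d f a b = fold (\<lambda>i s. fadd d (mulx d f s) (digit 2 a (d - 1 - i) * b)) [0..<d] 0"

lemma fadd_less: "fadd d a b < 2 ^ d"
  unfolding fadd_def by (rule undigits_less) simp

lemma fmul_less: "fmul d f a b < 2 ^ d"
proof -
  have "fold (\<lambda>i s. fadd d (mulx d f s) (digit 2 a (d - 1 - i) * b)) [0..<k] 0 < 2 ^ d" for k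
    by (cases k) (auto simp: fadd_less)
  then show ?thesis unfolding fmul_def .
qed

lemma digit_fadd: "i < d \<Longrightarrow> digit 2 (fadd d a b) i = (digit 2 a i + digit 2 b i) mod 2"
  unfolding fadd_def by (rule digit_undigits) auto

definition fval :: "'k::field \<Rightarrow> nat \<Rightarrow> nat \<Rightarrow> 'k" where
  "fval \<theta> d a = (\<Sum>i<d. of_nat (digit 2 a i) * \<theta> ^ i)"

lemma dig2_cases: "digit 2 a i = 0 \<or> digit 2 a i = 1"
  using digit_less[of 2 a i] by auto

context
  assumes c2: "1 + 1 = (0 :: 'k::field)"
begin

lemma char2_add_self: "x + x = (0 :: 'k)"
proof -
  have "x + x = x * (1 + 1)" by (simp add: algebra_simps)
  then show ?thesis using c2 by simp
qed

lemma char2_add_eq_0_iff: "x + y = 0 \<longleftrightarrow> x = (y :: 'k)"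
  using char2_add_self by (metis add_left_cancel)

lemma char2_of_nat_mod: "of_nat (n mod 2) = (of_nat n :: 'k)"
proof -
  have "of_nat n = (of_nat (2 * (n div 2) + n mod 2) :: 'k)" by simp
  also have "\<dots> = (1 + 1) * of_nat (n div 2) + of_nat (n mod 2)" by (simp only: of_nat_add of_nat_mult) simp
  finally show ?thesis using c2 by simp
qed

lemma char2_frob: "((x :: 'k) + y) ^ (2 ^ n) = x ^ (2 ^ n) + y ^ (2 ^ n)"
proof (induction n)
  case (Suc n)
  have sq: "(a + b) ^ 2 = a ^ 2 + b ^ 2" for a b :: 'k
    using char2_add_self[of "a * b"] by (simp add: power2_eq_square algebra_simps)
  show ?case using Suc by (simp add: power_mult mult.commute[of 2] sq)
qed simp

lemma char2_frob_inj: "(x :: 'k) ^ (2 ^ n) = y ^ (2 ^ n) \<Longrightarrow> x = y"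
proof -
  assume "x ^ (2 ^ n) = y ^ (2 ^ n)"
  then have "(x + y) ^ (2 ^ n) = 0" by (simp add: char2_frob char2_add_self)
  then show "x = y" using char2_add_eq_0_iff by simp
qed

lemma char2_frob_sum: "(\<Sum>i<(d::nat). (g i :: 'k)) ^ (2 ^ n) = (\<Sum>i<d. g i ^ (2 ^ n))"
  by (induction d) (simp_all add: char2_frob power_0_left)

lemma fval_fadd: "fval (\<theta>::'k) d (fadd d a b) = fval \<theta> d a + fval \<theta> d b"
  unfolding fval_def by (simp add: digit_fadd char2_of_nat_mod sum.distrib algebra_simps)

lemma fval_bit: "fval (\<theta>::'k) d (digit 2 a i * b) = of_nat (digit 2 a i) * fval \<theta> d b"
  using dig2_cases[of a i] by (auto simp: fval_def)

lemma fval_mulx: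
  assumes "\<theta> ^ d = fval (\<theta>::'k) d f" "0 < d"
  shows "fval \<theta> d (mulx d f y) = \<theta> * fval \<theta> d y"
proof -
  obtain e where d: "d = Suc e" using assms(2) by (cases d) auto
  have "fval \<theta> d (2 * y) = (\<Sum>i<e. of_nat (digit 2 y i) * \<theta> ^ Suc i)"
    unfolding fval_def d sum.lessThan_Suc_shift by (simp add: digit_Suc) (simp add: digit_def)
  also have "\<dots> + of_nat (digit 2 y e) * \<theta> ^ d = \<theta> * fval \<theta> d y"
    by (simp add: fval_def d sum_distrib_left algebra_simps)
  finally show ?thesis unfolding mulx_def fval_fadd fval_bit using assms by (simp add: d)
qed

lemma fval_fmul:
  assumes "\<theta> ^ d = fval (\<theta>::'k) d f"  "0 < d"
  shows "fval \<theta> d (fmul d f a b) = fval \<theta> d a * fval \<theta> d b"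
proof -
  \<comment> \<open>Invariant of Horner's scheme: after \<open>k\<close> rounds the top
    \<open>k\<close> digits of \<open>a\<close> have been consumed.\<close>
  have "k \<le> d \<Longrightarrow> fval \<theta> d (fold (\<lambda>i s. fadd d (mulx d f s) (digit 2 a (d - 1 - i) * b)) [0..<k] 0) =
    (\<Sum>i<k. of_nat (digit 2 a (d - k + i)) * \<theta> ^ i) * fval \<theta> d b" for k
  proof (induction k)
    case 0
    then show ?case by (simp add: fval_def)
  next
    case (Suc k)
    then have eq: "Suc (d - Suc k) = d - k" by simp
    have "(\<Sum>i<Suc k. of_nat (digit 2 a (d - Suc k + i)) * \<theta> ^ i) =
       of_nat (digit 2 a (d - Suc k)) + \<theta> * (\<Sum>i<k. of_nat (digit 2 a (d - k + i)) * \<theta> ^ i)"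
      unfolding sum.lessThan_Suc_shift sum_distrib_left by (simp add: eq[symmetric] ac_simps)
    then show ?case using Suc
      by (simp add: fval_fadd fval_mulx[OF assms] fval_bit del: sum.lessThan_Suc) (simp add: distrib_right mult.assoc add.commute)
  qed
  from this[of d] show ?thesis unfolding fmul_def by (simp add: fval_def)
qed

end

text \<open>This condition can be tested by brute force. It suffices because the map \<open>fval \<theta> d\<close> is then injective
  for every \<open>\<theta>\<close> that satisfies \<open>\<theta>^d = fval \<theta> d f\<close>.\<close>

definition is_gf_modulus :: "nat \<Rightarrow> nat \<Rightarrow> bool" where
  "is_gf_modulus d f \<longleftrightarrow> (\<forall>a<2 ^ d. a \<noteq> 0 \<longrightarrow> (\<exists>b<2 ^ d. fmul d f a b = 1))"

text \<open>Reasoning about the arithmetic on numbers goes through the embedding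
  \<open>\<phi>\<close>: equations are proved in a genuine field of characteristic 2 and pulled back
  by injectivity.\<close>

locale gf =
  fixes d f :: nat and \<phi> :: "nat \<Rightarrow> 'k::field"
  assumes c2: "1 + 1 = (0 :: 'k)" and d: "0 < d" and \<phi>0: "\<phi> 0 = 0" and \<phi>1: "\<phi> 1 = 1"
    and \<phi>add: "\<And>a b. \<phi> (fadd d a b) = \<phi> a + \<phi> b" and \<phi>mul: "\<And>a b. \<phi> (fmul d f a b) = \<phi> a * \<phi> b"
    and inj: "inj_on \<phi> {..<2 ^ d}" and gf: "is_gf_modulus d f"

lemma fval_0: "fval \<theta> d 0 = 0" by (simp add: fval_def)

lemma fval_1: assumes "0 < d" shows "fval \<theta> d 1 = 1"
proof -
  obtain e where d: "d = Suc e" using assms by (cases d) auto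
  have "digit 2 1 (Suc i) = 0" for i by (simp add: digit_Suc)
  then show ?thesis by (simp add: fval_def d sum.lessThan_Suc_shift del: sum.lessThan_Suc) (simp add: digit_def)
qed

lemma fadd_eq_0: assumes "a < 2 ^ d" "b < 2 ^ d" "fadd d a b = 0" shows "a = b"
proof (rule digit_eq_imp_eq[OF assms(1,2)])
  fix i assume "i < d"
  then have "(digit 2 a i + digit 2 b i) mod 2 = 0" using assms(3) digit_fadd[of i d a b] by simp
  then show "digit 2 a i = digit 2 b i" using dig2_cases[of a i] dig2_cases[of b i] by auto
qed

text \<open>Any root \<open>\<theta>\<close> of X^d + f will do. Evaluation at
  \<open>\<theta>\<close> is multiplicative, so a number with an inverse cannot be mapped to
  0.\<close>

lemma is_gf_modulus_imp_gf:
  assumes c2: "1 + 1 = (0 :: 'k::alg_closed_field)" and "0 < d" "is_gf_modulus d f"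
  shows "\<exists>\<phi>. gf d f (\<phi> :: nat \<Rightarrow> 'k)"
proof -
  let ?c = "\<lambda>i. if i = d then 1 else of_nat (digit 2 f i) :: 'k"
  obtain \<theta> where "(\<Sum>k\<le>d. ?c k * \<theta> ^ k) = 0"
    using alg_closed[of d ?c] assms(2) by auto
  moreover have "(\<Sum>k\<le>d. ?c k * \<theta> ^ k) = fval \<theta> d f + \<theta> ^ d"
    unfolding fval_def lessThan_Suc_atMost[symmetric] by simp
  ultimately have \<theta>: "\<theta> ^ d = fval \<theta> d f" using char2_add_eq_0_iff[OF c2] by metis
  have 0: "a = 0" if "a < 2 ^ d" "fval \<theta> d a = 0" for a
  proof (rule ccontr)
    assume "a \<noteq> 0"
    with that(1) assms(3) obtain b where "fmul d f a b = 1" unfolding is_gf_modulus_def by blast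
    then have "fval \<theta> d a * fval \<theta> d b = 1" using fval_fmul[OF c2 \<theta> assms(2), of a b] fval_1[OF assms(2), of \<theta>] by simp
    then show False using that by simp
  qed
  have "inj_on (fval \<theta> d) {..<2 ^ d}"
  proof (rule inj_onI)
    fix a b assume *: "a \<in> {..<2 ^ d}" "b \<in> {..<2 ^ d}" "fval \<theta> d a = fval \<theta> d b"
    then have "fval \<theta> d (fadd d a b) = 0" by (simp add: fval_fadd[OF c2] char2_add_self[OF c2])
    then show "a = b" using * 0 fadd_less fadd_eq_0 by blast
  qed
  then have *: "gf d f (fval \<theta> d)"
    using assms by unfold_locales (simp_all only: fval_0 fval_1 fval_fadd[OF c2] fval_fmul[OF c2 \<theta> assms(2)])
  show ?thesis by (rule exI, rule *)
qed

text \<open>The polynomial X^(2^d) + X has derivative 1, so none of its roots is multiple.\<close>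

lemma card_frob_fixed:
  assumes c2: "1 + 1 = (0 :: 'k::alg_closed_field)" and "0 < d"
  shows "finite {x :: 'k. x ^ (2 ^ d) = x}" "card {x :: 'k. x ^ (2 ^ d) = x} = 2 ^ d"
proof -
  define p :: "'k poly" where "p = Polynomial.monom 1 (2 ^ d) + [:0, 1:]"
  have two: "(2::nat) \<le> 2 ^ d" using assms(2) self_le_power[of 2 d] by simp
  have deg: "Polynomial.degree p = 2 ^ d" unfolding p_def using two by (subst degree_add_eq_left) (auto simp: degree_monom_eq)
  then have p0: "p \<noteq> 0" by auto
  have "poly p x = x ^ (2 ^ d) + x" for x unfolding p_def by (simp add: poly_monom)
  then have roots: "poly p x = 0 \<longleftrightarrow> x ^ (2 ^ d) = x" for x using char2_add_eq_0_iff[OF c2] by auto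
  have "of_nat (2 ^ d) = (0::'k)" using char2_of_nat_mod[OF c2, of "2 ^ d"] assms(2) by simp
  then have "pderiv p = 1"
    unfolding p_def by (simp add: pderiv_add pderiv_monom pderiv_pCons del: of_nat_power)
  obtain A where A: "size A = Polynomial.degree p" "p = Polynomial.smult (Polynomial.lead_coeff p) (\<Prod>x\<in>#A. [:-x, 1:])"
    using alg_closed_imp_factorization[OF p0] by blast
  have lc: "Polynomial.lead_coeff p \<noteq> 0" using p0 by simp
  have "poly p x = Polynomial.lead_coeff p * (\<Prod>y\<in>#A. x - y)" for x
    by (subst A(2)) (simp add: poly_prod_mset image_mset.compositionality o_def)
  then have set: "set_mset A = {x. x ^ (2 ^ d) = x}" using lc by (auto simp: roots[symmetric])
  have "count A a = 1" if a: "a \<in># A" for a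
  proof (rule ccontr)
    assume "count A a \<noteq> 1"
    moreover have "0 < count A a" using a by simp
    ultimately have "2 \<le> count A a" by linarith
    then have "a \<in># A - {#a#}" by (simp add: count_greater_zero_iff[symmetric] del: count_greater_zero_iff)
    with a obtain B where "A = add_mset a (add_mset a B)" by (metis insert_DiffM)
    then have "p = [:-a, 1:] * ([:-a, 1:] * Polynomial.smult (Polynomial.lead_coeff p) (\<Prod>x\<in>#B. [:-x, 1:]))"
      by (subst A(2)) simp
    then obtain q where "p = [:-a, 1:] * ([:-a, 1:] * q)" by blast
    moreover have "poly (pderiv ([:-a, 1:] * ([:-a, 1:] * q))) a = 0"
      by (simp only: pderiv_mult poly_add poly_mult) simp
    ultimately have "poly (pderiv p) a = 0" by (simp only:)
    then show False using \<open>pderiv p = 1\<close> by simp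
  qed
  then have "size A = card (set_mset A)" by (simp add: size_multiset_overloaded_eq)
  then show "finite {x :: 'k. x ^ (2 ^ d) = x}" "card {x :: 'k. x ^ (2 ^ d) = x} = 2 ^ d"
    using A(1) deg set finite_set_mset[of A] by simp_all
qed

text \<open>GF(2^d) is realised as the set of fixed points of the d-th Frobenius power in the
  algebraic closure of GF(2). The fixed points for all smaller positive exponents number less than
  2^d together, so some \<open>\<theta>\<close> lies in none of those sets and generates the
  field.\<close>

lemma is_gf_modulus_exists:
  assumes "0 < d" shows "\<exists>f<2 ^ d. is_gf_modulus d f"
proof -
  let ?K = "\<lambda>e. {x :: bit alg_closure. x ^ (2 ^ e) = x}"
  have "to_ac (1 + 1 :: bit) = 1 + 1" by (simp only: to_ac_add to_ac_1)
  then have c2: "1 + 1 = (0 :: bit alg_closure)" by simp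
  have "card (\<Union>e\<in>{1..<d}. ?K e) \<le> (\<Sum>e\<in>{1..<d}. card (?K e))" by (rule card_UN_le) simp
  also have "\<dots> = (\<Sum>e\<in>{1..<d}. 2 ^ e)" using card_frob_fixed(2)[OF c2] by (intro sum.cong) auto
  also have "\<dots> \<le> (\<Sum>e<d. 2 ^ e)" by (intro sum_mono2) auto
  also have "\<dots> < (2::nat) ^ d" using sum_power2[of d] by (simp add: atLeast0LessThan)
  finally have "card (\<Union>e\<in>{1..<d}. ?K e) < card (?K d)" using card_frob_fixed(2)[OF c2 assms] by simp
  then have "\<not> ?K d \<subseteq> (\<Union>e\<in>{1..<d}. ?K e)"
    using card_mono[of "\<Union>e\<in>{1..<d}. ?K e" "?K d"] card_frob_fixed(1)[OF c2] by fastforce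
  then obtain \<theta> where t: "\<theta> \<in> ?K d" "\<theta> \<notin> (\<Union>e\<in>{1..<d}. ?K e)" by blast
  then have \<theta>: "\<theta> ^ (2 ^ d) = \<theta>" "\<And>e. 1 \<le> e \<Longrightarrow> e < d \<Longrightarrow> \<theta> ^ (2 ^ e) \<noteq> \<theta>" by auto
  \<comment> \<open>If two of the conjugates agreed, \<open>\<theta>\<close> would be fixed by a
    smaller Frobenius power.\<close>
  have ne: "\<theta> ^ (2 ^ i) \<noteq> \<theta> ^ (2 ^ j)" if "i < j" "j < d" for i j
  proof
    assume "\<theta> ^ (2 ^ i) = \<theta> ^ (2 ^ j)"
    also have "\<theta> ^ (2 ^ j) = (\<theta> ^ (2 ^ (j - i))) ^ (2 ^ i)"
      using that by (simp add: power_mult[symmetric] power_add[symmetric])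
    finally have "\<theta> = \<theta> ^ (2 ^ (j - i))" by (rule char2_frob_inj[OF c2])
    moreover have "1 \<le> j - i" "j - i < d" using that by auto
    ultimately show False using \<theta>(2)[of "j - i"] by simp
  qed
  then have conj: "inj_on (\<lambda>i. \<theta> ^ (2 ^ i)) {..<d}"
    by (intro inj_onI) (metis lessThan_iff linorder_neqE_nat)
  \<comment> \<open>A polynomial over GF(2) that vanishes at \<open>\<theta>\<close> also vanishes
    at its \<open>d\<close> distinct conjugates, which is too many for a degree below
    \<open>d\<close>.\<close>
  have 0: "c = 0" if c: "c < 2 ^ d" "fval \<theta> d c = 0" for c
  proof -
    define p where "p = (\<Sum>i<d. Polynomial.monom (of_nat (digit 2 c i) :: bit alg_closure) i)"
    have ev: "poly p x = (\<Sum>i<d. of_nat (digit 2 c i) * x ^ i)" for x by (simp add: p_def poly_sum poly_monom)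
    have "poly p (\<theta> ^ (2 ^ j)) = 0" for j
    proof -
      have "poly p (\<theta> ^ (2 ^ j)) = (\<Sum>i<d. (of_nat (digit 2 c i) * \<theta> ^ i) ^ (2 ^ j))"
        unfolding ev
      proof (rule sum.cong[OF refl])
        fix i
        show "of_nat (digit 2 c i) * (\<theta> ^ 2 ^ j) ^ i = (of_nat (digit 2 c i) * \<theta> ^ i) ^ 2 ^ j"
          using dig2_cases[of c i] power_mult[of \<theta> "2 ^ j" i] power_mult[of \<theta> i "2 ^ j"]
          by (auto simp: mult.commute power_0_left)
      qed
      also have "\<dots> = fval \<theta> d c ^ (2 ^ j)" by (simp add: char2_frob_sum[OF c2] fval_def)
      finally show ?thesis using c by simp
    qed
    then have sub: "(\<lambda>i. \<theta> ^ (2 ^ i)) ` {..<d} \<subseteq> {x. poly p x = 0}" by auto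
    have "p = 0"
    proof (rule ccontr)
      assume "p \<noteq> 0"
      then have "d \<le> card {x. poly p x = 0}"
        using card_mono[OF poly_roots_finite sub] card_image[OF conj] by simp
      also have "\<dots> \<le> Polynomial.degree p" using \<open>p \<noteq> 0\<close> by (rule card_poly_roots_bound)
      also have "\<dots> \<le> d - 1" unfolding p_def by (intro degree_sum_le) (auto intro: order_trans[OF degree_monom_le])
      finally show False using assms by simp
    qed
    have "digit 2 c i = 0" if "i < d" for i
    proof -
      have "Polynomial.coeff p i = of_nat (digit 2 c i)" using that by (simp add: p_def coeff_sum if_distrib cong: if_cong)
      then show ?thesis using \<open>p = 0\<close> dig2_cases[of c i] by auto
    qed
    then show ?thesis using c(1) digit_eq_imp_eq[of c 2 d 0] by simp
  qed
  have inj: "inj_on (fval \<theta> d) {..<2 ^ d}"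
  proof (rule inj_onI)
    fix a b assume *: "a \<in> {..<2 ^ d}" "b \<in> {..<2 ^ d}" "fval \<theta> d a = fval \<theta> d b"
    then have "fval \<theta> d (fadd d a b) = 0" by (simp add: fval_fadd[OF c2] char2_add_self[OF c2])
    then show "a = b" using * 0 fadd_less fadd_eq_0 by blast
  qed
  have swap: "(\<theta> ^ i) ^ (2 ^ d) = (\<theta> ^ (2 ^ d)) ^ i" for i
    by (simp only: power_mult[symmetric] mult.commute)
  have "fval \<theta> d ` {..<2 ^ d} \<subseteq> ?K d"
  proof clarify
    fix a :: nat
    have "(of_nat (digit 2 a i) * \<theta> ^ i) ^ (2 ^ d) = of_nat (digit 2 a i) * \<theta> ^ i" for i
      using dig2_cases[of a i] swap[of i] \<theta>(1) by (auto simp: power_0_left)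
    then show "fval \<theta> d a ^ (2 ^ d) = fval \<theta> d a" unfolding fval_def char2_frob_sum[OF c2] by simp
  qed
  \<comment> \<open>By counting, the coordinate map reaches the whole field, in particular
    \<open>\<theta> ^ d\<close>; the number mapped to it is the modulus \<open>f\<close>.\<close>
  then have img: "fval \<theta> d ` {..<2 ^ d} = ?K d"
    using card_frob_fixed[OF c2 assms] card_image[OF inj] by (intro card_subset_eq) auto
  have "\<theta> ^ d \<in> ?K d" using swap[of d] \<theta>(1) by simp
  then obtain f where f: "f < 2 ^ d" "\<theta> ^ d = fval \<theta> d f" unfolding img[symmetric] by auto
  have "\<exists>b<2 ^ d. fmul d f a b = 1" if a: "a < 2 ^ d" "a \<noteq> 0" for a
  proof -
    \<comment> \<open>Multiplication by a nonzero \<open>a\<close> is injective on a finite set,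
      hence a permutation that attains 1.\<close>
    have "inj_on (fmul d f a) {..<2 ^ d}"
    proof (rule inj_onI)
      fix x y assume *: "x \<in> {..<2 ^ d}" "y \<in> {..<2 ^ d}" "fmul d f a x = fmul d f a y"
      have "fval \<theta> d a * fval \<theta> d x = fval \<theta> d a * fval \<theta> d y"
        using arg_cong[OF *(3), of "fval \<theta> d"] unfolding fval_fmul[OF c2 f(2) assms] .
      moreover have "fval \<theta> d a \<noteq> 0" using a(2) by (rule contrapos_nn) (rule 0[OF a(1)])
      ultimately have "fval \<theta> d x = fval \<theta> d y" by simp
      then show "x = y" using * inj by (simp add: inj_on_def)
    qed
    then have "fmul d f a ` {..<2 ^ d} = {..<2 ^ d}" by (intro endo_inj_surj) (auto simp: fmul_less)
    moreover have "1 \<in> {..<(2::nat) ^ d}" using assms one_less_power[of "2::nat" d] by simp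
    ultimately have "1 \<in> fmul d f a ` {..<2 ^ d}" by simp
    then show ?thesis by auto
  qed
  then show ?thesis using f(1) unfolding is_gf_modulus_def by blast
qed

section \<open>Decoding of errors and erasures\<close>

definition fsum :: "nat \<Rightarrow> nat list \<Rightarrow> nat" where "fsum d xs = fold (\<lambda>x s. fadd d x s) xs 0"

definition fpow :: "nat \<Rightarrow> nat \<Rightarrow> nat \<Rightarrow> nat \<Rightarrow> nat" where
  "fpow d f x j = fold (\<lambda>_ s. fmul d f x s) [0..<j] 1"

definition finv :: "nat \<Rightarrow> nat \<Rightarrow> nat \<Rightarrow> nat" where
  "finv d f x = hd_or 0 (filter (\<lambda>y. fmul d f x y = 1) [0..<2 ^ d])"

definition dot :: "nat \<Rightarrow> nat \<Rightarrow> nat list \<Rightarrow> nat list \<Rightarrow> nat" where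
  "dot d f u v = fsum d (map (\<lambda>i. fmul d f (nth_or 0 u i) (nth_or 0 v i)) [0..<length u])"

definition vcomb :: "nat \<Rightarrow> nat \<Rightarrow> nat \<Rightarrow> nat list \<Rightarrow> nat \<Rightarrow> nat list \<Rightarrow> nat list" where
  "vcomb d f s b r p = map (\<lambda>i. fadd d (fmul d f s (nth_or 0 b i)) (fmul d f r (nth_or 0 p i))) [0..<length b]"

definition kernel_pivots :: "nat \<Rightarrow> nat \<Rightarrow> nat list \<Rightarrow> nat list list \<Rightarrow> nat list list" where
  "kernel_pivots d f rw B = filter (\<lambda>b. dot d f rw b \<noteq> 0) B"

text \<open>The pivot row itself is turned into zero, so no row has to be removed.\<close>

definition kernel_step :: "nat \<Rightarrow> nat \<Rightarrow> nat list \<Rightarrow> nat list list \<Rightarrow> nat list list" where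
  "kernel_step d f rw B = (if kernel_pivots d f rw B = [] then B else
     map (\<lambda>b. vcomb d f (dot d f rw (hd_or [] (kernel_pivots d f rw B))) b (dot d f rw b) (hd_or [] (kernel_pivots d f rw B))) B)"

definition unit_vecs :: "nat \<Rightarrow> nat list list" where
  "unit_vecs n = map (\<lambda>i. map (\<lambda>j. of_bool (i = j)) [0..<n]) [0..<n]"

text \<open>Elimination turns the unit vectors into solutions of all equations.
  \<open>sum_list\<close> adds natural numbers and not field elements, so it is 0 exactly for the
  zero vector.\<close>

definition kernel_vec :: "nat \<Rightarrow> nat \<Rightarrow> nat \<Rightarrow> nat list list \<Rightarrow> nat list" where
  "kernel_vec d f n eqs = hd_or [] (filter (\<lambda>b. sum_list b \<noteq> 0) (fold (\<lambda>rw B. kernel_step d f rw B) eqs (unit_vecs n)))"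

text \<open>The syndrome \<open>s\<^sub>j\<close> is the sum of \<open>err v * v\<^sup>j\<close> over the positions \<open>v\<close>, and \<open>E\<close> consists of the erasures. If
  \<open>\<Sum>\<^sub>i l\<^sub>i s\<^bsub>i+j\<^esub> + \<Sum>\<^bsub>e\<in>E\<^esub> k\<^sub>e e\<^sup>j = 0\<close> for sufficiently many \<open>j\<close>, the polynomial with coefficients \<open>l\<^sub>i\<close> vanishes
  at all errors outside of \<open>E\<close> (Vandermonde). Then the error values solve a linear system.\<close>

definition dec_tau :: "nat list \<Rightarrow> nat \<Rightarrow> nat" where "dec_tau E J = (J - length E) div 2"

definition dec_lam :: "nat \<Rightarrow> nat \<Rightarrow> nat list \<Rightarrow> nat \<Rightarrow> nat list \<Rightarrow> nat list" where
  "dec_lam d f E J s = kernel_vec d f (dec_tau E J + 1 + length E)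
     (map (\<lambda>j. map (\<lambda>i. nth_or 0 s (i + j)) [0..<dec_tau E J + 1] @ map (\<lambda>v. fpow d f v j) E) [0..<dec_tau E J + length E])"

definition dec_roots :: "nat \<Rightarrow> nat \<Rightarrow> nat list \<Rightarrow> nat \<Rightarrow> nat list \<Rightarrow> nat list \<Rightarrow> nat list \<Rightarrow> nat list" where
  "dec_roots d f E J s l V = filter (\<lambda>v. (\<exists>u\<in>set E. u = v) \<or>
     fsum d (map (\<lambda>i. fmul d f (nth_or 0 l i) (fpow d f v i)) [0..<dec_tau E J + 1]) = 0) V"

definition dec_sol :: "nat \<Rightarrow> nat \<Rightarrow> nat list \<Rightarrow> nat list \<Rightarrow> nat list" where
  "dec_sol d f s Z = kernel_vec d f (length Z + 1)
     (map (\<lambda>j. map (\<lambda>u. fpow d f u j) Z @ [nth_or 0 s j]) [0..<length Z])"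

text \<open>The vector \<open>k\<close> solves a homogeneous system whose last column holds the
  syndromes; dividing by its last entry normalises it to the error values. The sum acts as a lookup
  of \<open>v\<close> in \<open>Z\<close>, with value 0 if \<open>v\<close> does not occur.\<close>

definition dec_val :: "nat \<Rightarrow> nat \<Rightarrow> nat list \<Rightarrow> nat list \<Rightarrow> nat \<Rightarrow> nat" where
  "dec_val d f Z k v = fsum d (map (\<lambda>i. if nth_or 0 Z i = v then
     fmul d f (finv d f (nth_or 0 k (length Z))) (nth_or 0 k i) else 0) [0..<length Z])"

definition dec_fin :: "nat \<Rightarrow> nat \<Rightarrow> nat list \<Rightarrow> nat list \<Rightarrow> nat list \<Rightarrow> nat list" where
  "dec_fin d f V s Z = map (\<lambda>v. dec_val d f Z (dec_sol d f s Z) v) V"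

definition decode :: "nat \<Rightarrow> nat \<Rightarrow> nat list \<Rightarrow> nat list \<Rightarrow> nat \<Rightarrow> nat list \<Rightarrow> nat list" where
  "decode d f V E J s = dec_fin d f V s (dec_roots d f E J s (dec_lam d f E J s) V)"

lemma fsum_less: "fsum d xs < 2 ^ d"
proof -
  have "fold (\<lambda>x s. fadd d x s) xs s < 2 ^ d" if "s < 2 ^ d" for s
    using that by (induction xs arbitrary: s) (auto simp: fadd_less)
  then show ?thesis by (simp add: fsum_def)
qed

lemma hd_or_filter: "x \<in> set xs \<Longrightarrow> P x \<Longrightarrow> P (hd_or z (filter P xs)) \<and> hd_or z (filter P xs) \<in> set xs"
  by (induction xs) (auto simp: hd_or_def)

lemma sum_lessThan_add: "(\<Sum>i<m + n. g i) = (\<Sum>i<m. g i) + (\<Sum>i<n. g (m + i))"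
  for g :: "nat \<Rightarrow> 'b::comm_monoid_add"
  by (induction n) (simp_all add: add.assoc[symmetric])

text \<open>Combining the equations with the coefficients of the polynomial that vanishes at all
  nodes but \<open>p u\<close> isolates the term of \<open>u\<close>.\<close>

lemma vandermonde:
  fixes p :: "'i \<Rightarrow> 'k::field"
  assumes "finite S" "inj_on p S" "\<And>j. j < card S \<Longrightarrow> (\<Sum>v\<in>S. c v * p v ^ j) = 0" "u \<in> S"
  shows "c u = 0"
proof -
  define q where "q = (\<Prod>v\<in>S - {u}. [:- p v, 1:])"
  have "Polynomial.degree q \<le> card (S - {u})"
    using degree_prod_sum_le[of "S - {u}" "\<lambda>v. [:- p v, 1:]"] assms(1) by (simp add: q_def)
  then have deg: "Polynomial.degree q < card S" using assms(1,4) card_Suc_Diff1[of S u] by linarith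
  have ev: "poly q x = (\<Sum>j<card S. Polynomial.coeff q j * x ^ j)" for x
    unfolding poly_altdef using deg by (intro sum.mono_neutral_left) (auto simp: coeff_eq_0)
  have "0 = (\<Sum>j<card S. Polynomial.coeff q j * (\<Sum>v\<in>S. c v * p v ^ j))" using assms(3) by simp
  also have "\<dots> = (\<Sum>j<card S. \<Sum>v\<in>S. Polynomial.coeff q j * (c v * p v ^ j))" by (simp add: sum_distrib_left)
  also have "\<dots> = (\<Sum>v\<in>S. \<Sum>j<card S. Polynomial.coeff q j * (c v * p v ^ j))" by (rule sum.swap)
  also have "\<dots> = (\<Sum>v\<in>S. c v * poly q (p v))"
    unfolding ev by (simp add: sum_distrib_left algebra_simps)
  also have "\<dots> = (\<Sum>v\<in>{u}. c v * poly q (p v))"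
    using assms(1,4) by (intro sum.mono_neutral_right) (auto simp: q_def poly_prod)
  finally have "c u * poly q (p u) = 0" by simp
  moreover have "poly q (p u) \<noteq> 0" using assms(1,2,4) by (auto simp: q_def poly_prod inj_on_def)
  ultimately show ?thesis by simp
qed

context gf
begin

lemma one_less: "1 < (2::nat) ^ d" using d one_less_power[of "2::nat" d] by simp

lemma \<phi>_eq_0: "a < 2 ^ d \<Longrightarrow> \<phi> a = 0 \<longleftrightarrow> a = 0"
  using inj \<phi>0 inj_on_eq_iff[OF inj, of a 0] by auto

lemma \<phi>_fsum: "\<phi> (fsum d xs) = (\<Sum>x\<leftarrow>xs. \<phi> x)"
proof -
  have "\<phi> (fold (\<lambda>x s. fadd d x s) xs s) = (\<Sum>x\<leftarrow>xs. \<phi> x) + \<phi> s" for s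
    by (induction xs arbitrary: s) (simp_all add: \<phi>add)
  then show ?thesis by (simp add: fsum_def \<phi>0)
qed

lemma \<phi>_fsum_upt: "\<phi> (fsum d (map g [0..<n])) = (\<Sum>i<n. \<phi> (g i))"
  by (simp add: \<phi>_fsum o_def interv_sum_list_conv_sum_set_nat atLeast0LessThan)

lemma \<phi>_fpow: "\<phi> (fpow d f x j) = \<phi> x ^ j"
proof -
  have "\<phi> (fold (\<lambda>_ s. fmul d f x s) xs s) = \<phi> x ^ length xs * \<phi> s" for xs :: "nat list" and s
    by (induction xs arbitrary: s) (simp_all add: \<phi>mul)
  then show ?thesis using \<phi>1 by (simp add: fpow_def del: One_nat_def)
qed

lemma finv: assumes "x < 2 ^ d" "x \<noteq> 0" shows "\<phi> (finv d f x) * \<phi> x = 1"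
proof -
  obtain y where "y < 2 ^ d" "fmul d f x y = 1" using assms gf unfolding is_gf_modulus_def by blast
  then have "fmul d f x (finv d f x) = 1"
    using hd_or_filter[of y "[0..<2 ^ d]" "\<lambda>y. fmul d f x y = 1" 0] unfolding finv_def by auto
  then show ?thesis using \<phi>mul[of x "finv d f x"] \<phi>1 by (simp add: mult.commute)
qed

lemma \<phi>_dot: "length u = n \<Longrightarrow> length v = n \<Longrightarrow> \<phi> (dot d f u v) = (\<Sum>i<n. \<phi> (u ! i) * \<phi> (v ! i))"
  by (simp add: dot_def \<phi>_fsum_upt \<phi>mul)

definition kernel_invar :: "nat \<Rightarrow> nat list list \<Rightarrow> nat list list \<Rightarrow> nat set \<Rightarrow> bool" where
  "kernel_invar n es B I \<longleftrightarrow> length B = n \<and> (\<forall>i<n. length (B ! i) = n \<and> (\<forall>j<n. B ! i ! j < 2 ^ d)) \<and>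
     I \<subseteq> {..<n} \<and> n \<le> card I + length es \<and>
     (\<forall>i\<in>I. B ! i ! i \<noteq> 0) \<and> (\<forall>i\<in>I. \<forall>j\<in>I. i \<noteq> j \<longrightarrow> B ! i ! j = 0) \<and>
     (\<forall>i<n. i \<notin> I \<longrightarrow> (\<forall>j<n. B ! i ! j = 0)) \<and>
     (\<forall>i<n. \<forall>rw\<in>set es. (\<Sum>j<n. \<phi> (rw ! j) * \<phi> (B ! i ! j)) = 0)"

lemma kernel_step_inv:
  assumes inv: "kernel_invar n es B I" and len: "length rw = n"
  shows "\<exists>I'. kernel_invar n (es @ [rw]) (kernel_step d f rw B) I'"
proof -
  have L: "length B = n" "\<And>i. i < n \<Longrightarrow> length (B ! i) = n" "\<And>i j. i < n \<Longrightarrow> j < n \<Longrightarrow> B ! i ! j < 2 ^ d"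
    "I \<subseteq> {..<n}" "n \<le> card I + length es" "\<And>i. i \<in> I \<Longrightarrow> B ! i ! i \<noteq> 0"
    "\<And>i j. i \<in> I \<Longrightarrow> j \<in> I \<Longrightarrow> i \<noteq> j \<Longrightarrow> B ! i ! j = 0" "\<And>i j. i < n \<Longrightarrow> i \<notin> I \<Longrightarrow> j < n \<Longrightarrow> B ! i ! j = 0"
    "\<And>i e. i < n \<Longrightarrow> e \<in> set es \<Longrightarrow> (\<Sum>j<n. \<phi> (e ! j) * \<phi> (B ! i ! j)) = 0"
    using inv unfolding kernel_invar_def by blast+
  have dot: "\<phi> (dot d f rw (B ! i)) = (\<Sum>j<n. \<phi> (rw ! j) * \<phi> (B ! i ! j))" if "i < n" for i
    using \<phi>_dot[OF len L(2)[OF that]] .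
  have dl: "dot d f u v < 2 ^ d" for u v unfolding dot_def by (rule fsum_less)
  have dz: "\<phi> (dot d f u v) = 0 \<longleftrightarrow> dot d f u v = 0" for u v by (rule \<phi>_eq_0[OF dl])
  show ?thesis
  proof (cases "kernel_pivots d f rw B = []")
    case True
    then have "dot d f rw (B ! i) = 0" if "i < n" for i
      using that L(1) by (auto simp: kernel_pivots_def filter_empty_conv)
    then have "(\<Sum>j<n. \<phi> (rw ! j) * \<phi> (B ! i ! j)) = 0" if "i < n" for i using dot that \<phi>0 by metis
    then have "kernel_invar n (es @ [rw]) B I" using inv unfolding kernel_invar_def by auto
    then show ?thesis using True by (auto simp: kernel_step_def)
  next
    case False
    define p where "p = hd_or [] (kernel_pivots d f rw B)"
    have "p \<in> set (kernel_pivots d f rw B)" using False unfolding p_def hd_or_def by (cases "kernel_pivots d f rw B") auto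
    then obtain i0 where i0: "i0 < n" "p = B ! i0" and nz: "dot d f rw p \<noteq> 0"
      using L(1) by (auto simp: kernel_pivots_def in_set_conv_nth)
    \<comment> \<open>Rows outside of \<open>I\<close> are zero and cannot serve as pivot.\<close>
    have "i0 \<in> I"
    proof (rule ccontr)
      assume "i0 \<notin> I"
      then have "\<phi> (dot d f rw p) = 0" using dot[OF i0(1)] L(8)[OF i0(1)] i0(2) \<phi>0 by simp
      then show False using nz dz by simp
    qed
    define lp where "lp = dot d f rw p"
    have lp: "\<phi> lp \<noteq> 0" using nz dz unfolding lp_def by simp
    define B' where "B' = kernel_step d f rw B"
    have B': "B' = map (\<lambda>b. vcomb d f lp b (dot d f rw b) p) B"
      using False unfolding B'_def kernel_step_def p_def lp_def by simp
    have row: "B' ! i = vcomb d f lp (B ! i) (dot d f rw (B ! i)) p" if "i < n" for i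
      using that L(1) by (simp add: B')
    have ent: "length (B' ! i) = n" "j < n \<Longrightarrow> B' ! i ! j < 2 ^ d"
      "j < n \<Longrightarrow> \<phi> (B' ! i ! j) = \<phi> lp * \<phi> (B ! i ! j) + \<phi> (dot d f rw (B ! i)) * \<phi> (B ! i0 ! j)" if "i < n" for i j
      using that L(2) i0 unfolding row[OF that] vcomb_def by (auto simp: fadd_less \<phi>add \<phi>mul)
    have zero: "B' ! i ! j = 0" if "i < n" "j < n" "\<phi> (B' ! i ! j) = 0" for i j
      using that ent(2)[of i j] \<phi>_eq_0 by blast
    have lin: "(\<Sum>j<n. \<phi> (e ! j) * \<phi> (B' ! i ! j)) =
        \<phi> lp * (\<Sum>j<n. \<phi> (e ! j) * \<phi> (B ! i ! j)) + \<phi> (dot d f rw (B ! i)) * (\<Sum>j<n. \<phi> (e ! j) * \<phi> (B ! i0 ! j))"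
      if "i < n" for i e
      using that by (simp add: ent(3) sum_distrib_left sum.distrib[symmetric] algebra_simps)
    \<comment> \<open>Among the columns in \<open>I\<close> the pivot row is nonzero only in column
      \<open>i0\<close>. Adding multiples of it therefore keeps the matrix on
      \<open>I - {i0}\<close> diagonal, and the factor \<open>lp\<close> of the old rows is
      nonzero.\<close>
    have "kernel_invar n (es @ [rw]) B' (I - {i0})"
      unfolding kernel_invar_def
    proof (intro conjI ballI allI impI)
      show "length B' = n" using L(1) by (simp add: B')
      show "length (B' ! i) = n" if "i < n" for i using ent(1) that .
      show "B' ! i ! j < 2 ^ d" if "i < n" "j < n" for i j using ent(2) that .
      show "I - {i0} \<subseteq> {..<n}" using L(4) by auto
      show "n \<le> card (I - {i0}) + length (es @ [rw])"
        using L(5) \<open>i0 \<in> I\<close> finite_subset[OF L(4)] by (simp add: card_Diff_singleton_if)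
    next
      fix i assume i: "i \<in> I - {i0}"
      then have "i < n" using L(4) by auto
      have "\<phi> (B' ! i ! i) = \<phi> lp * \<phi> (B ! i ! i)"
        using ent(3)[OF \<open>i < n\<close> \<open>i < n\<close>] L(7)[OF \<open>i0 \<in> I\<close>, of i] i \<phi>0 by auto
      moreover have "\<phi> (B ! i ! i) \<noteq> 0" using L(6)[of i] \<phi>_eq_0[OF L(3)[OF \<open>i < n\<close> \<open>i < n\<close>]] i by simp
      ultimately have "\<phi> (B' ! i ! i) \<noteq> 0" using lp by simp
      then show "B' ! i ! i \<noteq> 0" using \<phi>0 by (intro notI) simp
    next
      fix i j assume ij: "i \<in> I - {i0}" "j \<in> I - {i0}" "i \<noteq> j"
      then have "i < n" "j < n" using L(4) by auto
      then show "B' ! i ! j = 0"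
        using ent(3)[of i j] L(7)[OF \<open>i0 \<in> I\<close>, of j] L(7)[of i j] ij \<phi>0 by (intro zero) auto
    next
      fix i j assume ij: "i < n" "i \<notin> I - {i0}" "j < n"
      show "B' ! i ! j = 0"
      proof (cases "i = i0")
        case True
        then show ?thesis using ent(3)[of i j] ij i0(2) char2_add_self[OF c2] by (intro zero) (auto simp: lp_def)
      next
        case False
        then have "\<phi> (dot d f rw (B ! i)) = 0" using dot[OF ij(1)] L(8)[of i] ij \<phi>0 by simp
        then show ?thesis using ent(3)[of i j] L(8)[of i j] ij False \<phi>0 by (intro zero) auto
      qed
    next
      fix i e assume i: "i < n" and e: "e \<in> set (es @ [rw])"
      show "(\<Sum>j<n. \<phi> (e ! j) * \<phi> (B' ! i ! j)) = 0"
      proof (cases "e \<in> set es")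
        case True
        then show ?thesis using lin[OF i] L(9)[OF i] L(9)[OF i0(1)] by simp
      next
        case False
        then have "e = rw" using e by simp
        then show ?thesis using lin[OF i, of rw] dot[OF i] dot[OF i0(1)] i0(2) char2_add_self[OF c2, of "\<phi> lp * \<phi> (dot d f rw (B ! i))"]
          by (simp add: lp_def mult.commute)
      qed
    qed
    then show ?thesis unfolding B'_def ..
  qed
qed

text \<open>With fewer equations than unknowns the index set of the invariant is nonempty at the
  end.\<close>

lemma kernel_vec:
  assumes "length eqs < n" "\<And>rw. rw \<in> set eqs \<Longrightarrow> length rw = n"
  shows "length (kernel_vec d f n eqs) = n" "\<And>j. j < n \<Longrightarrow> kernel_vec d f n eqs ! j < 2 ^ d"
    "\<exists>j<n. kernel_vec d f n eqs ! j \<noteq> 0"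
    "\<And>rw. rw \<in> set eqs \<Longrightarrow> (\<Sum>j<n. \<phi> (rw ! j) * \<phi> (kernel_vec d f n eqs ! j)) = 0"
proof -
  have base: "kernel_invar n [] (unit_vecs n) {..<n}"
    unfolding kernel_invar_def unit_vecs_def using one_less by auto
  have "\<exists>I. kernel_invar n (es @ eqs) (fold (\<lambda>rw B. kernel_step d f rw B) eqs B) I" if "kernel_invar n es B I" for es B I
    using that assms(2)
  proof (induction eqs arbitrary: es B I)
    case (Cons rw eqs)
    then obtain I' where "kernel_invar n (es @ [rw]) (kernel_step d f rw B) I'" using kernel_step_inv[of n es B I rw] by auto
    from Cons.IH[OF this] Cons.prems show ?case by auto
  qed auto
  from this[OF base] obtain I B where B: "B = fold (\<lambda>rw B. kernel_step d f rw B) eqs (unit_vecs n)" and I: "kernel_invar n eqs B I" by auto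
  have "I \<noteq> {}" using I assms(1) unfolding kernel_invar_def by auto
  then obtain i where i: "i \<in> I" "i < n" using I unfolding kernel_invar_def by auto
  have "B ! i \<in> set B" using i I unfolding kernel_invar_def by auto
  moreover have "sum_list (B ! i) \<noteq> 0"
  proof -
    have "B ! i ! i \<in> set (B ! i)" "B ! i ! i \<noteq> 0" using i I unfolding kernel_invar_def by auto
    then show ?thesis by (auto simp: sum_list_eq_0_iff)
  qed
  ultimately have k: "kernel_vec d f n eqs \<in> set B" "sum_list (kernel_vec d f n eqs) \<noteq> 0"
    using hd_or_filter[of "B ! i" B "\<lambda>b. sum_list b \<noteq> 0" "[]"] unfolding kernel_vec_def B[symmetric] by simp_all
  then obtain i' where i': "i' < n" "kernel_vec d f n eqs = B ! i'" using I unfolding kernel_invar_def by (metis in_set_conv_nth)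
  show "length (kernel_vec d f n eqs) = n" "\<And>j. j < n \<Longrightarrow> kernel_vec d f n eqs ! j < 2 ^ d"
    "\<And>rw. rw \<in> set eqs \<Longrightarrow> (\<Sum>j<n. \<phi> (rw ! j) * \<phi> (kernel_vec d f n eqs ! j)) = 0"
    using I i' unfolding kernel_invar_def by auto
  then show "\<exists>j<n. kernel_vec d f n eqs ! j \<noteq> 0"
    using k(2) by (auto simp: sum_list_eq_0_iff in_set_conv_nth)
qed

lemma \<phi>_inj_on_nth: "distinct Z \<Longrightarrow> set Z \<subseteq> {..<2 ^ d} \<Longrightarrow> inj_on (\<lambda>i. \<phi> (Z ! i)) {..<length Z}"
proof (rule inj_onI)
  fix i j assume "distinct Z" "set Z \<subseteq> {..<2 ^ d}" and ij: "i \<in> {..<length Z}" "j \<in> {..<length Z}" "\<phi> (Z ! i) = \<phi> (Z ! j)"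
  moreover have "Z ! i \<in> set Z" "Z ! j \<in> set Z" using ij by auto
  ultimately have "Z ! i = Z ! j" using inj_onD[OF inj ij(3)] by blast
  then show "i = j" using \<open>distinct Z\<close> ij by (simp add: nth_eq_iff_index_eq)
qed

lemma sum_nth: "distinct Z \<Longrightarrow> (\<Sum>i<length Z. g (Z ! i)) = (\<Sum>v\<in>set Z. g v)" for g :: "nat \<Rightarrow> 'k"
  by (rule sum.reindex_bij_betw) (simp add: bij_betw_nth)

text \<open>This serves both codes: the hash set is decoded without erasures from
  \<open>2 * dl\<close> syndromes, each layer with erasures from \<open>dl\<close>
  syndromes.\<close>

lemma decode_correct:
  assumes V: "distinct V" "set V \<subseteq> {..<2 ^ d}" and E: "distinct E" "set E \<subseteq> set V"
    and err: "\<And>v. v \<in> set V \<Longrightarrow> err v < 2 ^ d"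
    and s: "\<And>j. j < J \<Longrightarrow> \<phi> (nth_or 0 s j) = (\<Sum>v\<in>set V. \<phi> (err v) * \<phi> v ^ j)"
    and cost: "2 * card {v \<in> set V - set E. err v \<noteq> 0} + length E \<le> J"
  shows "decode d f V E J s = map err V"
proof -
  define \<tau> where "\<tau> = dec_tau E J"
  define \<epsilon> where "\<epsilon> = length E"
  define S where "S = {v \<in> set V - set E. err v \<noteq> 0}"
  have finS: "finite S" unfolding S_def by simp
  have tau: "card S \<le> \<tau>" "2 * \<tau> + \<epsilon> \<le> J" using cost unfolding \<tau>_def dec_tau_def \<epsilon>_def S_def by auto
  define l where "l = dec_lam d f E J s"
  define eqs where "eqs = map (\<lambda>j. map (\<lambda>i. nth_or 0 s (i + j)) [0..<\<tau> + 1] @ map (\<lambda>v. fpow d f v j) E) [0..<\<tau> + \<epsilon>]"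
  have l: "l = kernel_vec d f (\<tau> + 1 + \<epsilon>) eqs" unfolding l_def dec_lam_def eqs_def \<tau>_def \<epsilon>_def ..
  have leneqs: "length eqs < \<tau> + 1 + \<epsilon>" "\<And>rw. rw \<in> set eqs \<Longrightarrow> length rw = \<tau> + 1 + \<epsilon>"
    unfolding eqs_def by (auto simp: \<epsilon>_def)
  note ker = kernel_vec[OF leneqs, folded l]
  define \<Lambda> where "\<Lambda> v = (\<Sum>i<\<tau> + 1. \<phi> (l ! i) * \<phi> v ^ i)" for v
  define \<beta> where "\<beta> v = \<phi> (l ! (\<tau> + 1 + inv_into {..<\<epsilon>} ((!) E) v))" for v
  have \<beta>: "\<beta> (E ! i) = \<phi> (l ! (\<tau> + 1 + i))" if "i < \<epsilon>" for i
    using that E(1) unfolding \<beta>_def \<epsilon>_def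
    by (subst inv_into_f_f) (auto simp: inj_on_def nth_eq_iff_index_eq)
  \<comment> \<open>The equation in terms of error positions. The largest syndrome index that occurs
    is \<open>2 * \<tau> + \<epsilon> - 1\<close>, which is below \<open>J\<close>.\<close>
  have rel: "(\<Sum>v\<in>set V. \<phi> (err v) * \<Lambda> v * \<phi> v ^ j) + (\<Sum>v\<in>set E. \<beta> v * \<phi> v ^ j) = 0" if j: "j < \<tau> + \<epsilon>" for j
  proof -
    have "eqs ! j \<in> set eqs" using j unfolding eqs_def by (intro nth_mem) simp
    moreover have eqj: "eqs ! j = map (\<lambda>i. nth_or 0 s (i + j)) [0..<\<tau> + 1] @ map (\<lambda>v. fpow d f v j) E"
      using j unfolding eqs_def by (simp del: upt_Suc)
    ultimately have "(\<Sum>i<\<tau> + 1 + \<epsilon>. \<phi> (eqs ! j ! i) * \<phi> (l ! i)) = 0" by (intro ker(4))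
    also have "(\<Sum>i<\<tau> + 1 + \<epsilon>. \<phi> (eqs ! j ! i) * \<phi> (l ! i)) =
      (\<Sum>i<\<tau> + 1. \<phi> (eqs ! j ! i) * \<phi> (l ! i)) + (\<Sum>i<\<epsilon>. \<phi> (eqs ! j ! (\<tau> + 1 + i)) * \<phi> (l ! (\<tau> + 1 + i)))"
      by (rule sum_lessThan_add)
    also have "(\<Sum>i<\<tau> + 1. \<phi> (eqs ! j ! i) * \<phi> (l ! i)) = (\<Sum>i<\<tau> + 1. (\<Sum>v\<in>set V. \<phi> (err v) * \<phi> v ^ (i + j)) * \<phi> (l ! i))"
    proof (rule sum.cong[OF refl])
      fix i assume i: "i \<in> {..<\<tau> + 1}"
      then have "eqs ! j ! i = nth_or 0 s (i + j)" unfolding eqj by (simp add: nth_append del: upt_Suc)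
      moreover have "i + j < J" using i j tau(2) by simp
      ultimately show "\<phi> (eqs ! j ! i) * \<phi> (l ! i) = (\<Sum>v\<in>set V. \<phi> (err v) * \<phi> v ^ (i + j)) * \<phi> (l ! i)"
        using s by simp
    qed
    also have "\<dots> = (\<Sum>v\<in>set V. \<phi> (err v) * \<Lambda> v * \<phi> v ^ j)"
      unfolding \<Lambda>_def sum_distrib_right sum_distrib_left
      by (subst sum.swap) (simp add: power_add algebra_simps)
    also have "(\<Sum>i<\<epsilon>. \<phi> (eqs ! j ! (\<tau> + 1 + i)) * \<phi> (l ! (\<tau> + 1 + i))) = (\<Sum>i<\<epsilon>. \<beta> (E ! i) * \<phi> (E ! i) ^ j)"
      unfolding eqj by (intro sum.cong) (auto simp: nth_append \<epsilon>_def[symmetric] \<beta> \<phi>_fpow mult.commute simp del: upt_Suc)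
    also have "\<dots> = (\<Sum>v\<in>set E. \<beta> v * \<phi> v ^ j)" unfolding \<epsilon>_def by (rule sum_nth[OF E(1)])
    finally show ?thesis .
  qed
  have injV: "inj_on \<phi> (set V)" using inj V(2) by (rule inj_on_subset)
  define c where "c v = \<phi> (err v) * \<Lambda> v + (if v \<in> set E then \<beta> v else 0)" for v
  have cardW: "card (S \<union> set E) \<le> \<tau> + \<epsilon>"
    using card_Un_le[of S "set E"] tau(1) card_length[of E] unfolding \<epsilon>_def by linarith
  \<comment> \<open>Only positions in \<open>S\<close> or \<open>E\<close> contribute, and they are
    at most \<open>\<tau> + \<epsilon>\<close> many, the number of equations.\<close>
  have c0: "c v = 0" if "v \<in> S \<union> set E" for v
  proof (rule vandermonde[OF _ _ _ that])
    show "finite (S \<union> set E)" using finS by simp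
    show "inj_on \<phi> (S \<union> set E)" using injV by (rule inj_on_subset) (use E(2) in \<open>auto simp: S_def\<close>)
    fix j assume "j < card (S \<union> set E)"
    then have "(\<Sum>v\<in>set V. \<phi> (err v) * \<Lambda> v * \<phi> v ^ j) + (\<Sum>v\<in>set E. \<beta> v * \<phi> v ^ j) = 0" using cardW by (intro rel) simp
    also have "(\<Sum>v\<in>set V. \<phi> (err v) * \<Lambda> v * \<phi> v ^ j) = (\<Sum>v\<in>S \<union> set E. \<phi> (err v) * \<Lambda> v * \<phi> v ^ j)"
    proof (intro sum.mono_neutral_right ballI)
      fix v assume "v \<in> set V - (S \<union> set E)"
      then have "err v = 0" by (auto simp: S_def)
      then show "\<phi> (err v) * \<Lambda> v * \<phi> v ^ j = 0" using \<phi>0 by simp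
    qed (use E(2) in \<open>auto simp: S_def\<close>)
    also have "(\<Sum>v\<in>set E. \<beta> v * \<phi> v ^ j) = (\<Sum>v\<in>S \<union> set E. (if v \<in> set E then \<beta> v else 0) * \<phi> v ^ j)"
      using finS by (intro sum.mono_neutral_cong_left) auto
    finally show "(\<Sum>v\<in>S \<union> set E. c v * \<phi> v ^ j) = 0" by (simp add: c_def algebra_simps sum.distrib)
  qed
  have \<Lambda>0: "\<Lambda> v = 0" if "v \<in> S" for v
    using c0[of v] that err[of v] \<phi>_eq_0[of "err v"] unfolding c_def S_def by auto
  \<comment> \<open>If all coefficients of the locator polynomial were 0, the erasure coefficients
    would vanish as well, and with them the whole kernel vector.\<close>
  have nz: "\<exists>i<\<tau> + 1. l ! i \<noteq> 0"
  proof (rule ccontr)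
    assume no: "\<not> ?thesis"
    then have "\<Lambda> v = 0" for v unfolding \<Lambda>_def by (auto intro!: sum.neutral simp: \<phi>0)
    then have "\<beta> v = 0" if "v \<in> set E" for v using c0[of v] that unfolding c_def by simp
    then have "\<phi> (l ! (\<tau> + 1 + i)) = 0" if "i < \<epsilon>" for i using \<beta>[OF that] that unfolding \<epsilon>_def by auto
    then have "l ! (\<tau> + 1 + i) = 0" if "i < \<epsilon>" for i using \<phi>_eq_0 ker(2)[of "\<tau> + 1 + i"] that by auto
    then have l2: "l ! (\<tau> + 1 + i) = 0" if "i < \<epsilon>" for i using that by simp
    have l1: "l ! i = 0" if "i < \<tau> + 1" for i using no that by blast
    have "l ! j = 0" if j: "j < \<tau> + 1 + \<epsilon>" for j
    proof (cases "j < \<tau> + 1")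
      case False
      then show ?thesis using l2[of "j - (\<tau> + 1)"] j by simp
    qed (rule l1)
    then show False using ker(3) by auto
  qed
  define q where "q = (\<Sum>i<\<tau> + 1. Polynomial.monom (\<phi> (l ! i)) i)"
  have q\<Lambda>: "poly q (\<phi> v) = \<Lambda> v" for v unfolding q_def \<Lambda>_def by (simp add: poly_sum poly_monom del: sum.lessThan_Suc)
  have "Polynomial.coeff q i = (if i < \<tau> + 1 then \<phi> (l ! i) else 0)" for i unfolding q_def by (simp add: coeff_sum if_distrib cong: if_cong del: sum.lessThan_Suc)
  moreover obtain i where "i < \<tau> + 1" "l ! i \<noteq> 0" using nz by blast
  ultimately have "Polynomial.coeff q i \<noteq> 0" using \<phi>_eq_0[OF ker(2)[of i]] by simp
  then have q0: "q \<noteq> 0" by auto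
  have "Polynomial.degree q \<le> \<tau>" unfolding q_def by (intro degree_sum_le) (auto intro: order_trans[OF degree_monom_le])
  define R where "R = {v \<in> set V. \<Lambda> v = 0}"
  have "card R = card (\<phi> ` R)" using injV by (intro card_image[symmetric] inj_on_subset[OF injV]) (auto simp: R_def)
  also have "\<dots> \<le> card {x. poly q x = 0}" using q0 by (intro card_mono poly_roots_finite) (auto simp: R_def q\<Lambda>)
  also have "\<dots> \<le> \<tau>" using card_poly_roots_bound[OF q0] \<open>Polynomial.degree q \<le> \<tau>\<close> by simp
  finally have R: "card R \<le> \<tau>" .
  define Z where "Z = dec_roots d f E J s l V"
  have "fsum d (map (\<lambda>i. fmul d f (nth_or 0 l i) (fpow d f v i)) [0..<\<tau> + 1]) = 0 \<longleftrightarrow> \<Lambda> v = 0" for v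
  proof -
    have "\<phi> (fsum d (map (\<lambda>i. fmul d f (nth_or 0 l i) (fpow d f v i)) [0..<\<tau> + 1])) = \<Lambda> v"
      unfolding \<phi>_fsum_upt \<Lambda>_def by (intro sum.cong) (auto simp: \<phi>mul \<phi>_fpow ker(1))
    then show ?thesis using \<phi>_eq_0[OF fsum_less] by metis
  qed
  then have setZ: "set Z = set E \<union> R" using E(2) unfolding Z_def dec_roots_def R_def \<tau>_def[symmetric] by auto
  have distZ: "distinct Z" unfolding Z_def dec_roots_def using V(1) by simp
  have ZV: "set Z \<subseteq> {..<2 ^ d}" using setZ E(2) V(2) unfolding R_def by auto
  have "length Z = card (set Z)" using distZ by (simp add: distinct_card)
  also have "\<dots> \<le> \<epsilon> + \<tau>" unfolding setZ using card_Un_le[of "set E" R] R card_length[of E] unfolding \<epsilon>_def by linarith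
  \<comment> \<open>The locator has at most \<open>\<tau>\<close> roots, so there are enough
    syndromes for one unknown error value per element of \<open>Z\<close>.\<close>
  finally have lenZ: "length Z \<le> J" using tau by linarith
  have supp: "err v = 0" if "v \<in> set V" "v \<notin> set Z" for v
    using that \<Lambda>0[of v] unfolding setZ R_def S_def by auto
  define k where "k = dec_sol d f s Z"
  define eq2 where "eq2 = map (\<lambda>j. map (\<lambda>u. fpow d f u j) Z @ [nth_or 0 s j]) [0..<length Z]"
  have k: "k = kernel_vec d f (length Z + 1) eq2" unfolding k_def dec_sol_def eq2_def ..
  have leneq2: "length eq2 < length Z + 1" "\<And>rw. rw \<in> set eq2 \<Longrightarrow> length rw = length Z + 1"
    unfolding eq2_def by auto
  note ker2 = kernel_vec[OF leneq2, folded k]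
  define \<mu> where "\<mu> = k ! length Z"
  \<comment> \<open>By uniqueness for the nodes in \<open>Z\<close>, the solution is
    \<open>\<mu>\<close> times the vector of error values; in characteristic 2 there is no
    sign.\<close>
  have ki: "\<phi> (k ! i) + \<phi> \<mu> * \<phi> (err (Z ! i)) = 0" if "i < length Z" for i
  proof (rule vandermonde[where p = "\<lambda>i. \<phi> (Z ! i)" and S = "{..<length Z}" and u = i and
      c = "\<lambda>i. \<phi> (k ! i) + \<phi> \<mu> * \<phi> (err (Z ! i))"])
    show "inj_on (\<lambda>i. \<phi> (Z ! i)) {..<length Z}" by (rule \<phi>_inj_on_nth[OF distZ ZV])
    fix j assume "j < card {..<length Z}"
    then have j: "j < length Z" by simp
    have "eq2 ! j \<in> set eq2" using j unfolding eq2_def by (intro nth_mem) simp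
    then have "(\<Sum>i<length Z + 1. \<phi> (eq2 ! j ! i) * \<phi> (k ! i)) = 0" by (intro ker2(4))
    moreover have eqj: "eq2 ! j = map (\<lambda>u. fpow d f u j) Z @ [nth_or 0 s j]" using j unfolding eq2_def by simp
    ultimately have "(\<Sum>i<length Z. \<phi> (k ! i) * \<phi> (Z ! i) ^ j) + \<phi> (nth_or 0 s j) * \<phi> \<mu> = 0"
      unfolding eqj \<mu>_def by (simp add: nth_append \<phi>_fpow mult.commute)
    also have "\<phi> (nth_or 0 s j) = (\<Sum>v\<in>set V. \<phi> (err v) * \<phi> v ^ j)" using j lenZ by (intro s) simp
    also have "\<dots> = (\<Sum>v\<in>set Z. \<phi> (err v) * \<phi> v ^ j)"
      using supp setZ E(2) \<phi>0 by (intro sum.mono_neutral_right) (auto simp: R_def)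
    also have "\<dots> = (\<Sum>i<length Z. \<phi> (err (Z ! i)) * \<phi> (Z ! i) ^ j)" by (rule sum_nth[OF distZ, symmetric])
    finally show "(\<Sum>i<length Z. (\<phi> (k ! i) + \<phi> \<mu> * \<phi> (err (Z ! i))) * \<phi> (Z ! i) ^ j) = 0"
      by (simp add: algebra_simps sum.distrib sum_distrib_left)
  qed (use that in auto)
  have \<mu>0: "\<mu> \<noteq> 0"
  proof
    assume "\<mu> = 0"
    then have "\<phi> (k ! i) = 0" if "i < length Z" for i using ki[OF that] \<phi>0 by simp
    then have "k ! i = 0" if "i < length Z" for i using \<phi>_eq_0[OF ker2(2)[of i]] that by simp
    then show False using ker2(3) \<open>\<mu> = 0\<close> unfolding \<mu>_def by (metis Suc_eq_plus1 less_SucE)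
  qed
  have inv: "\<phi> (finv d f \<mu>) * \<phi> \<mu> = 1" using ker2(2)[of "length Z"] \<mu>0 by (intro finv) (auto simp: \<mu>_def)
  have "dec_val d f Z k v = err v" if v: "v \<in> set V" for v
  proof -
    have nk: "nth_or 0 k (length Z) = \<mu>" unfolding \<mu>_def using ker2(1) by simp
    have "\<phi> (dec_val d f Z k v) = (\<Sum>i<length Z. if Z ! i = v then \<phi> (finv d f \<mu>) * \<phi> (k ! i) else 0)"
      unfolding dec_val_def \<phi>_fsum_upt nk using ker2(1) by (intro sum.cong) (auto simp: \<phi>mul \<phi>0)
    also have "\<dots> = (\<Sum>i<length Z. if Z ! i = v then \<phi> (err v) else 0)"
    proof (intro sum.cong refl)
      fix i assume "i \<in> {..<length Z}"
      then have "\<phi> (k ! i) = \<phi> \<mu> * \<phi> (err (Z ! i))" using ki[of i] char2_add_eq_0_iff[OF c2] by simp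
      then show "(if Z ! i = v then \<phi> (finv d f \<mu>) * \<phi> (k ! i) else 0) = (if Z ! i = v then \<phi> (err v) else 0)"
        using inv by (simp add: mult.assoc[symmetric])
    qed
    also have "\<dots> = (\<Sum>u\<in>set Z. if u = v then \<phi> (err v) else 0)" by (rule sum_nth[OF distZ])
    also have "\<dots> = \<phi> (err v)" using supp[OF v] \<phi>0 by auto
    finally show ?thesis
      using inj_onD[OF inj, of "dec_val d f Z k v" "err v"] err[OF v] fsum_less unfolding dec_val_def by auto
  qed
  then show ?thesis unfolding decode_def dec_fin_def l_def[symmetric] Z_def[symmetric] k_def[symmetric] by simp
qed

end

section \<open>Running time of field arithmetic and decoding\<close>

lemma pb_min2: "poly_bounded e g \<Longrightarrow> poly_bounded e (\<lambda>x. min (f x) (g x))"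
  by (erule pb_mono) simp

lemma pb_ptcomp: "poly_bounded e' k \<Longrightarrow> polytime e e' g \<Longrightarrow> poly_bounded e (\<lambda>x. k (g x))"
  by (rule pb_comp) (auto dest: pt_size)

lemma pt_cong: "polytime e e' f \<Longrightarrow> (\<And>x. f x = g x) \<Longrightarrow> polytime e e' g"
  by (metis ext)

text \<open>In the rules for index ranges the index is clamped, so that its value is polynomially
  bounded on every input of the body and not only on those that occur.\<close>

lemma pt_map_upt:
  assumes "polytime e eN f" "poly_bounded e f" "polytime (eP e eN) e' (\<lambda>p. h (fst p) (min (snd p) (f (fst p))))"
  shows "polytime e (eL e') (\<lambda>x. map (h x) [0..<f x])"
  by (rule pt_cong[OF pt_map[OF pt_upt[OF assms(1,2)], of e' "\<lambda>x i. h x (min i (f x))"]]) (use assms(3) in auto)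

lemma pt_filter_upt:
  assumes "polytime e eN f" "poly_bounded e f" "polytime (eP e eN) eB (\<lambda>p. h (fst p) (min (snd p) (f (fst p))))"
  shows "polytime e (eL eN) (\<lambda>x. filter (h x) [0..<f x])"
  by (rule pt_cong[OF pt_filter[OF pt_upt[OF assms(1,2)], of "\<lambda>x i. h x (min i (f x))"]])
     (use assms(3) in \<open>auto intro: filter_cong\<close>)

lemma pt_sum':
  assumes "polytime e eN f" "poly_bounded e f" "polytime (eP e eN) eN (\<lambda>p. g (fst p) (min (snd p) (f (fst p))))"
  shows "polytime e eN (\<lambda>x. \<Sum>i<f x. g x i)"
  by (rule pt_cong[OF pt_sum[OF assms(1,2), of "\<lambda>x i. g x (min i (f x))"]]) (use assms(3) in auto)

lemma pt_ex_less':
  assumes "polytime e eN f" "poly_bounded e f" "polytime (eP e eN) eB (\<lambda>p. g (fst p) (min (snd p) (f (fst p))))"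
  shows "polytime e eB (\<lambda>x. \<exists>i<f x. g x i)"
  by (rule pt_cong[OF pt_ex_less[OF assms(1,2), of "\<lambda>x i. g x (min i (f x))"]]) (use assms(3) in \<open>auto simp: min_def\<close>)

lemma pt_all_less':
  assumes "polytime e eN f" "poly_bounded e f" "polytime (eP e eN) eB (\<lambda>p. g (fst p) (min (snd p) (f (fst p))))"
  shows "polytime e eB (\<lambda>x. \<forall>i<f x. g x i)"
  by (rule pt_cong[OF pt_all_less[OF assms(1,2), of "\<lambda>x i. g x (min i (f x))"]]) (use assms(3) in \<open>auto simp: min_def\<close>)

lemmas pt_rules = pt_id pt_const_nat pt_const_bool pt_Pair pt_fst pt_snd pt_add pt_diff pt_mult pt_div pt_mod pt_less
  pt_le pt_eq pt_Suc pt_not pt_conj pt_disj pt_imp pt_if pt_of_bool pt_min pt_Nil pt_Cons pt_null pt_hd_or pt_rev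
  pt_append pt_concat pt_floorlog pt_sum_list pt_length pt_nth_or pt_bex pt_ball pt_power
  pt_map_upt pt_filter_upt pt_sum' pt_ex_less' pt_all_less'

lemmas pb_rules = pb_min2 pb_const pb_mult pb_add pb_power pb_diff pb_div pb_length

lemma pt_digit:
  assumes p: "polytime e eN B" "polytime e eN a" "polytime e eN i"
    and b: "poly_bounded e i"
  shows "polytime e eN (\<lambda>x. digit (B x) (a x) (i x))"
  unfolding digit_def
  by (rule pt_rules pb_rules p b p[THEN pt_comp] b[THEN pb_ptcomp])+

lemma pt_undigits:
  assumes p: "polytime e eN B" "polytime e eN d" and b: "poly_bounded e d" and c: "polytime (eP e eN) eN (\<lambda>p. c (fst p) (min (snd p) (d (fst p))))"
  shows "polytime e eN (\<lambda>x. undigits (B x) (d x) (c x))"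
  unfolding undigits_def
  by (rule c pt_rules pb_rules p b p[THEN pt_comp] b[THEN pb_ptcomp])+

lemma pt_fadd:
  assumes p: "polytime e eN d" "polytime e eN a" "polytime e eN b"
    and b: "poly_bounded e d"
  shows "polytime e eN (\<lambda>x. fadd (d x) (a x) (b x))"
  unfolding fadd_def
  by (rule pt_undigits pt_digit pt_rules pb_rules p b p[THEN pt_comp] b[THEN pb_ptcomp])+

lemma pt_mulx:
  assumes p: "polytime e eN d" "polytime e eN f" "polytime e eN y"
    and b: "poly_bounded e d"
  shows "polytime e eN (\<lambda>x. mulx (d x) (f x) (y x))"
  unfolding mulx_def
  by (rule pt_fadd pt_digit pt_rules pb_rules p b p[THEN pt_comp] b[THEN pb_ptcomp])+

lemma vsize_le: "a < 2 ^ k \<Longrightarrow> vsize (VNat a) \<le> 1 + k"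
  using floorlog_le[of a k] by simp

lemma pt_fmul:
  assumes p: "polytime e eN d" "polytime e eN f" "polytime e eN a" "polytime e eN y" and b: "poly_bounded e d"
  shows "polytime e eN (\<lambda>x. fmul (d x) (f x) (a x) (y x))"
  unfolding fmul_def
proof (rule pt_fold)
  show "polytime e (eL eN) (\<lambda>x. [0..<d x])" by (rule pt_upt p b)+
  show "poly_bounded e (\<lambda>x. 1 + d x)" by (rule pb_rules b)+
  show "vsize (VNat (fold (\<lambda>i s. fadd (d x) (mulx (d x) (f x) s) (digit 2 (a x) (d x - 1 - i) * y x)) ys 0)) \<le> 1 + d x"
    for x and ys :: "nat list"
    by (rule vsize_le, cases ys rule: rev_cases) (auto simp: fadd_less)
  show "polytime (eP (eP e eN) eN) eN (\<lambda>p. fadd (d (fst (fst p))) (mulx (d (fst (fst p))) (f (fst (fst p))) (snd p))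
             (digit 2 (a (fst (fst p))) (d (fst (fst p)) - 1 - snd (fst p)) * y (fst (fst p))))"
    by (rule pt_fadd pt_mulx pt_digit pt_rules pb_rules p b p[THEN pt_comp] b[THEN pb_ptcomp])+
qed (rule pt_const_nat)

lemma pt_fsum:
  assumes p: "polytime e eN d" "polytime e (eL eN) l" and b: "poly_bounded e d"
  shows "polytime e eN (\<lambda>x. fsum (d x) (l x))"
  unfolding fsum_def
proof (rule pt_fold[OF p(2)])
  show "poly_bounded e (\<lambda>x. 1 + d x)" by (rule pb_rules b)+
  show "vsize (VNat (fold (\<lambda>y s. fadd (d x) y s) ys 0)) \<le> 1 + d x" for x ys
    by (rule vsize_le) (rule fsum_less[unfolded fsum_def])
  show "polytime (eP (eP e eN) eN) eN (\<lambda>p. fadd (d (fst (fst p))) (snd (fst p)) (snd p))"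
    by (rule pt_fadd pt_rules pb_rules p b p[THEN pt_comp] b[THEN pb_ptcomp])+
qed (rule pt_const_nat)

lemma pt_fpow:
  assumes p: "polytime e eN d" "polytime e eN f" "polytime e eN a" "polytime e eN j" and b: "poly_bounded e d" "poly_bounded e j"
  shows "polytime e eN (\<lambda>x. fpow (d x) (f x) (a x) (j x))"
  unfolding fpow_def
proof (rule pt_fold)
  show "polytime e (eL eN) (\<lambda>x. [0..<j x])" by (rule pt_upt p b)+
  show "poly_bounded e (\<lambda>x. 2 + d x)" by (rule pb_rules b)+
  show "vsize (VNat (fold (\<lambda>_ s. fmul (d x) (f x) (a x) s) ys 1)) \<le> 2 + d x" for x and ys :: "nat list"
  proof (cases ys rule: rev_cases)
    case Nil
    then show ?thesis using vsize_le[of 1 1] by simp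
  next
    case (snoc zs z)
    then show ?thesis using vsize_le[OF fmul_less] by (simp del: vsize.simps add: le_SucI)
  qed
  show "polytime (eP (eP e eN) eN) eN (\<lambda>p. fmul (d (fst (fst p))) (f (fst (fst p))) (a (fst (fst p))) (snd p))"
    by (rule pt_fmul pt_rules pb_rules p b p[THEN pt_comp] b[THEN pb_ptcomp])+
qed (rule pt_const_nat)

lemma pt_finv:
  assumes p: "polytime e eN d" "polytime e eN f" "polytime e eN a"
    and b: "poly_bounded e d" "poly_bounded e (\<lambda>x. 2 ^ d x)"
  shows "polytime e eN (\<lambda>x. finv (d x) (f x) (a x))"
  unfolding finv_def
  by (rule pt_fmul pt_rules pb_rules p b p[THEN pt_comp] b[THEN pb_ptcomp])+

lemma pt_dot:
  assumes p: "polytime e eN d" "polytime e eN f" "polytime e (eL eN) u" "polytime e (eL eN) v"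
    and b: "poly_bounded e d"
  shows "polytime e eN (\<lambda>x. dot (d x) (f x) (u x) (v x))"
  unfolding dot_def
  by (rule pt_fsum pt_fmul pt_rules pb_rules p b p[THEN pt_comp] b[THEN pb_ptcomp])+

lemma pt_vcomb:
  assumes p: "polytime e eN d" "polytime e eN f" "polytime e eN s" "polytime e (eL eN) u" "polytime e eN r" "polytime e (eL eN) v"
    and b: "poly_bounded e d"
  shows "polytime e (eL eN) (\<lambda>x. vcomb (d x) (f x) (s x) (u x) (r x) (v x))"
  unfolding vcomb_def
  by (rule pt_fmul pt_fadd pt_rules pb_rules p b p[THEN pt_comp] b[THEN pb_ptcomp])+

lemma pt_kernel_pivots:
  assumes p: "polytime e eN d" "polytime e eN f" "polytime e (eL eN) r" "polytime e (eL (eL eN)) B"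
    and b: "poly_bounded e d"
  shows "polytime e (eL (eL eN)) (\<lambda>x. kernel_pivots (d x) (f x) (r x) (B x))"
  unfolding kernel_pivots_def
  by (rule pt_filter pt_dot pt_rules pb_rules p b p[THEN pt_comp] b[THEN pb_ptcomp])+

lemma pt_kernel_step:
  assumes p: "polytime e eN d" "polytime e eN f" "polytime e (eL eN) r" "polytime e (eL (eL eN)) B"
    and b: "poly_bounded e d"
  shows "polytime e (eL (eL eN)) (\<lambda>x. kernel_step (d x) (f x) (r x) (B x))"
  unfolding kernel_step_def
  by (rule pt_map pt_vcomb pt_dot pt_kernel_pivots pt_rules pb_rules p b p[THEN pt_comp] b[THEN pb_ptcomp])+

lemma pt_unit_vecs:
  assumes p: "polytime e eN n"
    and b: "poly_bounded e n"
  shows "polytime e (eL (eL eN)) (\<lambda>x. unit_vecs (n x))"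
  unfolding unit_vecs_def
  by (rule pt_rules pb_rules p b p[THEN pt_comp] b[THEN pb_ptcomp])+

text \<open>The exponent is \<open>d + 1\<close> because the unit vectors contain 1, which is not
  below \<open>2 ^ d\<close> for \<open>d = 0\<close>; the running time is bounded on such inputs
  too.\<close>

definition kwf :: "nat \<Rightarrow> nat \<Rightarrow> nat list list \<Rightarrow> bool" where
  "kwf d n B \<longleftrightarrow> length B = n \<and> (\<forall>b\<in>set B. length b = n \<and> (\<forall>x\<in>set b. x < 2 ^ (d + 1)))"

lemma kwf_kernel_step: assumes "kwf d n B" shows "kwf d n (kernel_step d f r B)"
proof -
  have "fadd d a b < 2 ^ (d + 1)" for a b using fadd_less[of d a b] by simp
  then show ?thesis using assms unfolding kwf_def kernel_step_def vcomb_def by auto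
qed

lemma kwf_size: assumes "kwf d n B" shows "vsize (eL (eL eN) B) \<le> 1 + n * (2 + n * (3 + d))"
proof -
  have "vsize (eL eN b) \<le> 1 + n * (3 + d)" if "b \<in> set B" for b
  proof -
    have "vsize (VNat x) \<le> 2 + d" if "x \<in> set b" for x
      using vsize_le[of x "d + 1"] assms \<open>b \<in> set B\<close> that unfolding kwf_def by simp
    then have "sum_list (map (\<lambda>x. 1 + vsize (VNat x)) b) \<le> sum_list (map (\<lambda>x. 3 + d) b)"
      by (intro sum_list_mono) (simp del: vsize.simps)
    also have "\<dots> = n * (3 + d)" using assms that unfolding kwf_def by (simp add: map_replicate_const sum_list_replicate)
    finally show ?thesis by (simp add: vsize_eL)
  qed
  then have "sum_list (map (\<lambda>b. 1 + vsize (eL eN b)) B) \<le> sum_list (map (\<lambda>b. 2 + n * (3 + d)) B)"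
    by (intro sum_list_mono) fastforce
  also have "\<dots> = n * (2 + n * (3 + d))" using assms unfolding kwf_def by (simp add: map_replicate_const sum_list_replicate)
  finally show ?thesis by (simp add: vsize_eL)
qed

lemma pt_kernel_vec:
  assumes p: "polytime e eN d" "polytime e eN f" "polytime e eN n" "polytime e (eL (eL eN)) l" and b: "poly_bounded e d" "poly_bounded e n"
  shows "polytime e (eL eN) (\<lambda>x. kernel_vec (d x) (f x) (n x) (l x))"
proof -
  have "polytime e (eL (eL eN)) (\<lambda>x. fold (\<lambda>rw B. kernel_step (d x) (f x) rw B) (l x) (unit_vecs (n x)))"
  proof (rule pt_fold[OF p(4)])
    show "polytime e (eL (eL eN)) (\<lambda>x. unit_vecs (n x))" by (rule pt_unit_vecs p b)+
    show "poly_bounded e (\<lambda>x. 1 + n x * (2 + n x * (3 + d x)))" by (rule pb_rules b)+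
    show "polytime (eP (eP e (eL eN)) (eL (eL eN))) (eL (eL eN)) (\<lambda>p. kernel_step (d (fst (fst p))) (f (fst (fst p))) (snd (fst p)) (snd p))"
      by (rule pt_kernel_step pt_rules pb_rules p b p[THEN pt_comp] b[THEN pb_ptcomp])+
    have "kwf (d x) (n x) (fold (\<lambda>rw B. kernel_step (d x) (f x) rw B) ys B)" if "kwf (d x) (n x) B" for x ys B
      using that by (induction ys arbitrary: B) (auto simp: kwf_kernel_step)
    moreover have "kwf (d x) (n x) (unit_vecs (n x))" for x
      using one_less_power[of "2::nat" "Suc (d x)"] by (auto simp: kwf_def unit_vecs_def)
    ultimately show "vsize (eL (eL eN) (fold (\<lambda>rw B. kernel_step (d x) (f x) rw B) ys (unit_vecs (n x)))) \<le> 1 + n x * (2 + n x * (3 + d x))" for x ys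
      by (intro kwf_size) blast
  qed
  then have "polytime e (eL (eL eN)) (\<lambda>x. filter (\<lambda>b. sum_list b \<noteq> 0) (fold (\<lambda>rw B. kernel_step (d x) (f x) rw B) (l x) (unit_vecs (n x))))"
    by (rule pt_filter) (rule pt_rules)+
  then show ?thesis unfolding kernel_vec_def by (rule pt_hd_or) (rule pt_Nil)
qed

lemma pt_dec_lam:
  assumes p: "polytime e eN d" "polytime e eN f" "polytime e (eL eN) E" "polytime e eN J" "polytime e (eL eN) s"
    and b: "poly_bounded e d" "poly_bounded e J"
  shows "polytime e (eL eN) (\<lambda>x. dec_lam (d x) (f x) (E x) (J x) (s x))"
  unfolding dec_lam_def dec_tau_def
  by (rule pt_kernel_vec pt_fpow pt_map_upt pt_map pt_rules pb_rules p b p[THEN pt_comp] b[THEN pb_ptcomp])+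

lemma pt_dec_roots:
  assumes p: "polytime e eN d" "polytime e eN f" "polytime e (eL eN) E" "polytime e eN J" "polytime e (eL eN) s" "polytime e (eL eN) l" "polytime e (eL eN) V"
    and b: "poly_bounded e d" "poly_bounded e J"
  shows "polytime e (eL eN) (\<lambda>x. dec_roots (d x) (f x) (E x) (J x) (s x) (l x) (V x))"
  unfolding dec_roots_def dec_tau_def
  by (rule pt_fsum pt_fmul pt_fpow pt_filter pt_rules pb_rules p b p[THEN pt_comp] b[THEN pb_ptcomp])+

lemma pt_dec_sol:
  assumes p: "polytime e eN d" "polytime e eN f" "polytime e (eL eN) s" "polytime e (eL eN) Z"
    and b: "poly_bounded e d"
  shows "polytime e (eL eN) (\<lambda>x. dec_sol (d x) (f x) (s x) (Z x))"
  unfolding dec_sol_def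
  by (rule pt_kernel_vec pt_fpow pt_map_upt pt_map pt_rules pb_rules p b p[THEN pt_comp] b[THEN pb_ptcomp])+

lemma pt_dec_val:
  assumes p: "polytime e eN d" "polytime e eN f" "polytime e (eL eN) Z" "polytime e (eL eN) k" "polytime e eN v"
    and b: "poly_bounded e d" "poly_bounded e (\<lambda>x. 2 ^ d x)"
  shows "polytime e eN (\<lambda>x. dec_val (d x) (f x) (Z x) (k x) (v x))"
  unfolding dec_val_def
  by (rule pt_fsum pt_fmul pt_finv pt_rules pb_rules p b p[THEN pt_comp] b[THEN pb_ptcomp])+

lemma pt_dec_fin:
  assumes p: "polytime e eN d" "polytime e eN f" "polytime e (eL eN) V" "polytime e (eL eN) s" "polytime e (eL eN) Z"
    and b: "poly_bounded e d" "poly_bounded e (\<lambda>x. 2 ^ d x)"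
  shows "polytime e (eL eN) (\<lambda>x. dec_fin (d x) (f x) (V x) (s x) (Z x))"
  unfolding dec_fin_def
  by (rule pt_map pt_dec_val pt_dec_sol pt_rules pb_rules p b p[THEN pt_comp] b[THEN pb_ptcomp])+

lemma pt_decode:
  assumes p: "polytime e eN d" "polytime e eN f" "polytime e (eL eN) V" "polytime e (eL eN) E" "polytime e eN J" "polytime e (eL eN) s"
    and b: "poly_bounded e d" "poly_bounded e (\<lambda>x. 2 ^ d x)" "poly_bounded e J"
  shows "polytime e (eL eN) (\<lambda>x. decode (d x) (f x) (V x) (E x) (J x) (s x))"
  unfolding decode_def
  by (rule pt_dec_fin pt_dec_roots pt_dec_lam pt_rules pb_rules p b p[THEN pt_comp] b[THEN pb_ptcomp])+

text \<open>The modulus is searched for at run time. Sketch and recovery find the same one, so it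
  need not be part of the sketch.\<close>

definition gfmod :: "nat \<Rightarrow> nat" where
  "gfmod d = hd_or 0 (filter (\<lambda>f. is_gf_modulus d f) [0..<2 ^ d])"

lemma pt_gfmod:
  assumes p: "polytime e eN d" and b: "poly_bounded e d" "poly_bounded e (\<lambda>x. 2 ^ d x)"
  shows "polytime e eN (\<lambda>x. gfmod (d x))"
  unfolding gfmod_def is_gf_modulus_def
  by (rule pt_fmul pt_rules pb_rules p b p[THEN pt_comp] b[THEN pb_ptcomp])+

lemma gfmod: assumes "0 < d" shows "is_gf_modulus d (gfmod d)" "gfmod d < 2 ^ d"
proof -
  obtain f where "f < 2 ^ d" "is_gf_modulus d f" using is_gf_modulus_exists[OF assms] by blast
  then show "is_gf_modulus d (gfmod d)" "gfmod d < 2 ^ d"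
    using hd_or_filter[of f "[0..<2 ^ d]" "\<lambda>f. is_gf_modulus d f" 0] unfolding gfmod_def by auto
qed

section \<open>The sketch and the recovery procedure\<close>

text \<open>A shingle is a block of \<open>c\<close> consecutive characters, coded as a positive number of \<open>shingle_bits F c\<close> bits.
  It is split into a part of \<open>d0\<close> bits and \<open>L\<close> layers of \<open>d\<close> bits. The coins \<open>a\<close> are the point
  at which the layers, as coefficients of a polynomial over GF(2^\<open>d0\<close>), are evaluated by the hash function.\<close>

definition shingle_bits :: "nat \<Rightarrow> nat \<Rightarrow> nat" where "shingle_bits F c = floorlog 2 (F ^ c)"
text \<open>The factor 6 comes from \<open>J0_bound\<close>: with \<open>x = 2 * n * al + 1\<close>,
  each of \<open>J0\<close>, \<open>J0 + 1\<close> and the squared number of shingle positions is at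
  most \<open>x ^ 2\<close>. Still \<open>2 ^ d\<close> is polynomial in \<open>n\<close> and
  \<open>al\<close>.\<close>

definition field_bits :: "nat \<Rightarrow> nat \<Rightarrow> nat" where "field_bits n al = 6 * floorlog 2 (2 * n * al + 1)"
text \<open>The remainder of the division by \<open>d\<close> goes into the hash, so that all layers
  have exactly \<open>d\<close> bits and fit into GF(2^\<open>d0\<close>). If \<open>al < d\<close>,
  there are no layers and the shingle is its own hash value.\<close>

definition hash_bits :: "nat \<Rightarrow> nat \<Rightarrow> nat" where "hash_bits al d = (if al < d then al else d + al mod d)"
definition num_layers :: "nat \<Rightarrow> nat \<Rightarrow> nat" where "num_layers al d = al div d - 1"

text \<open>The offset 1 separates all shingles from 0, whose hash value is 0 for every coin.
  Avoiding the hash value 0 thus amounts to avoiding one more collision.\<close>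

definition shingle_num :: "nat \<Rightarrow> nat \<Rightarrow> nat list \<Rightarrow> nat \<Rightarrow> nat" where
  "shingle_num F c ws i = 1 + undigits F c (\<lambda>j. nth_or 0 ws (i + j))"
definition shingle_nums :: "nat \<Rightarrow> nat \<Rightarrow> nat \<Rightarrow> nat list \<Rightarrow> nat list" where
  "shingle_nums F n c ws = map (\<lambda>i. shingle_num F c ws i) [0..<n - c + 1]"

definition layer :: "nat \<Rightarrow> nat \<Rightarrow> nat \<Rightarrow> nat \<Rightarrow> nat" where
  "layer d d0 u i = u div 2 ^ (d0 + i * d) mod 2 ^ d"
text \<open>The powers of \<open>a\<close> start at 1, since the constant coefficient is reserved
  for the low bits of the shingle.\<close>

definition hash_mix :: "nat \<Rightarrow> nat \<Rightarrow> nat \<Rightarrow> nat \<Rightarrow> (nat \<Rightarrow> nat) \<Rightarrow> nat" where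
  "hash_mix d0 f0 L a z = fsum d0 (map (\<lambda>i. fmul d0 f0 (fpow d0 f0 a (i + 1)) (z i)) [0..<L])"
definition hash_val :: "nat \<Rightarrow> nat \<Rightarrow> nat \<Rightarrow> nat \<Rightarrow> nat \<Rightarrow> nat \<Rightarrow> nat" where
  "hash_val d0 f0 d L a u = fadd d0 (u mod 2 ^ d0) (hash_mix d0 f0 L a (\<lambda>i. layer d d0 u i))"
text \<open>The hash value 0 is forbidden because power sums with positive exponents do not see
  it.\<close>

definition good_hash :: "nat \<Rightarrow> nat \<Rightarrow> nat \<Rightarrow> nat \<Rightarrow> nat list \<Rightarrow> nat \<Rightarrow> bool" where
  "good_hash d0 f0 d L xs a \<longleftrightarrow> (\<forall>u\<in>set xs. \<not> hash_val d0 f0 d L a u = 0 \<and>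
     (\<forall>v\<in>set xs. hash_val d0 f0 d L a u = hash_val d0 f0 d L a v \<longrightarrow> u = v))"
definition pick_hash :: "nat \<Rightarrow> nat \<Rightarrow> nat \<Rightarrow> nat \<Rightarrow> nat list \<Rightarrow> nat \<Rightarrow> nat" where
  "pick_hash d0 f0 d L xs a = (if good_hash d0 f0 d L xs a then a else
     hd_or 0 (filter (\<lambda>a. good_hash d0 f0 d L xs a) [0..<2 ^ d0]))"
definition hash_set :: "nat \<Rightarrow> nat \<Rightarrow> nat \<Rightarrow> nat \<Rightarrow> nat \<Rightarrow> nat list \<Rightarrow> nat list" where
  "hash_set d0 f0 d L a xs = filter (\<lambda>v. \<not> v = 0 \<and> (\<exists>u\<in>set xs. hash_val d0 f0 d L a u = v)) [0..<2 ^ d0]"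
text \<open>The blocks that cover the string start at \<open>block_pos n c b\<close>. The last one may overlap its predecessor.\<close>

definition block_pos :: "nat \<Rightarrow> nat \<Rightarrow> nat \<Rightarrow> nat" where "block_pos n c b = min (b * c) (n - c)"
definition num_blocks :: "nat \<Rightarrow> nat \<Rightarrow> nat" where "num_blocks n c = (n + c - 1) div c"
definition ranks :: "nat \<Rightarrow> nat \<Rightarrow> nat \<Rightarrow> nat \<Rightarrow> nat \<Rightarrow> nat \<Rightarrow> nat \<Rightarrow> nat \<Rightarrow> nat list \<Rightarrow> nat list \<Rightarrow> nat list" where
  "ranks F n c d0 f0 d L a ws G = map (\<lambda>b. length (filter (\<lambda>u. u < hash_val d0 f0 d L a (shingle_num F c ws (block_pos n c b))) G)) [0..<num_blocks n c]"
definition power_sum :: "nat \<Rightarrow> nat \<Rightarrow> nat list \<Rightarrow> nat \<Rightarrow> nat" where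
  "power_sum d0 f0 G j = fsum d0 (map (\<lambda>v. fpow d0 f0 v j) G)"
definition bch_syndromes :: "nat \<Rightarrow> nat \<Rightarrow> nat \<Rightarrow> nat list \<Rightarrow> nat list" where
  "bch_syndromes d0 f0 dl G = map (\<lambda>i. power_sum d0 f0 G (2 * i + 1)) [0..<dl]"
definition preimages :: "nat \<Rightarrow> nat \<Rightarrow> nat \<Rightarrow> nat \<Rightarrow> nat \<Rightarrow> nat list \<Rightarrow> nat list \<Rightarrow> nat list" where
  "preimages d0 f0 d L a xs G = map (\<lambda>v. hd_or 0 (filter (\<lambda>u. hash_val d0 f0 d L a u = v) xs)) G"
definition rs_syndrome :: "nat \<Rightarrow> nat \<Rightarrow> nat \<Rightarrow> nat list \<Rightarrow> nat \<Rightarrow> nat \<Rightarrow> nat" where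
  "rs_syndrome d f d0 ys i j = fsum d (map (\<lambda>r. fmul d f (layer d d0 (nth_or 0 ys r) i) (fpow d f r j)) [0..<length ys])"
definition rs_syndromes :: "nat \<Rightarrow> nat \<Rightarrow> nat \<Rightarrow> nat \<Rightarrow> nat \<Rightarrow> nat list \<Rightarrow> nat list" where
  "rs_syndromes d f d0 dl L ys = concat (map (\<lambda>i. map (\<lambda>j. rs_syndrome d f d0 ys i j) [0..<dl]) [0..<L])"

definition sk_core :: "nat \<Rightarrow> nat \<Rightarrow> nat \<Rightarrow> nat \<Rightarrow> nat \<Rightarrow> nat \<Rightarrow> nat \<Rightarrow> nat \<Rightarrow> nat \<Rightarrow> nat list \<Rightarrow> nat \<Rightarrow> nat list" where
  "sk_core F n c dl d0 f0 d f L ws a =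
     a # ranks F n c d0 f0 d L a ws (hash_set d0 f0 d L a (shingle_nums F n c ws)) @
     bch_syndromes d0 f0 dl (hash_set d0 f0 d L a (shingle_nums F n c ws)) @
     rs_syndromes d f d0 dl L (preimages d0 f0 d L a (shingle_nums F n c ws) (hash_set d0 f0 d L a (shingle_nums F n c ws)))"
definition sk_main :: "nat \<Rightarrow> nat \<Rightarrow> nat \<Rightarrow> nat \<Rightarrow> nat \<Rightarrow> nat \<Rightarrow> nat \<Rightarrow> nat \<Rightarrow> nat \<Rightarrow> nat list \<Rightarrow> nat \<Rightarrow> nat list" where
  "sk_main F n c dl d0 f0 d f L ws a = sk_core F n c dl d0 f0 d f L ws (pick_hash d0 f0 d L (shingle_nums F n c ws) a)"
text \<open>For \<open>t = 0\<close> the close string is the string itself. If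
  \<open>n \<le> (2 * c - 1) * t\<close>, the string may be stored in full within the permitted
  loss. As \<open>t\<close> is given in binary, the minimum with \<open>n\<close> is what bounds the
  number of syndromes polynomially.\<close>

definition sk_nums :: "nat \<Rightarrow> nat \<Rightarrow> nat \<Rightarrow> nat \<Rightarrow> nat \<Rightarrow> nat \<Rightarrow> nat list \<Rightarrow> nat \<Rightarrow> nat list" where
  "sk_nums F n c t d0 d ws a = (if t = 0 then [] else if n \<le> (2 * c - 1) * t then ws else
     sk_main F n c (min ((2 * c - 1) * t) n) d0 (gfmod d0) d (gfmod d) (num_layers (shingle_bits F c) d) ws a)"

text \<open>One width for everything: characters are below \<open>2 ^ floorlog 2 F\<close>, ranks
  below \<open>2 ^ n\<close>, field elements below \<open>2 ^ d0\<close>, and the sum dominates all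
  three exponents.\<close>

definition num_width :: "nat \<Rightarrow> nat \<Rightarrow> nat \<Rightarrow> nat" where "num_width F n d0 = floorlog 2 F + n + d0"
definition to_bits :: "nat \<Rightarrow> nat list \<Rightarrow> bool list" where
  "to_bits W xs = concat (map (\<lambda>x. map (\<lambda>j. digit 2 x j = 1) [0..<W]) xs)"
definition get_num :: "nat \<Rightarrow> bool list \<Rightarrow> nat \<Rightarrow> nat" where
  "get_num W s i = undigits 2 W (\<lambda>j. of_bool (nth_or False s (i * W + j)))"

definition sketch :: "nat \<Rightarrow> nat \<Rightarrow> nat \<Rightarrow> nat \<Rightarrow> nat \<Rightarrow> nat \<Rightarrow> nat list \<Rightarrow> nat \<Rightarrow> bool list" where
  "sketch F n c t d0 d ws a = to_bits (num_width F n d0) (sk_nums F n c t d0 d ws a)"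

text \<open>In characteristic 2 the power sum of exponent \<open>2 j\<close> is the square of that of exponent \<open>j\<close>, so
  those with odd exponents, which are at the positions from \<open>k\<close> on, determine all others.\<close>

definition odd_diff_sum :: "nat \<Rightarrow> nat \<Rightarrow> nat \<Rightarrow> nat \<Rightarrow> bool list \<Rightarrow> nat list \<Rightarrow> nat \<Rightarrow> nat" where
  "odd_diff_sum d0 f0 W k s G j = fadd d0 (get_num W s (k + j div 2)) (power_sum d0 f0 G j)"
definition odd_part :: "nat \<Rightarrow> nat" where
  "odd_part j = hd_or 0 (filter (\<lambda>m. m mod 2 = 1 \<and> (\<exists>k<j + 1. m * 2 ^ k = j)) [0..<j + 1])"
definition diff_sum :: "nat \<Rightarrow> nat \<Rightarrow> nat \<Rightarrow> nat \<Rightarrow> bool list \<Rightarrow> nat list \<Rightarrow> nat \<Rightarrow> nat" where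
  "diff_sum d0 f0 W k s G j = fpow d0 f0 (odd_diff_sum d0 f0 W k s G (odd_part j)) (j div odd_part j)"
definition hash_diff :: "nat \<Rightarrow> nat \<Rightarrow> nat \<Rightarrow> nat \<Rightarrow> nat \<Rightarrow> bool list \<Rightarrow> nat list \<Rightarrow> nat list" where
  "hash_diff d0 f0 dl W k s G = decode d0 f0 [0..<2 ^ d0] [] (2 * dl) (map (\<lambda>i. diff_sum d0 f0 W k s G (i + 1)) [0..<2 * dl])"
definition fix_hashes :: "nat \<Rightarrow> nat list \<Rightarrow> nat list \<Rightarrow> nat list" where
  "fix_hashes d0 es G = filter (\<lambda>v. \<not> v = 0 \<and> ((\<exists>u\<in>set G. u = v) \<and> nth_or 0 es v = 0 \<or> \<not> (\<exists>u\<in>set G. u = v) \<and> \<not> nth_or 0 es v = 0)) [0..<2 ^ d0]"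
definition candidates :: "nat \<Rightarrow> nat \<Rightarrow> nat \<Rightarrow> nat \<Rightarrow> nat \<Rightarrow> nat list \<Rightarrow> nat \<Rightarrow> nat list" where
  "candidates d0 f0 d L a xs v = filter (\<lambda>u. hash_val d0 f0 d L a u = v) xs"
text \<open>Elements are compared instead of counted, because a shingle that occurs repeatedly in
  the string is repeated in the list.\<close>

definition single :: "nat list \<Rightarrow> bool" where
  "single C \<longleftrightarrow> \<not> C = [] \<and> (\<forall>u\<in>set C. u = hd_or 0 C)"
definition guess :: "nat \<Rightarrow> nat \<Rightarrow> nat \<Rightarrow> nat \<Rightarrow> nat \<Rightarrow> nat list \<Rightarrow> nat list \<Rightarrow> nat list" where
  "guess d0 f0 d L a xs G = map (\<lambda>v. if single (candidates d0 f0 d L a xs v) then hd_or 0 (candidates d0 f0 d L a xs v) else 0) G"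
definition erasures :: "nat \<Rightarrow> nat \<Rightarrow> nat \<Rightarrow> nat \<Rightarrow> nat \<Rightarrow> nat list \<Rightarrow> nat list \<Rightarrow> nat list" where
  "erasures d0 f0 d L a xs G = filter (\<lambda>r. \<not> single (candidates d0 f0 d L a xs (nth_or 0 G r))) [0..<length G]"
definition layer_errors :: "nat \<Rightarrow> nat \<Rightarrow> nat \<Rightarrow> nat \<Rightarrow> nat \<Rightarrow> nat \<Rightarrow> bool list \<Rightarrow> nat list \<Rightarrow> nat list \<Rightarrow> nat \<Rightarrow> nat list" where
  "layer_errors d f d0 dl W k s ys E i = decode d f [0..<length ys] E dl
     (map (\<lambda>j. fadd d (get_num W s (k + i * dl + j)) (rs_syndrome d f d0 ys i j)) [0..<dl])"
definition fix_layers :: "nat \<Rightarrow> nat \<Rightarrow> nat \<Rightarrow> nat \<Rightarrow> nat \<Rightarrow> nat \<Rightarrow> nat \<Rightarrow> bool list \<Rightarrow> nat list \<Rightarrow> nat list \<Rightarrow> nat list list" where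
  "fix_layers d f d0 dl L W k s ys E = map (\<lambda>i. map (\<lambda>r. fadd d (layer d d0 (nth_or 0 ys r) i) (nth_or 0 (layer_errors d f d0 dl W k s ys E i) r)) [0..<length ys]) [0..<L]"
text \<open>Once the layers are known, adding their mix to the hash value again uncovers the low
  \<open>d0\<close> bits.\<close>

definition join_shingle :: "nat \<Rightarrow> nat \<Rightarrow> nat \<Rightarrow> nat \<Rightarrow> nat \<Rightarrow> nat list \<Rightarrow> nat list list \<Rightarrow> nat \<Rightarrow> nat" where
  "join_shingle d0 f0 d L a G Z r = fadd d0 (nth_or 0 G r) (hash_mix d0 f0 L a (\<lambda>i. nth_or 0 (nth_or [] Z i) r)) +
     (\<Sum>i<L. nth_or 0 (nth_or [] Z i) r * 2 ^ (d0 + i * d))"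
text \<open>In the sketch the summand 1 skips the coins. Subtracting 1 from the shingle undoes the
  offset of \<open>shingle_num\<close>.\<close>

definition output_string :: "nat \<Rightarrow> nat \<Rightarrow> nat \<Rightarrow> nat \<Rightarrow> nat \<Rightarrow> nat \<Rightarrow> nat \<Rightarrow> nat \<Rightarrow> nat \<Rightarrow> bool list \<Rightarrow> nat list \<Rightarrow> nat list list \<Rightarrow> nat list" where
  "output_string F n c d0 f0 d L a W s G Z = map (\<lambda>j. digit F (join_shingle d0 f0 d L a G Z (get_num W s (1 + j div c)) - 1) (j - block_pos n c (j div c))) [0..<n]"

text \<open>The stages \<open>rc1\<close>, \<open>rc2\<close> and \<open>rc3\<close> act as
  let-bindings for lists that are used several times.\<close>

definition rc3 :: "nat \<Rightarrow> nat \<Rightarrow> nat \<Rightarrow> nat \<Rightarrow> nat \<Rightarrow> nat \<Rightarrow> nat \<Rightarrow> nat \<Rightarrow> nat \<Rightarrow> nat \<Rightarrow> bool list \<Rightarrow> nat \<Rightarrow> nat list \<Rightarrow> nat list \<Rightarrow> nat list" where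
  "rc3 F n c dl d0 f0 d f L W s a xs G = output_string F n c d0 f0 d L a W s G
     (fix_layers d f d0 dl L W (1 + num_blocks n c + dl) s (guess d0 f0 d L a xs G) (erasures d0 f0 d L a xs G))"
definition rc2 :: "nat \<Rightarrow> nat \<Rightarrow> nat \<Rightarrow> nat \<Rightarrow> nat \<Rightarrow> nat \<Rightarrow> nat \<Rightarrow> nat \<Rightarrow> nat \<Rightarrow> nat \<Rightarrow> bool list \<Rightarrow> nat \<Rightarrow> nat list \<Rightarrow> nat list \<Rightarrow> nat list" where
  "rc2 F n c dl d0 f0 d f L W s a xs G = rc3 F n c dl d0 f0 d f L W s a xs (fix_hashes d0 (hash_diff d0 f0 dl W (1 + num_blocks n c) s G) G)"
definition rc1 :: "nat \<Rightarrow> nat \<Rightarrow> nat \<Rightarrow> nat \<Rightarrow> nat \<Rightarrow> nat \<Rightarrow> nat \<Rightarrow> nat \<Rightarrow> nat \<Rightarrow> nat \<Rightarrow> bool list \<Rightarrow> nat \<Rightarrow> nat list \<Rightarrow> nat list" where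
  "rc1 F n c dl d0 f0 d f L W s a xs = rc2 F n c dl d0 f0 d f L W s a xs (hash_set d0 f0 d L a xs)"
definition recover :: "nat \<Rightarrow> nat \<Rightarrow> nat \<Rightarrow> nat \<Rightarrow> nat \<Rightarrow> nat \<Rightarrow> nat list \<Rightarrow> bool list \<Rightarrow> nat list" where
  "recover F n c t d0 d ws s = (if t = 0 then ws else if n \<le> (2 * c - 1) * t then map (\<lambda>i. get_num (num_width F n d0) s i) [0..<n] else
     rc1 F n c (min ((2 * c - 1) * t) n) d0 (gfmod d0) d (gfmod d) (num_layers (shingle_bits F c) d) (num_width F n d0) s (get_num (num_width F n d0) s 0 mod 2 ^ d0) (shingle_nums F n c ws))"
text \<open>Reduction modulo \<open>F\<close> makes the output a list of character codes even if the
  bit string is not a sketch.\<close>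

definition recover_mod :: "nat \<Rightarrow> nat \<Rightarrow> nat \<Rightarrow> nat \<Rightarrow> nat \<Rightarrow> nat \<Rightarrow> nat list \<Rightarrow> bool list \<Rightarrow> nat list" where
  "recover_mod F n c t d0 d ws s = map (\<lambda>v. v mod F) (recover F n c t d0 d ws s)"

section \<open>Running time of sketch and recovery\<close>

lemma pt_shingle_bits:
  assumes p: "polytime e eN F" "polytime e eN c"
    and b: "poly_bounded e c"
  shows "polytime e eN (\<lambda>x. shingle_bits (F x) (c x))"
  unfolding shingle_bits_def
  by (rule pt_rules pb_rules p b p[THEN pt_comp] b[THEN pb_ptcomp])+

lemma pt_field_bits:
  assumes p: "polytime e eN n" "polytime e eN al"
  shows "polytime e eN (\<lambda>x. field_bits (n x) (al x))"
  unfolding field_bits_def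
  by (rule pt_rules pb_rules p p[THEN pt_comp])+

lemma pt_hash_bits:
  assumes p: "polytime e eN al" "polytime e eN d"
  shows "polytime e eN (\<lambda>x. hash_bits (al x) (d x))"
  unfolding hash_bits_def
  by (rule pt_rules pb_rules p p[THEN pt_comp])+

lemma pt_num_layers:
  assumes p: "polytime e eN al" "polytime e eN d"
  shows "polytime e eN (\<lambda>x. num_layers (al x) (d x))"
  unfolding num_layers_def
  by (rule pt_rules pb_rules p p[THEN pt_comp])+

lemma pt_shingle_num:
  assumes p: "polytime e eN F" "polytime e eN c" "polytime e (eL eN) ws" "polytime e eN i"
    and b: "poly_bounded e c"
  shows "polytime e eN (\<lambda>x. shingle_num (F x) (c x) (ws x) (i x))"
  unfolding shingle_num_def
  by (rule pt_undigits pt_rules pb_rules p b p[THEN pt_comp] b[THEN pb_ptcomp])+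

lemma pt_shingle_nums:
  assumes p: "polytime e eN F" "polytime e eN n" "polytime e eN c" "polytime e (eL eN) ws"
    and b: "poly_bounded e n" "poly_bounded e c"
  shows "polytime e (eL eN) (\<lambda>x. shingle_nums (F x) (n x) (c x) (ws x))"
  unfolding shingle_nums_def
  by (rule pt_shingle_num pt_rules pb_rules p b p[THEN pt_comp] b[THEN pb_ptcomp])+

lemma pt_layer:
  assumes p: "polytime e eN d" "polytime e eN d0" "polytime e eN u" "polytime e eN i"
    and b: "poly_bounded e d" "poly_bounded e d0" "poly_bounded e i"
  shows "polytime e eN (\<lambda>x. layer (d x) (d0 x) (u x) (i x))"
  unfolding layer_def
  by (rule pt_rules pb_rules p b p[THEN pt_comp] b[THEN pb_ptcomp])+

lemma pt_hash_mix:
  assumes p: "polytime e eN d0" "polytime e eN f0" "polytime e eN L" "polytime e eN a" and b: "poly_bounded e d0" "poly_bounded e L"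
    and z: "polytime (eP e eN) eN (\<lambda>p. z (fst p) (min (snd p) (L (fst p))))"
  shows "polytime e eN (\<lambda>x. hash_mix (d0 x) (f0 x) (L x) (a x) (z x))"
  unfolding hash_mix_def
  by (rule z pt_fsum pt_fmul pt_fpow pt_rules pb_rules p b p[THEN pt_comp] b[THEN pb_ptcomp])+

lemma pt_hash_val:
  assumes p: "polytime e eN d0" "polytime e eN f0" "polytime e eN d" "polytime e eN L" "polytime e eN a" "polytime e eN u"
    and b: "poly_bounded e d0" "poly_bounded e d" "poly_bounded e L"
  shows "polytime e eN (\<lambda>x. hash_val (d0 x) (f0 x) (d x) (L x) (a x) (u x))"
  unfolding hash_val_def
  by (rule pt_fadd pt_hash_mix pt_layer pt_rules pb_rules p b p[THEN pt_comp] b[THEN pb_ptcomp])+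

lemma pt_good_hash:
  assumes p: "polytime e eN d0" "polytime e eN f0" "polytime e eN d" "polytime e eN L" "polytime e (eL eN) xs" "polytime e eN a"
    and b: "poly_bounded e d0" "poly_bounded e d" "poly_bounded e L"
  shows "polytime e eB (\<lambda>x. good_hash (d0 x) (f0 x) (d x) (L x) (xs x) (a x))"
  unfolding good_hash_def
  by (rule pt_hash_val pt_rules pb_rules p b p[THEN pt_comp] b[THEN pb_ptcomp])+

lemma pt_pick_hash:
  assumes p: "polytime e eN d0" "polytime e eN f0" "polytime e eN d" "polytime e eN L" "polytime e (eL eN) xs" "polytime e eN a"
    and b: "poly_bounded e d0" "poly_bounded e d" "poly_bounded e L" "poly_bounded e (\<lambda>x. 2 ^ d0 x)"
  shows "polytime e eN (\<lambda>x. pick_hash (d0 x) (f0 x) (d x) (L x) (xs x) (a x))"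
  unfolding pick_hash_def
  by (rule pt_good_hash pt_rules pb_rules p b p[THEN pt_comp] b[THEN pb_ptcomp])+

lemma pt_hash_set:
  assumes p: "polytime e eN d0" "polytime e eN f0" "polytime e eN d" "polytime e eN L" "polytime e eN a" "polytime e (eL eN) xs"
    and b: "poly_bounded e d0" "poly_bounded e d" "poly_bounded e L" "poly_bounded e (\<lambda>x. 2 ^ d0 x)"
  shows "polytime e (eL eN) (\<lambda>x. hash_set (d0 x) (f0 x) (d x) (L x) (a x) (xs x))"
  unfolding hash_set_def
  by (rule pt_hash_val pt_rules pb_rules p b p[THEN pt_comp] b[THEN pb_ptcomp])+

lemma pt_block_pos:
  assumes p: "polytime e eN n" "polytime e eN c" "polytime e eN bb"
  shows "polytime e eN (\<lambda>x. block_pos (n x) (c x) (bb x))"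
  unfolding block_pos_def
  by (rule pt_rules pb_rules p p[THEN pt_comp])+

lemma pt_num_blocks:
  assumes p: "polytime e eN n" "polytime e eN c"
  shows "polytime e eN (\<lambda>x. num_blocks (n x) (c x))"
  unfolding num_blocks_def
  by (rule pt_rules pb_rules p p[THEN pt_comp])+

lemma pb_num_blocks: assumes "poly_bounded e n" "poly_bounded e c" shows "poly_bounded e (\<lambda>x. num_blocks (n x) (c x))"
  unfolding num_blocks_def by (rule pb_rules assms)+

lemma pt_ranks:
  assumes p: "polytime e eN F" "polytime e eN n" "polytime e eN c" "polytime e eN d0" "polytime e eN f0" "polytime e eN d" "polytime e eN L" "polytime e eN a" "polytime e (eL eN) ws" "polytime e (eL eN) G"
    and b: "poly_bounded e n" "poly_bounded e c" "poly_bounded e d0" "poly_bounded e d" "poly_bounded e L"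
  shows "polytime e (eL eN) (\<lambda>x. ranks (F x) (n x) (c x) (d0 x) (f0 x) (d x) (L x) (a x) (ws x) (G x))"
  unfolding ranks_def
  by (rule pt_block_pos pt_num_blocks pb_num_blocks pt_hash_val pt_shingle_num pt_filter pt_rules pb_rules p b p[THEN pt_comp] b[THEN pb_ptcomp])+

lemma pt_power_sum:
  assumes p: "polytime e eN d0" "polytime e eN f0" "polytime e (eL eN) G" "polytime e eN j"
    and b: "poly_bounded e d0" "poly_bounded e j"
  shows "polytime e eN (\<lambda>x. power_sum (d0 x) (f0 x) (G x) (j x))"
  unfolding power_sum_def
  by (rule pt_fsum pt_fpow pt_map pt_rules pb_rules p b p[THEN pt_comp] b[THEN pb_ptcomp])+

lemma pt_bch_syndromes:
  assumes p: "polytime e eN d0" "polytime e eN f0" "polytime e eN dl" "polytime e (eL eN) G"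
    and b: "poly_bounded e d0" "poly_bounded e dl"
  shows "polytime e (eL eN) (\<lambda>x. bch_syndromes (d0 x) (f0 x) (dl x) (G x))"
  unfolding bch_syndromes_def
  by (rule pt_power_sum pt_rules pb_rules p b p[THEN pt_comp] b[THEN pb_ptcomp])+

lemma pt_preimages:
  assumes p: "polytime e eN d0" "polytime e eN f0" "polytime e eN d" "polytime e eN L" "polytime e eN a" "polytime e (eL eN) xs" "polytime e (eL eN) G"
    and b: "poly_bounded e d0" "poly_bounded e d" "poly_bounded e L"
  shows "polytime e (eL eN) (\<lambda>x. preimages (d0 x) (f0 x) (d x) (L x) (a x) (xs x) (G x))"
  unfolding preimages_def
  by (rule pt_hash_val pt_map pt_filter pt_rules pb_rules p b p[THEN pt_comp] b[THEN pb_ptcomp])+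

lemma pt_rs_syndrome:
  assumes p: "polytime e eN d" "polytime e eN f" "polytime e eN d0" "polytime e (eL eN) ys" "polytime e eN i" "polytime e eN j"
    and b: "poly_bounded e d" "poly_bounded e d0" "poly_bounded e i" "poly_bounded e j"
  shows "polytime e eN (\<lambda>x. rs_syndrome (d x) (f x) (d0 x) (ys x) (i x) (j x))"
  unfolding rs_syndrome_def
  by (rule pt_fsum pt_fmul pt_fpow pt_layer pt_rules pb_rules p b p[THEN pt_comp] b[THEN pb_ptcomp])+

lemma pt_rs_syndromes:
  assumes p: "polytime e eN d" "polytime e eN f" "polytime e eN d0" "polytime e eN dl" "polytime e eN L" "polytime e (eL eN) ys"
    and b: "poly_bounded e d" "poly_bounded e d0" "poly_bounded e dl" "poly_bounded e L"
  shows "polytime e (eL eN) (\<lambda>x. rs_syndromes (d x) (f x) (d0 x) (dl x) (L x) (ys x))"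
  unfolding rs_syndromes_def
  by (rule pt_rs_syndrome pt_rules pb_rules p b p[THEN pt_comp] b[THEN pb_ptcomp])+

lemma pt_sk_core:
  assumes p: "polytime e eN F" "polytime e eN n" "polytime e eN c" "polytime e eN dl" "polytime e eN d0" "polytime e eN f0" "polytime e eN d" "polytime e eN f" "polytime e eN L" "polytime e (eL eN) ws" "polytime e eN a"
    and b: "poly_bounded e n" "poly_bounded e c" "poly_bounded e dl" "poly_bounded e d0" "poly_bounded e d" "poly_bounded e L" "poly_bounded e (\<lambda>x. 2 ^ d0 x)"
  shows "polytime e (eL eN) (\<lambda>x. sk_core (F x) (n x) (c x) (dl x) (d0 x) (f0 x) (d x) (f x) (L x) (ws x) (a x))"
  unfolding sk_core_def
  by (rule pt_ranks pt_bch_syndromes pt_rs_syndromes pt_hash_set pt_preimages pt_shingle_nums pt_rules pb_rules p b p[THEN pt_comp] b[THEN pb_ptcomp])+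

lemma pt_sk_main:
  assumes p: "polytime e eN F" "polytime e eN n" "polytime e eN c" "polytime e eN dl" "polytime e eN d0" "polytime e eN f0" "polytime e eN d" "polytime e eN f" "polytime e eN L" "polytime e (eL eN) ws" "polytime e eN a"
    and b: "poly_bounded e n" "poly_bounded e c" "poly_bounded e dl" "poly_bounded e d0" "poly_bounded e d" "poly_bounded e L" "poly_bounded e (\<lambda>x. 2 ^ d0 x)"
  shows "polytime e (eL eN) (\<lambda>x. sk_main (F x) (n x) (c x) (dl x) (d0 x) (f0 x) (d x) (f x) (L x) (ws x) (a x))"
  unfolding sk_main_def
  by (rule pt_sk_core pt_pick_hash pt_shingle_nums pt_rules pb_rules p b p[THEN pt_comp] b[THEN pb_ptcomp])+

lemma pb_shingle_bits: assumes "polytime e eN F" "polytime e eN c" "poly_bounded e c" shows "poly_bounded e (\<lambda>x. shingle_bits (F x) (c x))"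
  by (rule pb_mono[OF pt_size[OF pt_power[OF assms]]]) (simp add: shingle_bits_def)

lemma pb_num_layers: "poly_bounded e al \<Longrightarrow> poly_bounded e (\<lambda>x. num_layers (al x) (d x))"
  unfolding num_layers_def by (rule pb_rules | assumption)+

lemma pt_sk_nums:
  assumes p: "polytime e eN F" "polytime e eN n" "polytime e eN c" "polytime e eN t" "polytime e eN d0" "polytime e eN d" "polytime e (eL eN) ws" "polytime e eN a"
    and b: "poly_bounded e n" "poly_bounded e c" "poly_bounded e d0" "poly_bounded e d" "poly_bounded e (\<lambda>x. 2 ^ d0 x)" "poly_bounded e (\<lambda>x. 2 ^ d x)"
  shows "polytime e (eL eN) (\<lambda>x. sk_nums (F x) (n x) (c x) (t x) (d0 x) (d x) (ws x) (a x))"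
  unfolding sk_nums_def
  by (rule pt_sk_main pt_gfmod pt_num_layers pt_shingle_bits pb_shingle_bits pb_num_layers pt_rules pb_rules p b p[THEN pt_comp] b[THEN pb_ptcomp])+

lemma pt_num_width:
  assumes p: "polytime e eN F" "polytime e eN n" "polytime e eN d0"
  shows "polytime e eN (\<lambda>x. num_width (F x) (n x) (d0 x))"
  unfolding num_width_def
  by (rule pt_rules pb_rules p p[THEN pt_comp])+

lemma pb_num_width: assumes "polytime e eN F" "poly_bounded e n" "poly_bounded e d0" shows "poly_bounded e (\<lambda>x. num_width (F x) (n x) (d0 x))"
  by (rule pb_mono[OF pb_add[OF pb_add[OF pt_size[OF assms(1)] assms(2)] assms(3)]]) (simp add: num_width_def)

lemma pt_to_bits:
  assumes p: "polytime e eN W" "polytime e (eL eN) xs" and b: "poly_bounded e W" shows "polytime e (eL eB) (\<lambda>x. to_bits (W x) (xs x))"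
  unfolding to_bits_def
  by (rule pt_map_upt pt_map pt_digit pt_rules pb_rules p b p[THEN pt_comp] b[THEN pb_ptcomp])+

lemma pt_get_num:
  assumes p: "polytime e eN W" "polytime e (eL eB) s" "polytime e eN i"
    and b: "poly_bounded e W"
  shows "polytime e eN (\<lambda>x. get_num (W x) (s x) (i x))"
  unfolding get_num_def
  by (rule pt_undigits pt_rules pb_rules p b p[THEN pt_comp] b[THEN pb_ptcomp])+

lemma pt_sketch:
  assumes p: "polytime e eN F" "polytime e eN n" "polytime e eN c" "polytime e eN t" "polytime e eN d0" "polytime e eN d" "polytime e (eL eN) ws" "polytime e eN a"
    and b: "poly_bounded e n" "poly_bounded e c" "poly_bounded e d0" "poly_bounded e d" "poly_bounded e (\<lambda>x. 2 ^ d0 x)" "poly_bounded e (\<lambda>x. 2 ^ d x)"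
  shows "polytime e (eL eB) (\<lambda>x. sketch (F x) (n x) (c x) (t x) (d0 x) (d x) (ws x) (a x))"
  unfolding sketch_def
  by (rule pt_to_bits pt_num_width pb_num_width pt_sk_nums pt_rules pb_rules p b p[THEN pt_comp] b[THEN pb_ptcomp])+

lemma pt_odd_diff_sum:
  assumes p: "polytime e eN d0" "polytime e eN f0" "polytime e eN W" "polytime e eN k" "polytime e (eL eB) s" "polytime e (eL eN) G" "polytime e eN j"
    and b: "poly_bounded e d0" "poly_bounded e W" "poly_bounded e j"
  shows "polytime e eN (\<lambda>x. odd_diff_sum (d0 x) (f0 x) (W x) (k x) (s x) (G x) (j x))"
  unfolding odd_diff_sum_def
  by (rule pt_fadd pt_get_num pt_power_sum pt_rules pb_rules p b p[THEN pt_comp] b[THEN pb_ptcomp])+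

lemma pt_odd_part:
  assumes p: "polytime e eN j"
    and b: "poly_bounded e j"
  shows "polytime e eN (\<lambda>x. odd_part (j x))"
  unfolding odd_part_def
  by (rule pt_rules pb_rules p b p[THEN pt_comp] b[THEN pb_ptcomp])+

lemma odd_part_le: "odd_part j \<le> j"
  unfolding odd_part_def hd_or_def by (auto split: list.split dest!: filter_eq_ConsD)

lemma pb_odd_part: "poly_bounded e j \<Longrightarrow> poly_bounded e (\<lambda>x. odd_part (j x))"
  by (erule pb_mono) (rule odd_part_le)

lemma pt_diff_sum:
  assumes p: "polytime e eN d0" "polytime e eN f0" "polytime e eN W" "polytime e eN k" "polytime e (eL eB) s" "polytime e (eL eN) G" "polytime e eN j"
    and b: "poly_bounded e d0" "poly_bounded e W" "poly_bounded e j"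
  shows "polytime e eN (\<lambda>x. diff_sum (d0 x) (f0 x) (W x) (k x) (s x) (G x) (j x))"
  unfolding diff_sum_def
  by (rule pt_odd_diff_sum pt_fpow pt_odd_part pb_odd_part pt_rules pb_rules p b p[THEN pt_comp] b[THEN pb_ptcomp])+

lemma pt_hash_diff:
  assumes p: "polytime e eN d0" "polytime e eN f0" "polytime e eN dl" "polytime e eN W" "polytime e eN k" "polytime e (eL eB) s" "polytime e (eL eN) G"
    and b: "poly_bounded e d0" "poly_bounded e dl" "poly_bounded e W" "poly_bounded e (\<lambda>x. 2 ^ d0 x)"
  shows "polytime e (eL eN) (\<lambda>x. hash_diff (d0 x) (f0 x) (dl x) (W x) (k x) (s x) (G x))"
  unfolding hash_diff_def
  by (rule pt_decode pt_upt pt_diff_sum pt_rules pb_rules p b p[THEN pt_comp] b[THEN pb_ptcomp])+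

lemma pt_fix_hashes:
  assumes p: "polytime e eN d0" "polytime e (eL eN) es" "polytime e (eL eN) G"
    and b: "poly_bounded e d0" "poly_bounded e (\<lambda>x. 2 ^ d0 x)"
  shows "polytime e (eL eN) (\<lambda>x. fix_hashes (d0 x) (es x) (G x))"
  unfolding fix_hashes_def
  by (rule pt_rules pb_rules p b p[THEN pt_comp] b[THEN pb_ptcomp])+

lemma pt_candidates:
  assumes p: "polytime e eN d0" "polytime e eN f0" "polytime e eN d" "polytime e eN L" "polytime e eN a" "polytime e (eL eN) xs" "polytime e eN v"
    and b: "poly_bounded e d0" "poly_bounded e d" "poly_bounded e L"
  shows "polytime e (eL eN) (\<lambda>x. candidates (d0 x) (f0 x) (d x) (L x) (a x) (xs x) (v x))"
  unfolding candidates_def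
  by (rule pt_hash_val pt_filter pt_rules pb_rules p b p[THEN pt_comp] b[THEN pb_ptcomp])+

lemma pt_single:
  assumes p: "polytime e (eL eN) C"
  shows "polytime e eB (\<lambda>x. single (C x))"
  unfolding single_def
  by (rule pt_rules pb_rules p p[THEN pt_comp])+

lemma pt_guess:
  assumes p: "polytime e eN d0" "polytime e eN f0" "polytime e eN d" "polytime e eN L" "polytime e eN a" "polytime e (eL eN) xs" "polytime e (eL eN) G"
    and b: "poly_bounded e d0" "poly_bounded e d" "poly_bounded e L"
  shows "polytime e (eL eN) (\<lambda>x. guess (d0 x) (f0 x) (d x) (L x) (a x) (xs x) (G x))"
  unfolding guess_def
  by (rule pt_map pt_single pt_candidates pt_rules pb_rules p b p[THEN pt_comp] b[THEN pb_ptcomp])+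

lemma pt_erasures:
  assumes p: "polytime e eN d0" "polytime e eN f0" "polytime e eN d" "polytime e eN L" "polytime e eN a" "polytime e (eL eN) xs" "polytime e (eL eN) G"
    and b: "poly_bounded e d0" "poly_bounded e d" "poly_bounded e L"
  shows "polytime e (eL eN) (\<lambda>x. erasures (d0 x) (f0 x) (d x) (L x) (a x) (xs x) (G x))"
  unfolding erasures_def
  by (rule pt_single pt_candidates pt_rules pb_rules p b p[THEN pt_comp] b[THEN pb_ptcomp])+

lemma pt_layer_errors:
  assumes p: "polytime e eN d" "polytime e eN f" "polytime e eN d0" "polytime e eN dl" "polytime e eN W" "polytime e eN k" "polytime e (eL eB) s" "polytime e (eL eN) ys" "polytime e (eL eN) E" "polytime e eN i"
    and b: "poly_bounded e d" "poly_bounded e d0" "poly_bounded e dl" "poly_bounded e W" "poly_bounded e i" "poly_bounded e (\<lambda>x. 2 ^ d x)"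
  shows "polytime e (eL eN) (\<lambda>x. layer_errors (d x) (f x) (d0 x) (dl x) (W x) (k x) (s x) (ys x) (E x) (i x))"
  unfolding layer_errors_def
  by (rule pt_decode pt_upt pt_fadd pt_get_num pt_rs_syndrome pt_rules pb_rules p b p[THEN pt_comp] b[THEN pb_ptcomp])+

lemma pt_fix_layers:
  assumes p: "polytime e eN d" "polytime e eN f" "polytime e eN d0" "polytime e eN dl" "polytime e eN L" "polytime e eN W" "polytime e eN k" "polytime e (eL eB) s" "polytime e (eL eN) ys" "polytime e (eL eN) E"
    and b: "poly_bounded e d" "poly_bounded e d0" "poly_bounded e dl" "poly_bounded e L" "poly_bounded e W" "poly_bounded e (\<lambda>x. 2 ^ d x)"
  shows "polytime e (eL (eL eN)) (\<lambda>x. fix_layers (d x) (f x) (d0 x) (dl x) (L x) (W x) (k x) (s x) (ys x) (E x))"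
  unfolding fix_layers_def
  by (rule pt_layer_errors pt_fadd pt_layer pt_rules pb_rules p b p[THEN pt_comp] b[THEN pb_ptcomp])+

lemma pt_join_shingle:
  assumes p: "polytime e eN d0" "polytime e eN f0" "polytime e eN d" "polytime e eN L" "polytime e eN a" "polytime e (eL eN) G" "polytime e (eL (eL eN)) Z" "polytime e eN r"
    and b: "poly_bounded e d0" "poly_bounded e d" "poly_bounded e L"
  shows "polytime e eN (\<lambda>x. join_shingle (d0 x) (f0 x) (d x) (L x) (a x) (G x) (Z x) (r x))"
  unfolding join_shingle_def
  by (rule pt_fadd pt_hash_mix pt_rules pb_rules p b p[THEN pt_comp] b[THEN pb_ptcomp])+

lemma pt_output_string:
  assumes p: "polytime e eN F" "polytime e eN n" "polytime e eN c" "polytime e eN d0" "polytime e eN f0" "polytime e eN d" "polytime e eN L" "polytime e eN a" "polytime e eN W" "polytime e (eL eB) s" "polytime e (eL eN) G" "polytime e (eL (eL eN)) Z"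
    and b: "poly_bounded e n" "poly_bounded e d0" "poly_bounded e d" "poly_bounded e L" "poly_bounded e W"
  shows "polytime e (eL eN) (\<lambda>x. output_string (F x) (n x) (c x) (d0 x) (f0 x) (d x) (L x) (a x) (W x) (s x) (G x) (Z x))"
  unfolding output_string_def
  by (rule pt_digit pt_join_shingle pt_get_num pt_block_pos pt_rules pb_rules p b p[THEN pt_comp] b[THEN pb_ptcomp])+

lemma pt_rc3:
  assumes p: "polytime e eN F" "polytime e eN n" "polytime e eN c" "polytime e eN dl" "polytime e eN d0" "polytime e eN f0" "polytime e eN d" "polytime e eN f" "polytime e eN L" "polytime e eN W" "polytime e (eL eB) s" "polytime e eN a" "polytime e (eL eN) xs" "polytime e (eL eN) G"
    and b: "poly_bounded e n" "poly_bounded e c" "poly_bounded e dl" "poly_bounded e d0" "poly_bounded e d" "poly_bounded e L" "poly_bounded e W" "poly_bounded e (\<lambda>x. 2 ^ d x)"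
  shows "polytime e (eL eN) (\<lambda>x. rc3 (F x) (n x) (c x) (dl x) (d0 x) (f0 x) (d x) (f x) (L x) (W x) (s x) (a x) (xs x) (G x))"
  unfolding rc3_def
  by (rule pt_output_string pt_fix_layers pt_num_blocks pt_guess pt_erasures pt_rules pb_rules p b p[THEN pt_comp] b[THEN pb_ptcomp])+

lemma pt_rc2:
  assumes p: "polytime e eN F" "polytime e eN n" "polytime e eN c" "polytime e eN dl" "polytime e eN d0" "polytime e eN f0" "polytime e eN d" "polytime e eN f" "polytime e eN L" "polytime e eN W" "polytime e (eL eB) s" "polytime e eN a" "polytime e (eL eN) xs" "polytime e (eL eN) G"
    and b: "poly_bounded e n" "poly_bounded e c" "poly_bounded e dl" "poly_bounded e d0" "poly_bounded e d" "poly_bounded e L" "poly_bounded e W" "poly_bounded e (\<lambda>x. 2 ^ d0 x)" "poly_bounded e (\<lambda>x. 2 ^ d x)"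
  shows "polytime e (eL eN) (\<lambda>x. rc2 (F x) (n x) (c x) (dl x) (d0 x) (f0 x) (d x) (f x) (L x) (W x) (s x) (a x) (xs x) (G x))"
  unfolding rc2_def
  by (rule pt_rc3 pt_fix_hashes pt_hash_diff pt_num_blocks pt_rules pb_rules p b p[THEN pt_comp] b[THEN pb_ptcomp])+

lemma pt_rc1:
  assumes p: "polytime e eN F" "polytime e eN n" "polytime e eN c" "polytime e eN dl" "polytime e eN d0" "polytime e eN f0" "polytime e eN d" "polytime e eN f" "polytime e eN L" "polytime e eN W" "polytime e (eL eB) s" "polytime e eN a" "polytime e (eL eN) xs"
    and b: "poly_bounded e n" "poly_bounded e c" "poly_bounded e dl" "poly_bounded e d0" "poly_bounded e d" "poly_bounded e L" "poly_bounded e W" "poly_bounded e (\<lambda>x. 2 ^ d0 x)" "poly_bounded e (\<lambda>x. 2 ^ d x)"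
  shows "polytime e (eL eN) (\<lambda>x. rc1 (F x) (n x) (c x) (dl x) (d0 x) (f0 x) (d x) (f x) (L x) (W x) (s x) (a x) (xs x))"
  unfolding rc1_def
  by (rule pt_rc2 pt_hash_set pt_rules pb_rules p b p[THEN pt_comp] b[THEN pb_ptcomp])+

lemma pt_recover:
  assumes p: "polytime e eN F" "polytime e eN n" "polytime e eN c" "polytime e eN t" "polytime e eN d0" "polytime e eN d" "polytime e (eL eN) ws" "polytime e (eL eB) s"
    and b: "poly_bounded e n" "poly_bounded e c" "poly_bounded e d0" "poly_bounded e d" "poly_bounded e (\<lambda>x. 2 ^ d0 x)" "poly_bounded e (\<lambda>x. 2 ^ d x)"
  shows "polytime e (eL eN) (\<lambda>x. recover (F x) (n x) (c x) (t x) (d0 x) (d x) (ws x) (s x))"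
  unfolding recover_def
  by (rule pt_rc1 pt_num_width pb_num_width pt_get_num pt_gfmod pt_num_layers pt_shingle_bits pb_shingle_bits pb_num_layers pt_shingle_nums pt_rules pb_rules p b p[THEN pt_comp] b[THEN pb_ptcomp])+

lemma pt_recover_mod:
  assumes p: "polytime e eN F" "polytime e eN n" "polytime e eN c" "polytime e eN t" "polytime e eN d0" "polytime e eN d" "polytime e (eL eN) ws" "polytime e (eL eB) s"
    and b: "poly_bounded e n" "poly_bounded e c" "poly_bounded e d0" "poly_bounded e d" "poly_bounded e (\<lambda>x. 2 ^ d0 x)" "poly_bounded e (\<lambda>x. 2 ^ d x)"
  shows "polytime e (eL eN) (\<lambda>x. recover_mod (F x) (n x) (c x) (t x) (d0 x) (d x) (ws x) (s x))"
  unfolding recover_mod_def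
  by (rule pt_recover pt_map pt_rules pb_rules p b p[THEN pt_comp] b[THEN pb_ptcomp])+

section \<open>Correctness of recovery\<close>

definition sdiff :: "'b set \<Rightarrow> 'b set \<Rightarrow> 'b set" where "sdiff A B = (A - B) \<union> (B - A)"

definition shingle_set :: "nat \<Rightarrow> 'a list \<Rightarrow> 'a list set" where
  "shingle_set c w = {take c (drop i w) |i. i + c \<le> length w}"

lemma finite_shingle_set: "finite (shingle_set c w)"
proof -
  have "shingle_set c w \<subseteq> (\<lambda>i. take c (drop i w)) ` {..length w}" unfolding shingle_set_def by auto
  then show ?thesis by (rule finite_subset) simp
qed

lemma sdiff_commute: "sdiff A B = sdiff B A" by (auto simp: sdiff_def)

lemma shingle_set_insertion:
  assumes "1 \<le> c" shows "card (sdiff (shingle_set c (u @ v)) (shingle_set c (u @ a # v))) \<le> 2 * c - 1"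
proof -
  let ?w = "u @ v" and ?w' = "u @ a # v" and ?l = "length u"
  \<comment> \<open>Only windows that contain the inserted character can be new; there are at most
    \<open>c\<close> of them.\<close>
  have "shingle_set c ?w' - shingle_set c ?w \<subseteq> (\<lambda>i. take c (drop i ?w')) ` {?l + 1 - c..?l}"
  proof
    fix x assume x: "x \<in> shingle_set c ?w' - shingle_set c ?w"
    then obtain i where i: "x = take c (drop i ?w')" "i + c \<le> length ?w'" unfolding shingle_set_def by blast
    have "\<not> i + c \<le> ?l"
    proof
      assume "i + c \<le> ?l"
      then have "x = take c (drop i ?w)" "i + c \<le> length ?w" using i by auto
      then show False using x unfolding shingle_set_def by blast
    qed
    moreover have "\<not> ?l < i"
    proof
      assume "?l < i"
      then obtain h where "i = ?l + 1 + h" using less_iff_Suc_add[of ?l i] by auto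
      then have "drop i ?w' = drop (i - 1) ?w" by simp
      moreover have "i - 1 + c \<le> length ?w" using i(2) \<open>?l < i\<close> by simp
      ultimately have "x = take c (drop (i - 1) ?w) \<and> i - 1 + c \<le> length ?w" using i(1) by simp
      then have "x \<in> shingle_set c ?w" unfolding shingle_set_def by blast
      then show False using x by blast
    qed
    ultimately have "i \<in> {?l + 1 - c..?l}" by auto
    then show "x \<in> (\<lambda>i. take c (drop i ?w')) ` {?l + 1 - c..?l}" unfolding i(1) by (rule imageI)
  qed
  then have "card (shingle_set c ?w' - shingle_set c ?w) \<le> card {?l + 1 - c..?l}" by (rule surj_card_le[rotated]) simp
  then have 1: "card (shingle_set c ?w' - shingle_set c ?w) \<le> c" using assms by simp
  \<comment> \<open>Only windows that straddle the point of insertion can be lost; there are at most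
    \<open>c - 1\<close> of them.\<close>
  have "shingle_set c ?w - shingle_set c ?w' \<subseteq> (\<lambda>i. take c (drop i ?w)) ` {?l + 1 - c..<?l}"
  proof
    fix x assume x: "x \<in> shingle_set c ?w - shingle_set c ?w'"
    then obtain i where i: "x = take c (drop i ?w)" "i + c \<le> length ?w" unfolding shingle_set_def by blast
    have "\<not> i + c \<le> ?l"
    proof
      assume "i + c \<le> ?l"
      then have "x = take c (drop i ?w')" "i + c \<le> length ?w'" using i by auto
      then show False using x unfolding shingle_set_def by blast
    qed
    moreover have "\<not> ?l \<le> i"
    proof
      assume "?l \<le> i"
      then have "drop i ?w = drop (i + 1) ?w'" by (simp add: Suc_diff_le)
      moreover have "i + 1 + c \<le> length ?w'" using i(2) by simp
      ultimately have "x = take c (drop (i + 1) ?w') \<and> i + 1 + c \<le> length ?w'" using i(1) by simp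
      then have "x \<in> shingle_set c ?w'" unfolding shingle_set_def by blast
      then show False using x by blast
    qed
    ultimately have "i \<in> {?l + 1 - c..<?l}" by auto
    then show "x \<in> (\<lambda>i. take c (drop i ?w)) ` {?l + 1 - c..<?l}" unfolding i(1) by (rule imageI)
  qed
  then have "card (shingle_set c ?w - shingle_set c ?w') \<le> card {?l + 1 - c..<?l}" by (rule surj_card_le[rotated]) simp
  then have 2: "card (shingle_set c ?w - shingle_set c ?w') \<le> c - 1" using assms by simp
  show ?thesis unfolding sdiff_def
    using card_Un_le[of "shingle_set c ?w - shingle_set c ?w'" "shingle_set c ?w' - shingle_set c ?w"] 1 2 assms by linarith
qed

lemma shingle_set_edit_steps:
  assumes "1 \<le> c" "(edit_step A ^^ k) w w'"
  shows "card (sdiff (shingle_set c w) (shingle_set c w')) \<le> (2 * c - 1) * k"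
  using assms(2)
proof (induction k arbitrary: w')
  case 0
  then show ?case by (simp add: sdiff_def)
next
  case (Suc k)
  then obtain y where y: "(edit_step A ^^ k) w y" "edit_step A y w'" by auto
  have 1: "card (sdiff (shingle_set c y) (shingle_set c w')) \<le> 2 * c - 1"
    using y(2)
  proof cases
    case (insertion a u v)
    then show ?thesis using shingle_set_insertion[OF assms(1)] by simp
  next
    case (deletion u a v)
    then show ?thesis using shingle_set_insertion[OF assms(1), of u v a] by (simp add: sdiff_commute)
  qed
  have "sdiff (shingle_set c w) (shingle_set c w') \<subseteq> sdiff (shingle_set c w) (shingle_set c y) \<union> sdiff (shingle_set c y) (shingle_set c w')"
    by (auto simp: sdiff_def)
  then have "card (sdiff (shingle_set c w) (shingle_set c w')) \<le> card (sdiff (shingle_set c w) (shingle_set c y) \<union> sdiff (shingle_set c y) (shingle_set c w'))"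
    by (intro card_mono) (auto simp: sdiff_def finite_shingle_set)
  also have "\<dots> \<le> card (sdiff (shingle_set c w) (shingle_set c y)) + card (sdiff (shingle_set c y) (shingle_set c w'))" by (rule card_Un_le)
  finally show ?case unfolding mult_Suc_right using Suc.IH[OF y(1)] 1 by linarith
qed

text \<open>The minimum is attained because some path exists: delete all of \<open>w\<close>, then
  build up \<open>w'\<close>. Paths may pass through strings of any length, which the bound for
  shingles allows.\<close>

lemma edit_path:
  assumes "set w' \<subseteq> A" shows "(edit_step A ^^ edit_dist A w w') w w'"
proof -
  have "\<exists>k. (edit_step A ^^ k) w []"
  proof (induction w)
    case (Cons a w)
    then obtain k where "(edit_step A ^^ k) w []" by blast
    moreover have "edit_step A (a # w) w" using edit_step.deletion[of A "[]" a w] by simp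
    ultimately have "(edit_step A ^^ Suc k) (a # w) []" by (rule relpowp_Suc_I2[rotated])
    then show ?case by blast
  qed (auto intro: exI[of _ 0])
  moreover have "\<exists>k. (edit_step A ^^ k) [] w'"
    using assms
  proof (induction w' rule: rev_induct)
    case (snoc a w)
    then obtain k where "(edit_step A ^^ k) [] w" by auto
    moreover have "edit_step A w (w @ [a])" using edit_step.insertion[of a A w "[]"] snoc.prems by simp
    ultimately have "(edit_step A ^^ Suc k) [] (w @ [a])" by (rule relpowp_Suc_I)
    then show ?case by blast
  qed (auto intro: exI[of _ 0])
  ultimately have "\<exists>k. (edit_step A ^^ k) w w'" by (metis relpowp_trans)
  then show ?thesis unfolding edit_dist_def by (rule LeastI_ex)
qed

lemma card_sdiff_image: "finite A \<Longrightarrow> finite B \<Longrightarrow> card (sdiff (g ` A) (g ` B)) \<le> card (sdiff A B)"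
  by (rule order_trans[OF card_mono[of "g ` sdiff A B"] card_image_le]) (auto simp: sdiff_def)

lemma concat_nth:
  assumes "\<And>x. x \<in> set xs \<Longrightarrow> length (g x) = W" "i < length xs" "j < W"
  shows "i * W + j < length (concat (map g xs))" "concat (map g xs) ! (i * W + j) = g (xs ! i) ! j"
proof -
  have "i * W + j < length (concat (map g xs)) \<and> concat (map g xs) ! (i * W + j) = g (xs ! i) ! j"
    using assms
  proof (induction xs arbitrary: i)
    case (Cons x xs)
    then show ?case by (cases i) (auto simp: nth_append add.assoc)
  qed simp
  then show "i * W + j < length (concat (map g xs))" "concat (map g xs) ! (i * W + j) = g (xs ! i) ! j" by auto
qed

lemma get_num_to_bits:
  assumes "i < length xs" "xs ! i < 2 ^ W" shows "get_num W (to_bits W xs) i = xs ! i"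
proof -
  have "of_bool (nth_or False (to_bits W xs) (i * W + j)) = digit 2 (xs ! i) j" if "j < W" for j
  proof -
    have *: "i * W + j < length (to_bits W xs)" "to_bits W xs ! (i * W + j) = (digit 2 (xs ! i) j = 1)"
      using concat_nth[of xs "\<lambda>x. map (\<lambda>j. digit 2 x j = 1) [0..<W]" W i j] that assms(1)
      unfolding to_bits_def by auto
    then show ?thesis using dig2_cases[of "xs ! i" j] by auto
  qed
  then have "get_num W (to_bits W xs) i = undigits 2 W (digit 2 (xs ! i))"
    unfolding get_num_def undigits_def by (intro sum.cong) auto
  then show ?thesis using undigits_digit[OF assms(2)] by simp
qed

lemma odd_part: assumes "0 < j" shows "odd_part j mod 2 = 1" "\<exists>k. odd_part j * 2 ^ k = j"
proof -
  have "\<exists>m k. m mod 2 = 1 \<and> m * 2 ^ k = j"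
    using assms
  proof (induction j rule: less_induct)
    case (less j)
    show ?case
    proof (cases "even j")
      case True
      then obtain i where i: "j = 2 * i" by auto
      then obtain m k where "m mod 2 = 1" "m * 2 ^ k = i" using less.IH[of i] less.prems by auto
      then have "m * 2 ^ Suc k = j" using i by simp
      then show ?thesis using \<open>m mod 2 = 1\<close> by blast
    next
      case False
      then have "j mod 2 = 1 \<and> j * 2 ^ 0 = j" by (simp add: odd_iff_mod_2_eq_one)
      then show ?thesis by blast
    qed
  qed
  then obtain m k where mk: "m mod 2 = 1" "m * 2 ^ k = j" by blast
  have m0: "0 < m" using mk by (cases m) auto
  have "m \<le> j" using mk(2) by auto
  moreover have "k < j + 1"
  proof -
    have "k < 2 ^ k" by (rule less_exp)
    also have "\<dots> \<le> j" using mk(2) m0 by (metis Suc_leI mult.left_neutral mult_le_mono1 One_nat_def)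
    finally show ?thesis by simp
  qed
  ultimately have P: "m \<in> set [0..<j + 1]" "m mod 2 = 1 \<and> (\<exists>k<j + 1. m * 2 ^ k = j)"
    using mk by (simp_all only: set_upt atLeastLessThan_iff) (simp, blast)
  have "odd_part j mod 2 = 1 \<and> (\<exists>k<j + 1. odd_part j * 2 ^ k = j)"
    unfolding odd_part_def by (rule hd_or_filter[where P = "\<lambda>m. m mod 2 = 1 \<and> (\<exists>k<j + 1. m * 2 ^ k = j)", OF P, THEN conjunct1])
  then show "odd_part j mod 2 = 1" "\<exists>k. odd_part j * 2 ^ k = j" by auto
qed

lemma rank_nth:
  assumes "sorted G" "distinct G" "r < length G"
  shows "length (filter (\<lambda>u. u < G ! r) G) = r"
proof -
  have "{u \<in> set G. u < G ! r} = (!) G ` {..<r}"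
  proof
    show "{u \<in> set G. u < G ! r} \<subseteq> (!) G ` {..<r}"
    proof
      fix u assume "u \<in> {u \<in> set G. u < G ! r}"
      then obtain i where "i < length G" "G ! i = u" "G ! i < G ! r" by (auto simp: in_set_conv_nth)
      moreover from this have "i < r" using assms(1) by (meson leD not_less sorted_nth_mono)
      ultimately show "u \<in> (!) G ` {..<r}" by auto
    qed
    show "(!) G ` {..<r} \<subseteq> {u \<in> set G. u < G ! r}"
      using assms by (auto simp: order_less_le sorted_nth_mono nth_eq_iff_index_eq)
  qed
  moreover have "inj_on ((!) G) {..<r}" using assms by (auto simp: inj_on_def nth_eq_iff_index_eq)
  ultimately have "card {u \<in> set G. u < G ! r} = r" by (simp add: card_image)
  moreover have "card (set (filter (\<lambda>u. u < G ! r) G)) = length (filter (\<lambda>u. u < G ! r) G)"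
    using assms(2) by (intro distinct_card) simp
  ultimately show ?thesis by simp
qed

lemma (in gf) frob_sum: "finite A \<Longrightarrow> (\<Sum>v\<in>A. (g v :: 'k)) ^ (2 ^ k) = (\<Sum>v\<in>A. g v ^ (2 ^ k))"
  by (induction A rule: finite_induct) (simp_all add: char2_frob[OF c2] power_0_left)

text \<open>In characteristic 2 the common elements cancel, so the sum of two power sums depends on
  the symmetric difference only.\<close>

lemma (in gf) sum_sdiff: "finite A \<Longrightarrow> finite B \<Longrightarrow> (\<Sum>v\<in>A. (g v :: 'k)) + (\<Sum>v\<in>B. g v) = (\<Sum>v\<in>sdiff A B. g v)"
proof -
  assume fin: "finite A" "finite B"
  have "sum g A = sum g (A - B) + sum g (A \<inter> B)" "sum g B = sum g (B - A) + sum g (A \<inter> B)"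
    using fin sum.Int_Diff[of A g B] sum.Int_Diff[of B g A] by (simp_all add: Int_commute add.commute)
  moreover have "sum g (sdiff A B) = sum g (A - B) + sum g (B - A)"
    unfolding sdiff_def using fin by (intro sum.union_disjoint) auto
  moreover have "sum g (A \<inter> B) + sum g (A \<inter> B) = 0" by (rule char2_add_self[OF c2])
  ultimately show ?thesis by (simp add: algebra_simps)
qed

lemma (in gf) fadd_cancel: assumes "u < 2 ^ d" shows "fadd d (fadd d u v) v = u"
proof -
  have "\<phi> (fadd d (fadd d u v) v) = \<phi> u" using char2_add_self[OF c2, of "\<phi> v"] by (simp add: \<phi>add add.assoc)
  then show ?thesis using inj_onD[OF inj] fadd_less assms by auto
qed

lemma (in gf) fadd_self: "fadd d u u = 0"
proof -
  have "\<phi> (fadd d u u) = 0" using char2_add_self[OF c2] by (simp add: \<phi>add)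
  then show ?thesis using \<phi>_eq_0[OF fadd_less] by simp
qed

lemma (in gf) \<phi>_power_sum: assumes "distinct G" shows "\<phi> (power_sum d f G j) = (\<Sum>v\<in>set G. \<phi> v ^ j)"
  unfolding power_sum_def \<phi>_fsum by (simp add: o_def \<phi>_fpow sum_list_distinct_conv_sum_set[OF assms])

lemma (in gf) \<phi>_rs_syndrome: "\<phi> (rs_syndrome d f d0 ys i j) = (\<Sum>r<length ys. \<phi> (layer d d0 (ys ! r) i) * \<phi> r ^ j)"
  unfolding rs_syndrome_def \<phi>_fsum_upt by (intro sum.cong) (auto simp: \<phi>mul \<phi>_fpow)

lemma hash_set_props: "sorted (hash_set d0 f0 d L a xs)" "distinct (hash_set d0 f0 d L a xs)"
  "set (hash_set d0 f0 d L a xs) = hash_val d0 f0 d L a ` set xs - {0}"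
  unfolding hash_set_def using fadd_less by (auto simp: hash_val_def intro: sorted_wrt_filter)

lemma gf_ex: assumes "0 < d" shows "\<exists>\<phi>. gf d (gfmod d) (\<phi> :: nat \<Rightarrow> bit alg_closure)"
proof -
  have "to_ac (1 + 1 :: bit) = 1 + 1" by (simp only: to_ac_add to_ac_1)
  then have c2: "1 + 1 = (0 :: bit alg_closure)" by simp
  show ?thesis by (rule is_gf_modulus_imp_gf[OF c2 assms gfmod(1)[OF assms]])
qed

text \<open>The hash of the symmetric difference of the shingle sets is found first.\<close>

lemma fix_hashes_correct:
  assumes "0 < d0" and G: "G = hash_set d0 (gfmod d0) d L a xs" "\<forall>u\<in>set xs. hash_val d0 (gfmod d0) d L a u \<noteq> 0"
    and G': "G' = hash_set d0 (gfmod d0) d L a xs'" and card: "card (sdiff (set xs) (set xs')) \<le> dl"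
    and s: "\<And>i. i < dl \<Longrightarrow> get_num W s (k + i) = power_sum d0 (gfmod d0) G (2 * i + 1)"
  shows "fix_hashes d0 (hash_diff d0 (gfmod d0) dl W k s G') G' = G"
proof -
  define f0 where "f0 = gfmod d0"
  obtain \<phi> :: "nat \<Rightarrow> bit alg_closure" where "gf d0 f0 \<phi>" using gf_ex[OF assms(1)] f0_def by blast
  then interpret gf d0 f0 \<phi> .
  let ?h = "hash_val d0 f0 d L a"
  have setG: "set G = ?h ` set xs - {0}" "set G' = ?h ` set xs' - {0}" unfolding G G' f0_def by (rule hash_set_props(3))+
  have dG: "distinct G" "distinct G'" unfolding G G' by (rule hash_set_props(2))+
  define D where "D = sdiff (set G) (set G')"
  \<comment> \<open>The hash function need not be injective on the shingles of the close string;
    collisions cannot enlarge the symmetric difference.\<close>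
  have "D \<subseteq> ?h ` sdiff (set xs) (set xs')" unfolding D_def setG sdiff_def by auto
  then have cD: "card D \<le> dl" using card surj_card_le[of "sdiff (set xs) (set xs')" D ?h] by (simp add: sdiff_def)
  have finD: "finite D" unfolding D_def sdiff_def by simp
  have hl: "?h u < 2 ^ d0" for u unfolding hash_val_def by (rule fadd_less)
  have Dl: "v < 2 ^ d0" if "v \<in> D" for v using that hl unfolding D_def sdiff_def setG by auto
  have D0: "0 \<notin> D" unfolding D_def sdiff_def setG by auto
  have syn: "\<phi> (diff_sum d0 f0 W k s G' j) = (\<Sum>v\<in>D. \<phi> v ^ j)" if j: "0 < j" "j \<le> 2 * dl" for j
  proof -
    define m where "m = odd_part j"
    obtain e where e: "m * 2 ^ e = j" using odd_part(2)[OF j(1)] unfolding m_def by blast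
    have m: "m mod 2 = 1" "m \<le> j" unfolding m_def using odd_part(1)[OF j(1)] odd_part_le by auto
    then have "m div 2 < dl" "2 * (m div 2) + 1 = m" using j(2) by presburger+
    \<comment> \<open>The exponent \<open>m = 2 * i + 1\<close> is stored at offset
      \<open>i = m div 2\<close>.\<close>
    then have "get_num W s (k + m div 2) = power_sum d0 f0 G m" using s[of "m div 2"] unfolding f0_def by simp
    then have "\<phi> (odd_diff_sum d0 f0 W k s G' m) = (\<Sum>v\<in>D. \<phi> v ^ m)"
      unfolding odd_diff_sum_def \<phi>add by (simp add: \<phi>_power_sum[OF dG(1)] \<phi>_power_sum[OF dG(2)] sum_sdiff D_def)
    moreover have "0 < m" using m(1) by (cases m) auto
    then have "j div m = 2 ^ e" using e by auto
    ultimately have "\<phi> (diff_sum d0 f0 W k s G' j) = (\<Sum>v\<in>D. \<phi> v ^ m) ^ (2 ^ e)"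
      unfolding diff_sum_def m_def[symmetric] \<phi>_fpow by simp
    also have "\<dots> = (\<Sum>v\<in>D. \<phi> v ^ j)" unfolding frob_sum[OF finD] power_mult[symmetric] e ..
    finally show ?thesis .
  qed
  define err where "err v = (if v \<in> D then v else 0)" for v
  have "hash_diff d0 f0 dl W k s G' = map err [0..<2 ^ d0]"
    unfolding hash_diff_def
  proof (rule decode_correct)
    fix j assume j: "j < 2 * dl"
    have "\<phi> (nth_or 0 (map (\<lambda>i. diff_sum d0 f0 W k s G' (i + 1)) [0..<2 * dl]) j) = (\<Sum>v\<in>D. \<phi> v ^ (j + 1))"
      using j syn[of "j + 1"] by simp
    also have "\<dots> = (\<Sum>v\<in>set [0..<2 ^ d0]. \<phi> (err v) * \<phi> v ^ j)"
      using Dl \<phi>0 by (intro sum.mono_neutral_cong_left) (auto simp: err_def)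
    finally show "\<phi> (nth_or 0 (map (\<lambda>i. diff_sum d0 f0 W k s G' (i + 1)) [0..<2 * dl]) j) = (\<Sum>v\<in>set [0..<2 ^ d0]. \<phi> (err v) * \<phi> v ^ j)" .
  next
    have "{v \<in> set [0..<2 ^ d0] - set []. err v \<noteq> 0} \<subseteq> D" by (auto simp: err_def split: if_splits)
    then have "card {v \<in> set [0..<2 ^ d0] - set []. err v \<noteq> 0} \<le> dl" using card_mono[OF finD] cD by (meson le_trans)
    then show "2 * card {v \<in> set [0..<2 ^ d0] - set []. err v \<noteq> 0} + length ([] :: nat list) \<le> 2 * dl" by simp
  qed (auto simp: err_def)
  then have e: "nth_or 0 (hash_diff d0 f0 dl W k s G') v = err v" if "v < 2 ^ d0" for v using that by simp
  have "fix_hashes d0 (hash_diff d0 f0 dl W k s G') G' = filter (\<lambda>v. v \<in> set G) [0..<2 ^ d0]"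
    unfolding fix_hashes_def
  proof (rule filter_cong[OF refl])
    fix v assume "v \<in> set [0..<2 ^ d0]"
    then have "v < 2 ^ d0" by simp
    have z: "0 \<notin> set G" unfolding setG by simp
    show "(\<not> v = 0 \<and> ((\<exists>u\<in>set G'. u = v) \<and> nth_or 0 (hash_diff d0 f0 dl W k s G') v = 0 \<or>
         \<not> (\<exists>u\<in>set G'. u = v) \<and> \<not> nth_or 0 (hash_diff d0 f0 dl W k s G') v = 0)) = (v \<in> set G)"
      unfolding e[OF \<open>v < 2 ^ d0\<close>] err_def D_def sdiff_def using z by (cases "v = 0") auto
  qed
  also have "\<dots> = G" unfolding setG unfolding G hash_set_def f0_def by (intro filter_cong) auto
  finally show ?thesis unfolding f0_def .
qed

lemma radix: "u mod 2 ^ d0 + (\<Sum>i<k. layer d d0 u i * 2 ^ (d0 + i * d)) = u mod 2 ^ (d0 + k * d)"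
proof (induction k)
  case (Suc k)
  have "u mod 2 ^ (d0 + Suc k * d) = u mod (2 ^ (d0 + k * d) * 2 ^ d)" by (simp add: power_add algebra_simps)
  also have "\<dots> = 2 ^ (d0 + k * d) * layer d d0 u k + u mod 2 ^ (d0 + k * d)" unfolding mod_mult2_eq layer_def ..
  finally show ?case using Suc by simp
qed simp

lemma hash_mix_cong: "(\<And>i. i < L \<Longrightarrow> y i = z i) \<Longrightarrow> hash_mix d0 f0 L a y = hash_mix d0 f0 L a z"
  unfolding hash_mix_def by (intro arg_cong[where f = "fsum d0"] map_cong) auto

lemma preimages_props:
  assumes "G = hash_set d0 f0 d L a xs" "r < length G"
  shows "preimages d0 f0 d L a xs G ! r \<in> set xs" "hash_val d0 f0 d L a (preimages d0 f0 d L a xs G ! r) = G ! r"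
proof -
  have "G ! r \<in> set G" using assms(2) by simp
  then obtain u where "u \<in> set xs" "hash_val d0 f0 d L a u = G ! r" unfolding assms(1) hash_set_props(3) by auto
  from hd_or_filter[OF this(1), of "\<lambda>u. hash_val d0 f0 d L a u = G ! r" 0, OF this(2)]
  show "preimages d0 f0 d L a xs G ! r \<in> set xs" "hash_val d0 f0 d L a (preimages d0 f0 d L a xs G ! r) = G ! r"
    unfolding preimages_def using assms(2) by auto
qed

text \<open>An erased position accounts for at least one shingle of the symmetric difference and a wrong
  guess for two, so the errors and erasures are within the capacity of the code.\<close>

lemma fix_layers_correct:
  fixes d0 f0 d L a :: nat and xs xs' :: "nat list"
  defines "G \<equiv> hash_set d0 f0 d L a xs"
  defines "ys \<equiv> preimages d0 f0 d L a xs G" and "zs \<equiv> guess d0 f0 d L a xs' G" and "E \<equiv> erasures d0 f0 d L a xs' G"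
  assumes "0 < d" and good: "good_hash d0 f0 d L xs a" and card: "card (sdiff (set xs) (set xs')) \<le> dl"
    and len: "length G \<le> 2 ^ d"
    and s: "\<And>i j. i < L \<Longrightarrow> j < dl \<Longrightarrow> get_num W s (k + i * dl + j) = rs_syndrome d (gfmod d) d0 ys i j"
  shows "fix_layers d (gfmod d) d0 dl L W k s zs E = map (\<lambda>i. map (\<lambda>r. layer d d0 (nth_or 0 ys r) i) [0..<length G]) [0..<L]"
proof -
  define f where "f = gfmod d"
  obtain \<phi> :: "nat \<Rightarrow> bit alg_closure" where "gf d f \<phi>" using gf_ex[OF \<open>0 < d\<close>] f_def by blast
  then interpret gf d f \<phi> .
  let ?h = "hash_val d0 f0 d L a"
  have lens: "length ys = length G" "length zs = length G" unfolding ys_def preimages_def zs_def guess_def by simp_all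
  have ys: "ys ! r \<in> set xs" "?h (ys ! r) = G ! r" if "r < length G" for r
    using preimages_props[of G d0 f0 d L a xs r] that unfolding G_def ys_def by auto
  have inj: "u = v" if "u \<in> set xs" "v \<in> set xs" "?h u = ?h v" for u v
    using good that unfolding good_hash_def by blast
  have dG: "distinct G" unfolding G_def by (rule hash_set_props(2))
  \<comment> \<open>Shingles in the symmetric difference are charged to their hash values. The sets
    \<open>T r\<close> are disjoint since the values in \<open>G\<close> are.\<close>
  define T where "T r = {u \<in> sdiff (set xs) (set xs'). ?h u = G ! r}" for r
  have finT: "finite (T r)" for r unfolding T_def sdiff_def by simp
  have setE: "set E = {r. r < length G \<and> \<not> single (candidates d0 f0 d L a xs' (G ! r))}"
    unfolding E_def erasures_def by auto
  have candidates: "set (candidates d0 f0 d L a xs' v) = {u \<in> set xs'. ?h u = v}" for v unfolding candidates_def by auto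
  \<comment> \<open>Either there is no candidate, and the true shingle is missing from
    \<open>xs'\<close>; or there are two different ones, at most one of which belongs to
    \<open>xs\<close>.\<close>
  have era: "1 \<le> card (T r)" if r: "r \<in> set E" for r
  proof -
    have rl: "r < length G" and ns: "\<not> single (candidates d0 f0 d L a xs' (G ! r))" using r setE by auto
    have "T r \<noteq> {}"
    proof (cases "candidates d0 f0 d L a xs' (G ! r) = []")
      case True
      then have "ys ! r \<notin> set xs'" using ys(2)[OF rl] candidates[of "G ! r"] by auto
      then show ?thesis using ys[OF rl] unfolding T_def sdiff_def by auto
    next
      case False
      then obtain u v where uv: "u \<in> set (candidates d0 f0 d L a xs' (G ! r))" "v \<in> set (candidates d0 f0 d L a xs' (G ! r))" "u \<noteq> v"
        using ns unfolding single_def hd_or_def by (cases "candidates d0 f0 d L a xs' (G ! r)") auto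
      then have "\<not> (u \<in> set xs \<and> v \<in> set xs)" using inj[of u v] candidates by auto
      then show ?thesis using uv(1,2) candidates unfolding T_def sdiff_def by auto
    qed
    then show ?thesis using finT[of r] by (simp add: Suc_le_eq card_gt_0_iff)
  qed
  \<comment> \<open>The true shingle is missing from \<open>xs'\<close>, as it would be a second
    candidate. The guess is missing from \<open>xs\<close>, by injectivity there. Both are
    charged.\<close>
  have wrong: "2 \<le> card (T r)" if r: "r < length G" "r \<notin> set E" "zs ! r \<noteq> ys ! r" for r
  proof -
    let ?C = "candidates d0 f0 d L a xs' (G ! r)"
    have sg: "single ?C" using r setE by auto
    then have z: "zs ! r = hd_or 0 ?C" unfolding zs_def guess_def using r(1) by simp
    have "hd_or 0 ?C \<in> set ?C" using sg unfolding single_def hd_or_def by (cases ?C) auto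
    then have zC: "zs ! r \<in> set xs'" "?h (zs ! r) = G ! r" unfolding z candidates by auto
    then have "zs ! r \<notin> set xs" using inj[of "zs ! r" "ys ! r"] ys[OF r(1)] r(3) by auto
    moreover have "ys ! r \<notin> set xs'"
    proof
      assume "ys ! r \<in> set xs'"
      then have "ys ! r \<in> set ?C" using ys(2)[OF r(1)] unfolding candidates by simp
      then show False using sg r(3) unfolding single_def z by auto
    qed
    ultimately have "{ys ! r, zs ! r} \<subseteq> T r" using ys[OF r(1)] zC unfolding T_def sdiff_def by auto
    from card_mono[OF finT this] show ?thesis using r(3) by (simp add: eq_commute)
  qed
  have bound: "2 * card {r \<in> set [0..<length G] - set E. zs ! r \<noteq> ys ! r} + length E \<le> dl"
  proof -
    let ?B = "{r \<in> set [0..<length G] - set E. zs ! r \<noteq> ys ! r}"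
    have "2 * card ?B + card (set E) = (\<Sum>r\<in>?B. 2) + (\<Sum>r\<in>set E. 1)" by simp
    also have "\<dots> \<le> (\<Sum>r\<in>?B. card (T r)) + (\<Sum>r\<in>set E. card (T r))"
      using wrong era by (intro add_mono sum_mono) auto
    also have "\<dots> = (\<Sum>r\<in>?B \<union> set E. card (T r))" by (intro sum.union_disjoint[symmetric]) auto
    also have "\<dots> = card (\<Union>r\<in>?B \<union> set E. T r)"
    proof (rule card_UN_disjoint[symmetric])
      show "\<forall>i\<in>?B \<union> set E. \<forall>j\<in>?B \<union> set E. i \<noteq> j \<longrightarrow> T i \<inter> T j = {}"
      proof (intro ballI impI)
        fix i j assume "i \<in> ?B \<union> set E" "j \<in> ?B \<union> set E" "i \<noteq> j"
        then have "i < length G" "j < length G" unfolding setE by auto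
        then have "G ! i \<noteq> G ! j" using dG \<open>i \<noteq> j\<close> by (simp add: nth_eq_iff_index_eq)
        then show "T i \<inter> T j = {}" unfolding T_def by auto
      qed
    qed (use finT in auto)
    also have "\<dots> \<le> card (sdiff (set xs) (set xs'))" by (intro card_mono) (auto simp: T_def sdiff_def)
    finally show ?thesis using card distinct_card[of E] unfolding E_def erasures_def by simp
  qed
  have layl: "layer d d0 u i < 2 ^ d" for u i unfolding layer_def by simp
  have "map (\<lambda>r. fadd d (layer d d0 (nth_or 0 zs r) i) (nth_or 0 (layer_errors d f d0 dl W k s zs E i) r)) [0..<length zs] =
     map (\<lambda>r. layer d d0 (nth_or 0 ys r) i) [0..<length G]" if i: "i < L" for i
  proof -
    define err where "err r = fadd d (layer d d0 (ys ! r) i) (layer d d0 (zs ! r) i)" for r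
    have "layer_errors d f d0 dl W k s zs E i = map err [0..<length zs]"
      unfolding layer_errors_def
    proof (rule decode_correct)
      show "set [0..<length zs] \<subseteq> {..<2 ^ d}" using len lens by auto
      show "distinct E" "set E \<subseteq> set [0..<length zs]" unfolding E_def erasures_def lens by auto
      show "err v < 2 ^ d" for v unfolding err_def by (rule fadd_less)
      fix j assume j: "j < dl"
      have "\<phi> (nth_or 0 (map (\<lambda>j. fadd d (get_num W s (k + i * dl + j)) (rs_syndrome d f d0 zs i j)) [0..<dl]) j) =
         \<phi> (rs_syndrome d f d0 ys i j) + \<phi> (rs_syndrome d f d0 zs i j)"
        using j s[OF i j] by (simp add: \<phi>add f_def)
      also have "\<dots> = (\<Sum>v\<in>set [0..<length zs]. \<phi> (err v) * \<phi> v ^ j)"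
        unfolding \<phi>_rs_syndrome lens err_def \<phi>add by (simp add: sum.distrib distrib_right atLeast0LessThan)
      finally show "\<phi> (nth_or 0 (map (\<lambda>j. fadd d (get_num W s (k + i * dl + j)) (rs_syndrome d f d0 zs i j)) [0..<dl]) j) =
         (\<Sum>v\<in>set [0..<length zs]. \<phi> (err v) * \<phi> v ^ j)" .
    next
      have "{r \<in> set [0..<length zs] - set E. err r \<noteq> 0} \<subseteq> {r \<in> set [0..<length G] - set E. zs ! r \<noteq> ys ! r}"
        unfolding err_def lens using fadd_self by auto
      then have "card {r \<in> set [0..<length zs] - set E. err r \<noteq> 0} \<le> card {r \<in> set [0..<length G] - set E. zs ! r \<noteq> ys ! r}"
        by (intro card_mono) auto
      then show "2 * card {r \<in> set [0..<length zs] - set E. err r \<noteq> 0} + length E \<le> dl" using bound by linarith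
    qed simp
    moreover have "fadd d (layer d d0 (zs ! r) i) (err r) = layer d d0 (ys ! r) i" for r
    proof -
      have "\<phi> (fadd d (layer d d0 (zs ! r) i) (err r)) = \<phi> (layer d d0 (ys ! r) i)"
        using char2_add_self[OF c2, of "\<phi> (layer d d0 (zs ! r) i)"] unfolding err_def \<phi>add by (metis add.assoc add.commute add.left_neutral)
      then show ?thesis using inj_onD[OF gf.inj[OF gf_axioms]] fadd_less layl by blast
    qed
    ultimately show ?thesis using lens by simp
  qed
  then show ?thesis unfolding fix_layers_def f_def[symmetric] by simp
qed

locale scheme =
  fixes F n c :: nat
  assumes F: "1 \<le> F" and c: "1 \<le> c" and cn: "c \<le> n"
begin

definition "al = shingle_bits F c"
definition "d = field_bits n al"
definition "d0 = hash_bits al d"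
definition "L = num_layers al d"
definition "f0 = gfmod d0"
definition "f = gfmod d"

lemma pow_less: "F ^ c < 2 ^ al"
  unfolding al_def shingle_bits_def by (rule less_two_power_floorlog)

lemma al_pos: "0 < al"
  using pow_less F by (cases al) auto

lemma d_pos: "0 < d"
proof -
  have "1 < (2::nat) ^ floorlog 2 (2 * n * al + 1)" using less_two_power_floorlog[of "2 * n * al + 1"] by linarith
  then have "floorlog 2 (2 * n * al + 1) \<noteq> 0" by (intro notI) simp
  then show ?thesis unfolding d_def field_bits_def by simp
qed

lemma d0_pos: "0 < d0"
  using al_pos d_pos by (simp add: d0_def hash_bits_def)

lemma pow_d: "(2 * n * al + 1) ^ 6 < 2 ^ d"
proof -
  have "(2 * n * al + 1) ^ 6 < (2 ^ floorlog 2 (2 * n * al + 1)) ^ 6"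
    by (intro power_strict_mono less_two_power_floorlog) auto
  then show ?thesis by (simp add: d_def field_bits_def power_mult[symmetric] mult.commute)
qed

text \<open>The positions in the hash list are the nodes of the Reed-Solomon code, so they have to
  be different elements of GF(2^\<open>d\<close>).\<close>

lemma n_less: "n < 2 ^ d"
proof -
  have "n \<le> n * al" using al_pos by simp
  then have "n < 2 * n * al + 1" by linarith
  also have "\<dots> \<le> (2 * n * al + 1) ^ 6" by (rule self_le_power) auto
  finally show ?thesis using pow_d by linarith
qed

lemma split: "al = d0 + L * d"
proof (cases "al < d")
  case True
  then show ?thesis by (simp add: d0_def hash_bits_def L_def num_layers_def)
next
  case False
  then have "1 \<le> al div d" using d_pos by (simp add: Suc_le_eq div_greater_zero_iff)
  then have "al div d = Suc L" unfolding L_def num_layers_def by simp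
  then have "al = Suc L * d + al mod d" using div_mult_mod_eq[of al d] by simp
  then show ?thesis using False by (simp add: d0_def hash_bits_def)
qed

text \<open>Layers are multiplied in GF(2^\<open>d0\<close>) by the hash function, which must not
  lose any of their bits.\<close>

lemma d_le_d0: "0 < L \<Longrightarrow> d \<le> d0"
  unfolding L_def num_layers_def d0_def hash_bits_def by (cases "al < d") auto

lemma shingle_num_bounds: assumes "\<And>x. x \<in> set ws \<Longrightarrow> x < F" shows "1 \<le> shingle_num F c ws i" "shingle_num F c ws i < 2 ^ al"
    "j < c \<Longrightarrow> digit F (shingle_num F c ws i - 1) j = nth_or 0 ws (i + j)"
proof -
  have l: "nth_or 0 ws k < F" for k using assms F by (cases "k < length ws") auto
  have "undigits F c (\<lambda>j. nth_or 0 ws (i + j)) < F ^ c" using l by (intro undigits_less) auto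
  then show "1 \<le> shingle_num F c ws i" "shingle_num F c ws i < 2 ^ al" using pow_less unfolding shingle_num_def by auto
  show "digit F (shingle_num F c ws i - 1) j = nth_or 0 ws (i + j)" if "j < c"
    unfolding shingle_num_def using digit_undigits[of c "\<lambda>j. nth_or 0 ws (i + j)" F j] l that by simp
qed

lemma join_shingle_correct:
  assumes "u < 2 ^ al" and "\<And>i. i < L \<Longrightarrow> nth_or 0 (nth_or [] Z i) r = layer d d0 u i" and "nth_or 0 G r = hash_val d0 f0 d L a u"
  shows "join_shingle d0 f0 d L a G Z r = u"
proof -
  have "\<exists>\<phi>. gf d0 f0 (\<phi> :: nat \<Rightarrow> bit alg_closure)" unfolding f0_def by (rule gf_ex[OF d0_pos])
  then obtain \<phi> :: "nat \<Rightarrow> bit alg_closure" where "gf d0 f0 \<phi>" by blast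
  then interpret g: gf d0 f0 \<phi> .
  have m: "hash_mix d0 f0 L a (\<lambda>i. nth_or 0 (nth_or [] Z i) r) = hash_mix d0 f0 L a (layer d d0 u)"
    using assms(2) by (rule hash_mix_cong)
  have "fadd d0 (nth_or 0 G r) (hash_mix d0 f0 L a (\<lambda>i. nth_or 0 (nth_or [] Z i) r)) = u mod 2 ^ d0"
    unfolding m assms(3) hash_val_def by (rule g.fadd_cancel) simp
  then show ?thesis unfolding join_shingle_def using assms(1,2) radix[of u d0 d L] by (simp add: split[symmetric])
qed

lemma block_pos: assumes "j < n" shows "block_pos n c (j div c) \<le> j" "j - block_pos n c (j div c) < c" "block_pos n c b < n - c + 1"
proof -
  have "j = j div c * c + j mod c" "j mod c < c" using c by (auto simp: mod_less_divisor)
  then show "block_pos n c (j div c) \<le> j" "j - block_pos n c (j div c) < c" unfolding block_pos_def using assms cn by linarith+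
  show "block_pos n c b < n - c + 1" unfolding block_pos_def by simp
qed

lemma blk: "j < n \<Longrightarrow> j div c < num_blocks n c"
proof -
  assume "j < n"
  then have "j div c \<le> (n - 1) div c" by (intro div_le_mono) simp
  moreover have "num_blocks n c = (n - 1) div c + 1"
  proof -
    have "n + c - 1 = (n - 1) + c" using c cn by simp
    then have "num_blocks n c = ((n - 1) + c) div c" unfolding num_blocks_def by (rule arg_cong)
    also have "\<dots> = (n - 1) div c + 1" using c by (intro div_add_self2) simp
    finally show ?thesis .
  qed
  ultimately show ?thesis by simp
qed

lemma shingle_nums_nth: "i < n - c + 1 \<Longrightarrow> shingle_num F c ws i \<in> set (shingle_nums F n c ws)"
  unfolding shingle_nums_def by (auto simp del: upt_Suc)

lemma hash_set_length: "length (hash_set d0 f0 d L a (shingle_nums F n c ws)) \<le> n - c + 1"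
proof -
  have "length (hash_set d0 f0 d L a (shingle_nums F n c ws)) = card (set (hash_set d0 f0 d L a (shingle_nums F n c ws)))"
    by (rule distinct_card[OF hash_set_props(2), symmetric])
  also have "\<dots> \<le> card (hash_val d0 f0 d L a ` set (shingle_nums F n c ws))" unfolding hash_set_props by (intro card_mono) auto
  also have "\<dots> \<le> card (set (shingle_nums F n c ws))" by (rule card_image_le) simp
  also have "\<dots> \<le> length (shingle_nums F n c ws)" by (rule card_length)
  finally show ?thesis by (simp add: shingle_nums_def)
qed

lemma rc1_correct:
  assumes ws: "\<And>x. x \<in> set ws \<Longrightarrow> x < F" "length ws = n"
    and good: "good_hash d0 f0 d L (shingle_nums F n c ws) a"
    and card: "card (sdiff (set (shingle_nums F n c ws)) (set xs')) \<le> dl"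
    and bits: "\<And>x. x \<in> set (sk_core F n c dl d0 f0 d f L ws a) \<Longrightarrow> x < 2 ^ W"
  shows "rc1 F n c dl d0 f0 d f L W (to_bits W (sk_core F n c dl d0 f0 d f L ws a)) a xs' = ws"
proof -
  define xs where "xs = shingle_nums F n c ws"
  define G where "G = hash_set d0 f0 d L a xs"
  define ys where "ys = preimages d0 f0 d L a xs G"
  define rk where "rk = ranks F n c d0 f0 d L a ws G"
  define dat where "dat = sk_core F n c dl d0 f0 d f L ws a"
  have dat: "dat = a # rk @ bch_syndromes d0 f0 dl G @ rs_syndromes d f d0 dl L ys"
    unfolding dat_def sk_core_def rk_def ys_def G_def xs_def ..
  have lrk: "length rk = num_blocks n c" unfolding rk_def ranks_def by simp
  have lb: "length (bch_syndromes d0 f0 dl G) = dl" unfolding bch_syndromes_def by simp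
  define s where "s = to_bits W dat"
  have get: "get_num W s i = dat ! i" if "i < length dat" for i
    unfolding s_def using bits[folded dat_def] that by (intro get_num_to_bits) auto
  have nz: "\<forall>u\<in>set xs. hash_val d0 (gfmod d0) d L a u \<noteq> 0"
    using good unfolding good_hash_def xs_def f0_def by blast
  have g1: "get_num W s (1 + num_blocks n c + i) = power_sum d0 (gfmod d0) G (2 * i + 1)" if "i < dl" for i
  proof -
    have "dat ! (1 + num_blocks n c + i) = bch_syndromes d0 f0 dl G ! i" using that lrk lb unfolding dat by (simp add: nth_append)
    then show ?thesis using that get[of "1 + num_blocks n c + i"] lrk lb unfolding dat by (simp add: bch_syndromes_def f0_def)
  qed
  have g2: "get_num W s (1 + num_blocks n c + dl + i * dl + j) = rs_syndrome d (gfmod d) d0 ys i j" if "i < L" "j < dl" for i j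
  proof -
    have *: "i * dl + j < length (rs_syndromes d f d0 dl L ys)" "rs_syndromes d f d0 dl L ys ! (i * dl + j) = rs_syndrome d f d0 ys i j"
      using concat_nth[of "[0..<L]" "\<lambda>i. map (\<lambda>j. rs_syndrome d f d0 ys i j) [0..<dl]" dl i j] that
      unfolding rs_syndromes_def by auto
    have "dat ! (1 + num_blocks n c + dl + (i * dl + j)) = rs_syndromes d f d0 dl L ys ! (i * dl + j)"
      using lrk lb unfolding dat by (simp add: nth_append)
    then show ?thesis using * get[of "1 + num_blocks n c + dl + (i * dl + j)"] lrk lb unfolding dat by (simp add: f_def add.assoc)
  qed
  have fx: "fix_hashes d0 (hash_diff d0 f0 dl W (1 + num_blocks n c) s (hash_set d0 f0 d L a xs')) (hash_set d0 f0 d L a xs') = G"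
    unfolding f0_def by (rule fix_hashes_correct[OF d0_pos _ nz]) (use card g1 in \<open>auto simp: G_def xs_def f0_def\<close>)
  have len: "length G \<le> 2 ^ d" using hash_set_length[of a ws] n_less c unfolding G_def xs_def by linarith
  define Z where "Z = map (\<lambda>i. map (\<lambda>r. layer d d0 (nth_or 0 ys r) i) [0..<length G]) [0..<L]"
  have lf: "fix_layers d f d0 dl L W (1 + num_blocks n c + dl) s (guess d0 f0 d L a xs' G) (erasures d0 f0 d L a xs' G) = Z"
    unfolding f_def Z_def ys_def G_def
    by (rule fix_layers_correct[OF d_pos]) (use good card len g2 in \<open>auto simp: G_def xs_def ys_def\<close>)
  have lys: "length ys = length G" unfolding ys_def preimages_def by simp
  have ysp: "ys ! r \<in> set xs" "hash_val d0 f0 d L a (ys ! r) = G ! r" if "r < length G" for r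
    using preimages_props[of G d0 f0 d L a xs r] that unfolding G_def ys_def by auto
  have "digit F (join_shingle d0 f0 d L a G Z (get_num W s (1 + j div c)) - 1) (j - block_pos n c (j div c)) = ws ! j" if j: "j < n" for j
  proof -
    define b where "b = j div c"
    have b: "b < num_blocks n c" unfolding b_def by (rule blk[OF j])
    define u where "u = shingle_num F c ws (block_pos n c b)"
    have u: "u \<in> set xs" unfolding u_def xs_def by (rule shingle_nums_nth[OF block_pos(3)[OF j]])
    have "hash_val d0 f0 d L a u \<in> set G" unfolding G_def hash_set_props using u nz f0_def by auto
    then obtain r where r: "r < length G" "G ! r = hash_val d0 f0 d L a u" by (auto simp: in_set_conv_nth)
    \<comment> \<open>The hash list is sorted and already recovered, so the rank is the index of the
      block's hash value in it.\<close>
    have "rk ! b = length (filter (\<lambda>v. v < G ! r) G)" unfolding rk_def ranks_def r(2) using b by (simp add: u_def)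
    also have "\<dots> = r" by (rule rank_nth[OF _ _ r(1)]) (auto simp: G_def hash_set_props)
    finally have "get_num W s (1 + b) = r" using get[of "1 + b"] b lrk unfolding dat by (simp add: nth_append)
    moreover have "ys ! r = u" using ysp[OF r(1)] r(2) u good unfolding good_hash_def xs_def by auto
    moreover have "join_shingle d0 f0 d L a G Z r = u"
    proof (rule join_shingle_correct)
      show "u < 2 ^ al" unfolding u_def by (rule shingle_num_bounds(2)[OF ws(1)])
      show "nth_or 0 (nth_or [] Z i) r = layer d d0 u i" if "i < L" for i
        using that r(1) \<open>ys ! r = u\<close> lys unfolding Z_def by simp
      show "nth_or 0 G r = hash_val d0 f0 d L a u" using r by simp
    qed
    moreover have "digit F (u - 1) (j - block_pos n c b) = ws ! j"
      unfolding u_def using shingle_num_bounds(3)[OF ws(1) block_pos(2)[OF j]] block_pos(1)[OF j] j ws(2) unfolding b_def by simp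
    ultimately show ?thesis unfolding b_def by simp
  qed
  then have "output_string F n c d0 f0 d L a W s G Z = ws"
    unfolding output_string_def using ws(2) by (intro nth_equalityI) auto
  then show ?thesis
    unfolding rc1_def rc2_def rc3_def dat_def[symmetric] s_def[symmetric] fx lf .
qed

end

section \<open>Loss of entropy\<close>

definition max_joint :: "('a \<times> 'b) pmf \<Rightarrow> 'b \<Rightarrow> real" where "max_joint D b = (SUP a. pmf D (a, b))"

definition guess_prob :: "('a \<times> 'b) pmf \<Rightarrow> real" where
  "guess_prob D = measure_pmf.expectation (map_pmf snd D) (\<lambda>b. SUP a. \<P>(x in measure_pmf D. fst x = a \<bar> snd x = b))"

lemma bdd_pmf: "bdd_above (range (\<lambda>a. pmf D (a, b)))"
  by (rule bdd_aboveI[of _ 1]) (auto simp: pmf_le_1)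

lemma max_joint_upper: "pmf D (a, b) \<le> max_joint D b"
  unfolding max_joint_def by (rule cSUP_upper[OF UNIV_I bdd_pmf])

lemma max_joint_nonneg: "0 \<le> max_joint D b"
  using max_joint_upper[of D undefined b] pmf_nonneg[of D "(undefined, b)"] by linarith

lemma cond_pmf_eq: "\<P>(x in measure_pmf D. fst x = a \<bar> snd x = b) = pmf D (a, b) / pmf (map_pmf snd D) b"
proof -
  have "{x \<in> space (measure_pmf D). fst x = a \<and> snd x = b} = {(a, b)}" by auto
  moreover have "{x \<in> space (measure_pmf D). snd x = b} = snd -` {b}" by auto
  ultimately show ?thesis unfolding cond_prob_def by (simp add: pmf_map measure_pmf_single)
qed

text \<open>The probability of \<open>b\<close> cancels the denominator of the conditional
  probability. The sum is a nonnegative integral because there can be infinitely many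
  \<open>b\<close>.\<close>

lemma guess_prob_nn: "ennreal (guess_prob D) = (\<integral>\<^sup>+ b. ennreal (max_joint D b) \<partial>count_space UNIV)" and guess_prob_nonneg: "0 \<le> guess_prob D"
proof -
  let ?p = "\<lambda>b. pmf (map_pmf snd D) b"
  let ?g = "\<lambda>b. SUP a. pmf D (a, b) / ?p b"
  have le: "pmf D (a, b) \<le> ?p b" for a b
    unfolding pmf_map by (subst pmf.rep_eq) (intro measure_pmf.finite_measure_mono, auto)
  have le1: "pmf D (a, b) / ?p b \<le> 1" for a b
    using le[of a b] pmf_nonneg[of "map_pmf snd D" b] by (simp add: divide_le_eq_1 less_le)
  have bdd: "bdd_above (range (\<lambda>a. pmf D (a, b) / ?p b))" for b by (rule bdd_aboveI[of _ 1]) (use le1 in auto)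
  have g0: "0 \<le> ?g b" for b
    by (rule order_trans[OF _ cSUP_upper[OF UNIV_I[of undefined] bdd]]) simp
  have g1: "?g b \<le> 1" for b by (rule cSUP_least) (use le1 in auto)
  have pg: "?p b * ?g b = max_joint D b" for b
  proof (cases "?p b = 0")
    case True
    then have "pmf D (a, b) = 0" for a using le[of a b] pmf_nonneg[of D "(a, b)"] by linarith
    then show ?thesis using True by (simp add: max_joint_def)
  next
    case False
    then have p: "0 < ?p b" using pmf_nonneg[of "map_pmf snd D" b] by linarith
    have "?g b \<le> max_joint D b / ?p b" by (rule cSUP_least) (use max_joint_upper[of D _ b] p in \<open>auto intro: divide_right_mono\<close>)
    moreover have "max_joint D b \<le> ?p b * ?g b" unfolding max_joint_def
    proof (rule cSUP_least)
      fix a show "pmf D (a, b) \<le> ?p b * ?g b" using cSUP_upper[OF UNIV_I[of a] bdd[of b]] p by (simp add: divide_le_eq mult.commute)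
    qed simp
    ultimately show ?thesis using p by (simp add: le_divide_eq mult.commute)
  qed
  have e: "guess_prob D = measure_pmf.expectation (map_pmf snd D) ?g" unfolding guess_prob_def cond_pmf_eq ..
  show "0 \<le> guess_prob D" unfolding e by (intro integral_nonneg_AE) (use g0 in auto)
  have "integrable (measure_pmf (map_pmf snd D)) ?g"
    by (rule measure_pmf.integrable_const_bound[of _ 1]) (use g0 g1 in auto)
  then have "ennreal (guess_prob D) = (\<integral>\<^sup>+ b. ennreal (?g b) \<partial>measure_pmf (map_pmf snd D))"
    unfolding e using g0 by (intro nn_integral_eq_integral[symmetric]) auto
  also have "\<dots> = (\<integral>\<^sup>+ b. ennreal (max_joint D b) \<partial>count_space UNIV)"
    unfolding nn_integral_measure_pmf pg[symmetric] using g0 by (simp add: ennreal_mult)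
  finally show "ennreal (guess_prob D) = (\<integral>\<^sup>+ b. ennreal (max_joint D b) \<partial>count_space UNIV)" .
qed

lemma guess_prob_pos: "0 < guess_prob D"
proof -
  obtain a b where ab: "(a, b) \<in> set_pmf D" using set_pmf_not_empty[of D] by (metis ex_in_conv surj_pair)
  have "0 < pmf D (a, b)" using ab by (simp add: pmf_positive)
  also have "pmf D (a, b) \<le> max_joint D b" by (rule max_joint_upper)
  finally have "0 < max_joint D b" .
  moreover have "ennreal (max_joint D b) \<le> ennreal (guess_prob D)"
  proof -
    have "ennreal (max_joint D b) = (\<integral>\<^sup>+ y. ennreal (max_joint D b) * indicator {b} y \<partial>count_space UNIV)" by simp
    also have "\<dots> \<le> (\<integral>\<^sup>+ y. ennreal (max_joint D y) \<partial>count_space UNIV)"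
      by (intro nn_integral_mono) (auto simp: indicator_def)
    finally show ?thesis unfolding guess_prob_nn .
  qed
  ultimately show ?thesis using guess_prob_nonneg[of D] by (simp add: ennreal_le_iff)
qed

text \<open>The right-hand side of the assumption bounds the sum over all sketches \<open>s\<close> of the largest
  probability with which \<open>s\<close> occurs as sketch of a point.\<close>

lemma entropy_loss:
  fixes D :: "('w \<times> 'i) pmf" and SS :: "'w \<Rightarrow> 's pmf"
  assumes M: "fst ` set_pmf D \<subseteq> M" and T: "finite T" "\<And>w. w \<in> M \<Longrightarrow> set_pmf (SS w) \<subseteq> T"
    and \<mu>: "\<And>w s. w \<in> M \<Longrightarrow> pmf (SS w) s \<le> \<mu> s" "\<And>s. 0 \<le> \<mu> s" and sum: "sum \<mu> T \<le> 2 powr l"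
  shows "avg_min_entropy (bind_pmf D (\<lambda>(w, i). map_pmf (\<lambda>s. (w, (s, i))) (SS w))) \<ge> avg_min_entropy D - l"
proof -
  let ?D = "bind_pmf D (\<lambda>(w, i). map_pmf (\<lambda>s. (w, (s, i))) (SS w))"
  have pD: "pmf ?D (a, (s, i)) = pmf D (a, i) * pmf (SS a) s" for a s i
  proof -
    have "pmf (case x of (w, i) \<Rightarrow> map_pmf (\<lambda>s. (w, (s, i))) (SS w)) (a, (s, i)) = pmf (SS a) s * indicator {(a, i)} x" for x
    proof (cases "x = (a, i)")
      case True
      have "inj (\<lambda>s. (a, (s, i)))" by (auto intro: injI)
      then show ?thesis using True pmf_map_inj'[of "\<lambda>s. (a, (s, i))" "SS a" s] by simp
    next
      case False
      then have "(a, (s, i)) \<notin> set_pmf (case x of (w, i) \<Rightarrow> map_pmf (\<lambda>s. (w, (s, i))) (SS w))" by (cases x) auto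
      then show ?thesis using False by (simp add: set_pmf_iff)
    qed
    then have "pmf ?D (a, (s, i)) = measure_pmf.expectation D (\<lambda>x. pmf (SS a) s * indicator {(a, i)} x)"
      unfolding pmf_bind by (intro Bochner_Integration.integral_cong) auto
    also have "\<dots> = pmf (SS a) s * pmf D (a, i)" by (simp add: pmf.rep_eq)
    finally show ?thesis by simp
  qed
  \<comment> \<open>The coins of \<open>SS\<close> are independent of the pair, so each joint
    probability is a product of which both factors are bounded.\<close>
  have bound: "max_joint ?D (s, i) \<le> \<mu> s * indicator T s * max_joint D i" for s i
    unfolding max_joint_def[of ?D]
  proof (rule cSUP_least)
    fix a
    show "pmf ?D (a, (s, i)) \<le> \<mu> s * indicator T s * max_joint D i"
    proof (cases "(a, i) \<in> set_pmf D \<and> s \<in> set_pmf (SS a)")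
      case True
      then have a: "a \<in> M" using M by force
      then have "s \<in> T" using T(2) True by auto
      have "pmf D (a, i) * pmf (SS a) s \<le> max_joint D i * \<mu> s"
        by (intro mult_mono max_joint_upper \<mu>(1) a max_joint_nonneg) simp
      then show ?thesis using \<open>s \<in> T\<close> unfolding pD by (simp add: mult.commute)
    next
      case False
      then have "pmf ?D (a, (s, i)) = 0" unfolding pD by (auto simp: set_pmf_iff)
      then show ?thesis using \<mu>(2)[of s] max_joint_nonneg[of D i] by simp
    qed
  qed simp
  have "ennreal (guess_prob ?D) = (\<integral>\<^sup>+ x. ennreal (max_joint ?D x) \<partial>count_space UNIV)" by (rule guess_prob_nn)
  also have "\<dots> = (\<integral>\<^sup>+ s. \<integral>\<^sup>+ i. ennreal (max_joint ?D (s, i)) \<partial>count_space UNIV \<partial>count_space UNIV)"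
    by (rule nn_integral_fst_count_space[symmetric])
  also have "\<dots> \<le> (\<integral>\<^sup>+ s. \<integral>\<^sup>+ i. ennreal (\<mu> s * indicator T s) * ennreal (max_joint D i) \<partial>count_space UNIV \<partial>count_space UNIV)"
    using bound \<mu>(2) max_joint_nonneg[of D] by (intro nn_integral_mono) (simp add: ennreal_mult[symmetric] ennreal_leI)
  also have "\<dots> = (\<integral>\<^sup>+ s. ennreal (\<mu> s * indicator T s) * ennreal (guess_prob D) \<partial>count_space UNIV)"
    by (simp add: nn_integral_cmult guess_prob_nn)
  also have "\<dots> = (\<integral>\<^sup>+ s. ennreal (\<mu> s * indicator T s) \<partial>count_space UNIV) * ennreal (guess_prob D)"
    by (simp add: nn_integral_multc)
  also have "(\<integral>\<^sup>+ s. ennreal (\<mu> s * indicator T s) \<partial>count_space UNIV) = (\<integral>\<^sup>+ s. ennreal (\<mu> s) * indicator T s \<partial>count_space UNIV)"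
    by (intro nn_integral_cong) (auto simp: indicator_def)
  also have "\<dots> = (\<integral>\<^sup>+ s. ennreal (\<mu> s) \<partial>count_space T)" by (simp add: nn_integral_count_space_indicator)
  also have "\<dots> = ennreal (sum \<mu> T)" using T(1) \<mu>(2) by (simp add: nn_integral_count_space_finite)
  also have "\<dots> * ennreal (guess_prob D) = ennreal (sum \<mu> T * guess_prob D)"
    using \<mu>(2) by (intro ennreal_mult[symmetric] sum_nonneg guess_prob_nonneg) auto
  finally have "guess_prob ?D \<le> sum \<mu> T * guess_prob D"
    using \<mu>(2) guess_prob_nonneg[of D] by (subst (asm) ennreal_le_iff) (auto intro!: mult_nonneg_nonneg sum_nonneg)
  also have "\<dots> \<le> 2 powr l * guess_prob D" using sum guess_prob_nonneg by (rule mult_right_mono)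
  finally have "guess_prob ?D \<le> 2 powr l * guess_prob D" .
  then have "log 2 (guess_prob ?D) \<le> log 2 (2 powr l * guess_prob D)" using guess_prob_pos[of ?D] by (intro log_mono) auto
  also have "\<dots> = l + log 2 (guess_prob D)" using guess_prob_pos[of D] by (simp add: log_mult)
  finally show ?thesis unfolding avg_min_entropy_def guess_prob_def[symmetric] by simp
qed

lemma hd_or_filter_upt_le: "a < q \<Longrightarrow> P a \<Longrightarrow> hd_or 0 (filter P [0..<q]) \<le> a"
proof -
  assume "a < q" "P a"
  then have a: "a \<in> set (filter P [0..<q])" by simp
  have "sorted (filter P [0..<q])" by (simp add: sorted_wrt_filter)
  then show ?thesis using a by (cases "filter P [0..<q]") (auto simp: hd_or_def)
qed

section \<open>Bad coins and the number of sketches\<close>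

context scheme
begin

abbreviation "m \<equiv> n - c + 1"
abbreviation "N \<equiv> num_blocks n c"
abbreviation "q \<equiv> (2::nat) ^ d0"
definition "J0 = m * (m + 1) * L"
definition "strings = {ws. set ws \<subseteq> {..<F} \<and> length ws = n}"

lemma gf0: obtains \<phi> :: "nat \<Rightarrow> bit alg_closure" where "gf d0 f0 \<phi>"
proof -
  have "\<exists>\<phi>. gf d0 f0 (\<phi> :: nat \<Rightarrow> bit alg_closure)" unfolding f0_def by (rule gf_ex[OF d0_pos])
  then show ?thesis using that by blast
qed

text \<open>The difference of the two hash values is a polynomial in the coin of degree at most
  \<open>L\<close>. Its coefficients are the differences of low parts and layers, which cannot all
  vanish since together they determine the shingle.\<close>

lemma hash_collisions:
  assumes "u < 2 ^ al" "v < 2 ^ al" "u \<noteq> v"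
  shows "card {a. a < q \<and> hash_val d0 f0 d L a u = hash_val d0 f0 d L a v} \<le> L"
proof -
  obtain \<phi> :: "nat \<Rightarrow> bit alg_closure" where "gf d0 f0 \<phi>" by (rule gf0)
  then interpret g: gf d0 f0 \<phi> .
  define cf where "cf i = (if i = 0 then \<phi> (u mod q) + \<phi> (v mod q) else \<phi> (layer d d0 u (i - 1)) + \<phi> (layer d d0 v (i - 1)))" for i
  define p where "p = (\<Sum>i<L + 1. Polynomial.monom (cf i) i)"
  have hs: "\<phi> (hash_val d0 f0 d L a w) = \<phi> (w mod q) + (\<Sum>i<L. \<phi> a ^ (i + 1) * \<phi> (layer d d0 w i))" for a w
    unfolding hash_val_def hash_mix_def g.\<phi>add g.\<phi>_fsum_upt g.\<phi>mul g.\<phi>_fpow ..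
  have ev: "poly p (\<phi> a) = \<phi> (hash_val d0 f0 d L a u) + \<phi> (hash_val d0 f0 d L a v)" for a
  proof -
    have "poly p (\<phi> a) = cf 0 + (\<Sum>i<L. cf (Suc i) * \<phi> a ^ Suc i)"
      unfolding p_def Suc_eq_plus1[symmetric] by (simp add: poly_sum poly_monom sum.lessThan_Suc_shift del: sum.lessThan_Suc)
    then show ?thesis unfolding hs cf_def by (simp add: sum.distrib algebra_simps)
  qed
  have "p \<noteq> 0"
  proof
    assume "p = 0"
    have "Polynomial.coeff p i = cf i" if "i < L + 1" for i
      using that by (simp add: p_def coeff_sum if_distrib cong: if_cong del: sum.lessThan_Suc)
    then have cf0: "cf i = 0" if "i < L + 1" for i using \<open>p = 0\<close> that by simp
    have "\<phi> (u mod q) = \<phi> (v mod q)" using cf0[of 0] char2_add_eq_0_iff[OF g.c2] unfolding cf_def by simp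
    then have 1: "u mod q = v mod q" using inj_onD[OF g.inj] by auto
    have 2: "layer d d0 u i = layer d d0 v i" if "i < L" for i
    proof -
      have le: "2 ^ d \<le> q" using d_le_d0 that by (intro power_increasing) auto
      have l: "layer d d0 w i < q" for w unfolding layer_def by (rule less_le_trans[OF mod_less_divisor le]) simp
      have "\<phi> (layer d d0 u i) = \<phi> (layer d d0 v i)"
        using cf0[of "Suc i"] that char2_add_eq_0_iff[OF g.c2] unfolding cf_def by simp
      then show ?thesis using inj_onD[OF g.inj] l by auto
    qed
    have "u mod 2 ^ al = v mod 2 ^ al" unfolding split radix[of u d0 d L, symmetric] radix[of v d0 d L, symmetric] using 1 2 by simp
    then show False using assms by simp
  qed
  have "Polynomial.degree p \<le> L" unfolding p_def by (intro degree_sum_le) (auto intro: order_trans[OF degree_monom_le])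
  let ?A = "{a. a < q \<and> hash_val d0 f0 d L a u = hash_val d0 f0 d L a v}"
  have "card ?A = card (\<phi> ` ?A)" by (intro card_image[symmetric] inj_on_subset[OF g.inj]) auto
  also have "\<dots> \<le> card {x. poly p x = 0}"
    using \<open>p \<noteq> 0\<close> by (intro card_mono poly_roots_finite) (auto simp: ev char2_add_self[OF g.c2])
  also have "\<dots> \<le> L" using card_poly_roots_bound[OF \<open>p \<noteq> 0\<close>] \<open>Polynomial.degree p \<le> L\<close> by simp
  finally show ?thesis .
qed

lemma hash_val_0: "hash_val d0 f0 d L a 0 = 0"
proof -
  obtain \<phi> :: "nat \<Rightarrow> bit alg_closure" where "gf d0 f0 \<phi>" by (rule gf0)
  then interpret g: gf d0 f0 \<phi> .
  have "\<phi> (hash_val d0 f0 d L a 0) = 0"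
    unfolding hash_val_def hash_mix_def g.\<phi>add g.\<phi>_fsum_upt g.\<phi>mul by (simp add: layer_def g.\<phi>0)
  then show ?thesis using g.\<phi>_eq_0[of "hash_val d0 f0 d L a 0"] fadd_less unfolding hash_val_def by blast
qed

lemma bad_count:
  assumes ws: "ws \<in> strings"
  shows "card {a. a < q \<and> \<not> good_hash d0 f0 d L (shingle_nums F n c ws) a} \<le> J0"
proof -
  define S where "S = set (shingle_nums F n c ws)"
  have Sb: "u < 2 ^ al" "u \<noteq> 0" if "u \<in> S" for u
    using that shingle_num_bounds(1,2)[of ws] ws unfolding S_def shingle_nums_def strings_def by (auto simp: Suc_le_eq subset_iff)
  have cS: "card S \<le> m" unfolding S_def using card_length[of "shingle_nums F n c ws"] by (simp add: shingle_nums_def)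
  have finS: "finite S" unfolding S_def by simp
  \<comment> \<open>The element 0 in the second component takes care of shingles with hash value
    0.\<close>
  define Q where "Q = {x \<in> S \<times> insert 0 S. fst x \<noteq> snd x}"
  have finQ: "finite Q" unfolding Q_def using finS by simp
  let ?C = "\<lambda>x. {a. a < q \<and> hash_val d0 f0 d L a (fst x) = hash_val d0 f0 d L a (snd x)}"
  have "{a. a < q \<and> \<not> good_hash d0 f0 d L (shingle_nums F n c ws) a} \<subseteq> (\<Union>x\<in>Q. ?C x)"
  proof
    fix a assume "a \<in> {a. a < q \<and> \<not> good_hash d0 f0 d L (shingle_nums F n c ws) a}"
    then have a: "a < q" "\<not> good_hash d0 f0 d L (shingle_nums F n c ws) a" by auto
    then consider u where "u \<in> S" "hash_val d0 f0 d L a u = 0" | u v where "u \<in> S" "v \<in> S" "u \<noteq> v" "hash_val d0 f0 d L a u = hash_val d0 f0 d L a v"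
      unfolding good_hash_def S_def by blast
    then show "a \<in> (\<Union>x\<in>Q. ?C x)"
    proof cases
      case (1 u)
      then have "(u, 0) \<in> Q" using Sb unfolding Q_def by auto
      then show ?thesis using 1 a hash_val_0 by force
    next
      case (2 u v)
      then have "(u, v) \<in> Q" unfolding Q_def by auto
      then show ?thesis using 2 a by force
    qed
  qed
  then have "card {a. a < q \<and> \<not> good_hash d0 f0 d L (shingle_nums F n c ws) a} \<le> card (\<Union>x\<in>Q. ?C x)"
    using finQ by (intro card_mono) auto
  also have "\<dots> \<le> (\<Sum>x\<in>Q. card (?C x))" by (rule card_UN_le[OF finQ])
  also have "\<dots> \<le> (\<Sum>x\<in>Q. L)"
  proof (intro sum_mono hash_collisions)
    fix x assume "x \<in> Q"
    then show "fst x < 2 ^ al" "snd x < 2 ^ al" "fst x \<noteq> snd x" using Sb unfolding Q_def by auto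
  qed
  also have "\<dots> = card Q * L" by simp
  also have "card Q \<le> card (S \<times> insert 0 S)" unfolding Q_def using finS by (intro card_mono) auto
  also have "\<dots> \<le> m * (m + 1)" unfolding card_cartesian_product
    using cS card_insert_le_m1[of "m + 1" S 0] by (intro mult_le_mono) auto
  finally show ?thesis unfolding J0_def by simp
qed

lemma J0_bound: "J0 * (J0 + 1) * m ^ 2 \<le> q"
proof (cases "L = 0")
  case True
  then show ?thesis by (simp add: J0_def)
next
  case False
  let ?x = "2 * n * al + 1"
  have "1 \<le> al" using al_pos by simp
  have mn: "m \<le> n" "m + 1 \<le> 2 * n" using c cn by auto
  have "L \<le> L * d" using d_pos by simp
  then have "L \<le> al" using split by linarith
  \<comment> \<open>From \<open>m \<le> n\<close>, \<open>m + 1 \<le> 2 * n\<close> and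
    \<open>L \<le> al\<close>; this yields the square that the field size was chosen for.\<close>
  then have "J0 \<le> n * (2 * n) * al" unfolding J0_def using mn by (intro mult_le_mono) auto
  also have "\<dots> \<le> (2 * n * al) * (2 * n * al)" using \<open>1 \<le> al\<close> by (simp add: algebra_simps)
  finally have 1: "J0 \<le> (2 * n * al) ^ 2" by (simp add: power2_eq_square)
  then have 2: "J0 + 1 \<le> ?x ^ 2" by (simp add: power2_eq_square)
  have "n \<le> n * al" using \<open>1 \<le> al\<close> by simp
  then have "m \<le> ?x" using mn(1) unfolding mult.assoc by linarith
  then have 3: "m ^ 2 \<le> ?x ^ 2" by (rule power_mono) simp
  have "J0 * (J0 + 1) * m ^ 2 \<le> ?x ^ 2 * ?x ^ 2 * ?x ^ 2" using 2 3 by (intro mult_le_mono) auto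
  also have "\<dots> = ?x ^ 6" by (simp add: power_add[symmetric])
  also have "\<dots> \<le> 2 ^ d" using pow_d by simp
  also have "\<dots> \<le> q" using d_le_d0 False by (intro power_increasing) auto
  finally show ?thesis .
qed

lemma J0_less: "J0 < q"
proof (cases "J0 = 0")
  case False
  have "J0 * 2 * 1 \<le> J0 * (J0 + 1) * m ^ 2" using False by (intro mult_le_mono) auto
  then show ?thesis using J0_bound False by linarith
qed simp

text \<open>At most \<open>J0\<close> coins are bad, so one of the \<open>J0 + 1\<close> coins up to
  \<open>J0\<close> is good, and the search returns the first good one.\<close>

lemma pick_hash:
  assumes ws: "ws \<in> strings" and a: "a < q"
  shows "good_hash d0 f0 d L (shingle_nums F n c ws) (pick_hash d0 f0 d L (shingle_nums F n c ws) a)" "pick_hash d0 f0 d L (shingle_nums F n c ws) a < q"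
    "\<not> good_hash d0 f0 d L (shingle_nums F n c ws) a \<Longrightarrow> pick_hash d0 f0 d L (shingle_nums F n c ws) a \<le> J0"
proof -
  let ?g = "good_hash d0 f0 d L (shingle_nums F n c ws)"
  have "\<exists>b\<le>J0. ?g b"
  proof (rule ccontr)
    assume "\<not> ?thesis"
    then have "{..J0} \<subseteq> {a. a < q \<and> \<not> ?g a}" using J0_less by auto
    then have "card {..J0} \<le> card {a. a < q \<and> \<not> ?g a}" by (intro card_mono) auto
    then show False using bad_count[OF ws] by simp
  qed
  then obtain b where b: "b \<le> J0" "?g b" by blast
  have bq: "b < q" using b(1) J0_less by simp
  have h: "?g (hd_or 0 (filter ?g [0..<q]))" "hd_or 0 (filter ?g [0..<q]) \<le> b"
    using hd_or_filter[of b "[0..<q]" ?g 0] b(2) bq hd_or_filter_upt_le[of b q ?g] by auto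
  then show "?g (pick_hash d0 f0 d L (shingle_nums F n c ws) a)" "pick_hash d0 f0 d L (shingle_nums F n c ws) a < q"
    "\<not> ?g a \<Longrightarrow> pick_hash d0 f0 d L (shingle_nums F n c ws) a \<le> J0"
    using a b bq unfolding pick_hash_def by auto
qed

text \<open>Two different blocks cannot both have the last rank if all shingles are different. The list of ranks
  that this excludes leaves room for the cases in which bad coins are replaced.\<close>

definition "RK = {l. set l \<subseteq> {..<m} \<and> length l = N} - (\<lambda>l. (m - 1) # (m - 1) # l) ` {l. set l \<subseteq> {..<m} \<and> length l = N - 2}"
definition "rests dl = (\<lambda>(x, y, z). x @ y @ z) ` (RK \<times> {l. set l \<subseteq> {..<q} \<and> length l = dl} \<times> {l. set l \<subseteq> {..<2 ^ d} \<and> length l = L * dl})"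

lemma finite_lists: "finite {l. set l \<subseteq> {..<(k::nat)} \<and> length l = j}"
  using finite_lists_length_eq[of "{..<k}" j] by simp

lemma card_lists: "card {l. set l \<subseteq> {..<(k::nat)} \<and> length l = j} = k ^ j"
  using card_lists_length_eq[of "{..<k}" j] by simp

lemma finite_rests: "finite (rests dl)"
  unfolding rests_def RK_def using finite_lists by auto

lemma N2: "c < n \<Longrightarrow> 2 \<le> N"
  using blk[of c] c by simp

lemma card_rests:
  assumes "c < n" shows "real (card (rests dl)) \<le> real m ^ (N - 2) * (real m ^ 2 - 1) * 2 ^ (al * dl)"
proof -
  have sub: "(\<lambda>l. (m - 1) # (m - 1) # l) ` {l. set l \<subseteq> {..<m} \<and> length l = N - 2} \<subseteq> {l. set l \<subseteq> {..<m} \<and> length l = N}"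
    using N2[OF assms] by auto
  have "card ((\<lambda>l. (m - 1) # (m - 1) # l) ` {l. set l \<subseteq> {..<m} \<and> length l = N - 2}) = m ^ (N - 2)"
    by (subst card_image) (auto simp: card_lists intro: inj_onI)
  then have "card RK = m ^ N - m ^ (N - 2)"
    unfolding RK_def using sub finite_lists by (subst card_Diff_subset) (auto simp: card_lists dest: finite_subset)
  then have "real (card RK) = real m ^ N - real m ^ (N - 2)"
    using power_increasing[of "N - 2" N m] by (simp add: of_nat_diff)
  also have "N = (N - 2) + 2" using N2[OF assms] by simp
  then have "real m ^ N = real m ^ (N - 2) * real m ^ 2" by (metis power_add)
  finally have RK: "real (card RK) = real m ^ (N - 2) * (real m ^ 2 - 1)" by (simp add: algebra_simps)
  have "card (rests dl) \<le> card (RK \<times> {l. set l \<subseteq> {..<q} \<and> length l = dl} \<times> {l. set l \<subseteq> {..<(2::nat) ^ d} \<and> length l = L * dl})"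
    unfolding rests_def RK_def using finite_lists by (intro card_image_le) auto
  also have "\<dots> = card RK * (q ^ dl * (2 ^ d) ^ (L * dl))" by (simp add: card_cartesian_product card_lists)
  \<comment> \<open>Here the splitting \<open>al = d0 + L * d\<close> gives exactly
    \<open>al\<close> bits per unit of the difference.\<close>
  also have "q ^ dl * (2 ^ d) ^ (L * dl) = 2 ^ (al * dl)"
    unfolding split by (simp add: power_mult[symmetric] power_add[symmetric] algebra_simps)
  finally have "real (card (rests dl)) \<le> real (card RK * 2 ^ (al * dl))" by (rule of_nat_mono)
  then show ?thesis using RK by simp
qed

lemma sk_core_rests:
  assumes ws: "ws \<in> strings" and cn': "c < n" and good: "good_hash d0 f0 d L (shingle_nums F n c ws) a"
  shows "\<exists>r\<in>rests dl. sk_core F n c dl d0 f0 d f L ws a = a # r"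
proof -
  define xs where "xs = shingle_nums F n c ws"
  define G where "G = hash_set d0 f0 d L a xs"
  define rk where "rk = ranks F n c d0 f0 d L a ws G"
  let ?u = "\<lambda>b. shingle_num F c ws (block_pos n c b)"
  have lenG: "length G \<le> m" using hash_set_length[of a ws] unfolding G_def xs_def .
  have ux: "?u b \<in> set xs" for b unfolding xs_def by (rule shingle_nums_nth) (simp add: block_pos_def)
  have rkb: "\<exists>r<length G. rk ! b = r \<and> G ! r = hash_val d0 f0 d L a (?u b)" if "b < N" for b
  proof -
    have "hash_val d0 f0 d L a (?u b) \<in> set G" using ux good unfolding G_def hash_set_props good_hash_def xs_def by auto
    then obtain r where r: "r < length G" "G ! r = hash_val d0 f0 d L a (?u b)" by (auto simp: in_set_conv_nth)
    have "rk ! b = length (filter (\<lambda>v. v < G ! r) G)" unfolding rk_def ranks_def r(2) using that by simp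
    also have "\<dots> = r" by (rule rank_nth[OF _ _ r(1)]) (auto simp: G_def hash_set_props)
    finally show ?thesis using r by blast
  qed
  have lrk: "length rk = N" unfolding rk_def ranks_def by simp
  have "set rk \<subseteq> {..<m}" using rkb lenG lrk by (fastforce simp: in_set_conv_nth)
  \<comment> \<open>A rank of \<open>m - 1\<close> means that there are \<open>m\<close> hash
    values, so no shingle occurs twice. Equal ranks would make the first two blocks equal shingles,
    although they start at the different positions 0 and \<open>min c (n - c)\<close>.\<close>
  moreover have "rk \<notin> (\<lambda>l. (m - 1) # (m - 1) # l) ` Xs" for Xs
  proof
    assume "rk \<in> (\<lambda>l. (m - 1) # (m - 1) # l) ` Xs"
    then have 01: "rk ! 0 = m - 1" "rk ! 1 = m - 1" by auto
    obtain r0 where r0: "r0 < length G" "rk ! 0 = r0" "G ! r0 = hash_val d0 f0 d L a (?u 0)" using rkb[of 0] N2[OF cn'] by auto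
    obtain r1 where r1: "r1 < length G" "rk ! 1 = r1" "G ! r1 = hash_val d0 f0 d L a (?u 1)" using rkb[of 1] N2[OF cn'] by auto
    have "?u 0 = ?u 1" using r0 r1 01 good ux[of 0] ux[of 1] unfolding good_hash_def xs_def by auto
    have "length G = card (set G)" by (simp add: G_def distinct_card hash_set_props(2))
    also have "\<dots> \<le> card (hash_val d0 f0 d L a ` set xs)" unfolding G_def hash_set_props by (intro card_mono) auto
    also have "\<dots> \<le> card (set xs)" by (rule card_image_le) simp
    finally have "length xs \<le> card (set xs)" using r0(1,2) 01(1) by (simp add: xs_def shingle_nums_def)
    then have "distinct xs" using card_length[of xs] by (intro card_distinct) simp
    moreover have "block_pos n c 0 < length xs" "block_pos n c 1 < length xs" by (auto simp: block_pos_def xs_def shingle_nums_def)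
    moreover have "xs ! block_pos n c 0 = xs ! block_pos n c 1" using \<open>?u 0 = ?u 1\<close> calculation unfolding xs_def shingle_nums_def by (simp del: upt_Suc)
    ultimately have "block_pos n c 0 = block_pos n c 1" by (simp add: nth_eq_iff_index_eq)
    then show False using c cn' by (simp add: block_pos_def)
  qed
  ultimately have "rk \<in> RK" using lrk unfolding RK_def by blast
  moreover have "bch_syndromes d0 f0 dl G \<in> {l. set l \<subseteq> {..<q} \<and> length l = dl}"
    unfolding bch_syndromes_def power_sum_def using fsum_less by auto
  moreover have "rs_syndromes d f d0 dl L ys \<in> {l. set l \<subseteq> {..<2 ^ d} \<and> length l = L * dl}" for ys
    unfolding rs_syndromes_def rs_syndrome_def using fsum_less by (auto simp: length_concat o_def sum_list_triv)
  ultimately show ?thesis unfolding rests_def sk_core_def rk_def G_def xs_def by force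
qed

lemma rests_bits:
  assumes "r \<in> rests dl" "x \<in> set r" shows "x < 2 ^ num_width F n d0"
proof -
  have "m \<le> 2 ^ n" using c cn less_exp[of n] by linarith
  also have "\<dots> \<le> 2 ^ num_width F n d0" by (intro power_increasing) (auto simp: num_width_def)
  finally have 1: "m \<le> 2 ^ num_width F n d0" .
  have 2: "q \<le> 2 ^ num_width F n d0" by (intro power_increasing) (auto simp: num_width_def)
  have 3: "2 ^ d \<le> q" if "0 < L" using d_le_d0[OF that] by (intro power_increasing) auto
  obtain k b y where r: "r = k @ b @ y" "k \<in> RK" "set b \<subseteq> {..<q}" "set y \<subseteq> {..<2 ^ d}" "length y = L * dl"
    using assms(1) unfolding rests_def by auto
  consider "x \<in> set k" | "x \<in> set b" | "x \<in> set y" using assms(2) r(1) by auto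
  then show ?thesis
  proof cases
    case 1
    then have "x < m" using r(2) unfolding RK_def by auto
    then show ?thesis using \<open>m \<le> 2 ^ num_width F n d0\<close> by linarith
  next
    case 2
    then have "x < q" using r(3) by auto
    then show ?thesis using \<open>q \<le> 2 ^ num_width F n d0\<close> by linarith
  next
    case x: 3
    then have "0 < L" using r(5) by (cases L) auto
    then show ?thesis using r(4) x 2 3 by (meson lessThan_iff less_le_trans subsetD)
  qed
qed

lemma recover_correct:
  assumes ws: "ws \<in> strings" and card: "card (sdiff (set (shingle_nums F n c ws)) (set (shingle_nums F n c ws'))) \<le> (2 * c - 1) * t"
    and t0: "t = 0 \<Longrightarrow> ws' = ws" and a: "a < q"
  shows "recover_mod F n c t d0 d ws' (sketch F n c t d0 d ws a) = ws"
proof -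
  have wsF: "x < F" if "x \<in> set ws" for x using ws that unfolding strings_def by auto
  have len: "length ws = n" using ws unfolding strings_def by simp
  have "recover F n c t d0 d ws' (sketch F n c t d0 d ws a) = ws"
  proof (cases "t = 0 \<or> n \<le> (2 * c - 1) * t")
    case True
    have "get_num (num_width F n d0) (to_bits (num_width F n d0) ws) i = ws ! i" if "i < n" for i
    proof (rule get_num_to_bits)
      have "ws ! i < F" using wsF that len by simp
      also have "F < 2 ^ floorlog 2 F" by (rule less_two_power_floorlog)
      also have "\<dots> \<le> 2 ^ num_width F n d0" by (intro power_increasing) (auto simp: num_width_def)
      finally show "ws ! i < 2 ^ num_width F n d0" .
    qed (use that len in simp)
    then have "map (get_num (num_width F n d0) (to_bits (num_width F n d0) ws)) [0..<n] = ws" using len by (intro nth_equalityI) auto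
    then show ?thesis using True t0 unfolding recover_def sketch_def sk_nums_def by auto
  next
    case False
    then have t: "t \<noteq> 0" "\<not> n \<le> (2 * c - 1) * t" by auto
    then have "2 * c - 1 \<le> (2 * c - 1) * t" by simp
    then have cn': "c < n" using t c by linarith
    define dl where "dl = (2 * c - 1) * t"
    have dl: "min ((2 * c - 1) * t) n = dl" using t unfolding dl_def by simp
    define b where "b = pick_hash d0 f0 d L (shingle_nums F n c ws) a"
    have good: "good_hash d0 f0 d L (shingle_nums F n c ws) b" and bq: "b < q" unfolding b_def using pick_hash[OF ws a] by auto
    obtain r where r: "r \<in> rests dl" "sk_core F n c dl d0 f0 d f L ws b = b # r" using sk_core_rests[OF ws cn' good] by blast
    have "q \<le> 2 ^ num_width F n d0" by (intro power_increasing) (auto simp: num_width_def)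
    then have bits: "x < 2 ^ num_width F n d0" if "x \<in> set (sk_core F n c dl d0 f0 d f L ws b)" for x
      using that rests_bits[OF r(1)] less_le_trans[OF bq] unfolding r(2) by auto
    have Lf: "num_layers (shingle_bits F c) d = L" "gfmod d0 = f0" "gfmod d = f" unfolding L_def al_def f0_def f_def by auto
    have s: "sketch F n c t d0 d ws a = to_bits (num_width F n d0) (sk_core F n c dl d0 f0 d f L ws b)"
      unfolding sketch_def sk_nums_def sk_main_def Lf dl b_def using t by simp
    have "get_num (num_width F n d0) (sketch F n c t d0 d ws a) 0 = b"
      using get_num_to_bits[of 0 "sk_core F n c dl d0 f0 d f L ws b" "num_width F n d0"] bits unfolding s r(2) by simp
    then have g: "get_num (num_width F n d0) (sketch F n c t d0 d ws a) 0 mod 2 ^ d0 = b" using bq by simp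
    have "recover F n c t d0 d ws' (sketch F n c t d0 d ws a) =
      rc1 F n c dl d0 f0 d f L (num_width F n d0) (sketch F n c t d0 d ws a) b (shingle_nums F n c ws')"
      unfolding recover_def Lf dl g using t by simp
    also have "\<dots> = ws" unfolding s
      by (rule rc1_correct[OF wsF len good]) (use card bits in \<open>auto simp: dl_def\<close>)
    finally show ?thesis .
  qed
  moreover have "map (\<lambda>v. v mod F) ws = ws" using wsF by (intro map_idI) auto
  ultimately show ?thesis unfolding recover_mod_def by simp
qed

definition "sketch_dist t ws = map_pmf (\<lambda>a. sketch F n c t d0 d ws a) (pmf_of_set {..<q})"

text \<open>Good coins occur in the sketch unchanged and have probability \<open>1 / q\<close>. Bad coins are replaced by
  one of the values up to \<open>J0\<close>, which adds at most the probability \<open>J0 / q\<close> of bad coins to each of these.\<close>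

lemma leak_main:
  assumes t: "t \<noteq> 0" "\<not> n \<le> (2 * c - 1) * t"
  shows "\<exists>T \<mu>. finite T \<and> (\<forall>s. 0 \<le> \<mu> s) \<and> (\<forall>ws\<in>strings. set_pmf (sketch_dist t ws) \<subseteq> T \<and> (\<forall>s. pmf (sketch_dist t ws) s \<le> \<mu> s)) \<and>
     sum \<mu> T \<le> real m ^ N * 2 ^ (al * ((2 * c - 1) * t))"
proof -
  \<comment> \<open>In this case \<open>c < n\<close>, so there are at least two blocks and the
    excluded rank lists exist.\<close>
  have "2 * c - 1 \<le> (2 * c - 1) * t" using t by simp
  then have cn': "c < n" using t c by linarith
  define dl where "dl = (2 * c - 1) * t"
  have dl: "min ((2 * c - 1) * t) n = dl" using t unfolding dl_def by simp
  have Lf: "num_layers (shingle_bits F c) d = L" "gfmod d0 = f0" "gfmod d = f" unfolding L_def al_def f0_def f_def by auto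
  define Y where "Y = {..<q} \<times> rests dl"
  have finY: "finite Y" unfolding Y_def using finite_rests by simp
  define h where "h x = to_bits (num_width F n d0) (fst x # snd x)" for x
  define \<beta> where "\<beta> = real J0 / real q"
  define v where "v x = 1 / real q + (if fst x \<le> J0 then \<beta> else 0)" for x :: "nat \<times> nat list"
  have \<beta>0: "0 \<le> \<beta>" unfolding \<beta>_def by simp
  have v0: "0 \<le> v x" for x unfolding v_def using \<beta>0 by simp
  \<comment> \<open>Summation over all preimages under \<open>h\<close> makes the sum of
    \<open>\<mu>\<close> equal to that of \<open>v\<close> whether or not \<open>h\<close> is
    injective.\<close>
  define \<mu> where "\<mu> s = (\<Sum>x\<in>{x \<in> Y. h x = s}. v x)" for s
  define T where "T = h ` Y"
  have key: "set_pmf (sketch_dist t ws) \<subseteq> T \<and> (\<forall>s. pmf (sketch_dist t ws) s \<le> \<mu> s)" if ws: "ws \<in> strings" for ws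
  proof -
    let ?good = "good_hash d0 f0 d L (shingle_nums F n c ws)"
    let ?pick = "pick_hash d0 f0 d L (shingle_nums F n c ws)"
    obtain r where r: "\<And>b. ?good b \<Longrightarrow> r b \<in> rests dl \<and> sk_core F n c dl d0 f0 d f L ws b = b # r b"
      using sk_core_rests[OF ws cn', of _ dl] by metis
    define g where "g a = sketch F n c t d0 d ws a" for a
    have g: "g a = h (?pick a, r (?pick a))" "(?pick a, r (?pick a)) \<in> Y" if "a < q" for a
    proof -
      show "g a = h (?pick a, r (?pick a))"
        unfolding g_def sketch_def sk_nums_def sk_main_def Lf dl h_def using t r[OF pick_hash(1)[OF ws that]] by simp
      show "(?pick a, r (?pick a)) \<in> Y" using pick_hash[OF ws that] r unfolding Y_def by simp
    qed
    have SS: "sketch_dist t ws = map_pmf g (pmf_of_set {..<q})" unfolding sketch_dist_def g_def ..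
    have ne: "{..<q} \<noteq> {}" "finite {..<q}" using J0_less by auto
    have "set_pmf (sketch_dist t ws) \<subseteq> T" unfolding SS T_def using g by (auto simp: set_pmf_of_set[OF ne])
    moreover have "pmf (sketch_dist t ws) s \<le> \<mu> s" for s
    proof -
      let ?A = "{a. a < q \<and> ?good a \<and> g a = s}" and ?B = "{a. a < q \<and> \<not> ?good a \<and> g a = s}"
      let ?Ys = "{x \<in> Y. h x = s}"
      have finYs: "finite ?Ys" using finY by simp
      have "pmf (sketch_dist t ws) s = real (card ({..<q} \<inter> g -` {s})) / real q"
        unfolding SS pmf_map by (simp add: measure_pmf_of_set[OF ne])
      also have "{..<q} \<inter> g -` {s} = ?A \<union> ?B" by auto
      also have "card (?A \<union> ?B) = card ?A + card ?B" by (intro card_Un_disjoint) auto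
      also have "real (card ?A + card ?B) / real q = real (card ?A) / real q + real (card ?B) / real q" by (simp add: add_divide_distrib)
      also have "\<dots> \<le> real (card ?Ys) / real q + (\<Sum>x\<in>?Ys. if fst x \<le> J0 then \<beta> else 0)"
      proof (rule add_mono)
        have "(\<lambda>a. (a, r a)) ` ?A \<subseteq> ?Ys"
        proof clarify
          fix a assume a: "a < q" "?good a" "s = g a"
          then have "?pick a = a" unfolding pick_hash_def by simp
          then show "(a, r a) \<in> Y \<and> h (a, r a) = g a" using g[OF a(1)] by simp
        qed
        then have "card ?A \<le> card ?Ys" using finYs by (intro card_inj_on_le[of "\<lambda>a. (a, r a)"]) (auto intro: inj_onI)
        then show "real (card ?A) / real q \<le> real (card ?Ys) / real q" by (simp add: divide_right_mono)
        show "real (card ?B) / real q \<le> (\<Sum>x\<in>?Ys. if fst x \<le> J0 then \<beta> else 0)"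
        proof (cases "?B = {}")
          case True
          show ?thesis unfolding True using \<beta>0 by (simp add: sum_nonneg)
        next
          case False
          then obtain a where a: "a < q" "\<not> ?good a" "g a = s" by auto
          \<comment> \<open>All bad coins that lead to \<open>s\<close> are charged at once to this
            preimage of \<open>s\<close>, whose coins are at most \<open>J0\<close>.\<close>
          define x0 where "x0 = (?pick a, r (?pick a))"
          have x0: "x0 \<in> ?Ys" "fst x0 \<le> J0" using g[OF a(1)] a(3) pick_hash(3)[OF ws a(1,2)] unfolding x0_def by auto
          have "card ?B \<le> card {a. a < q \<and> \<not> ?good a}" by (intro card_mono) auto
          then have "real (card ?B) \<le> real J0" using bad_count[OF ws] by simp
          then have "real (card ?B) / real q \<le> \<beta>" unfolding \<beta>_def by (simp add: divide_right_mono)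
          also have "\<beta> = (\<Sum>x\<in>{x0}. if fst x \<le> J0 then \<beta> else 0)" using x0(2) by simp
          also have "\<dots> \<le> (\<Sum>x\<in>?Ys. if fst x \<le> J0 then \<beta> else 0)"
            using x0(1) finYs \<beta>0 by (intro sum_mono2) auto
          finally show ?thesis .
        qed
      qed
      also have "\<dots> = \<mu> s" unfolding \<mu>_def v_def by (simp add: sum.distrib)
      finally show ?thesis .
    qed
    ultimately show ?thesis by blast
  qed
  have "sum \<mu> T = sum v Y" unfolding \<mu>_def T_def using finY by (intro sum.group) auto
  also have "\<dots> = real (card Y) / real q + (\<Sum>x\<in>Y. if fst x \<le> J0 then \<beta> else 0)" unfolding v_def by (simp add: sum.distrib)
  also have "real (card Y) / real q = real (card (rests dl))" unfolding Y_def by (simp add: card_cartesian_product)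
  also have "(\<Sum>x\<in>Y. if fst x \<le> J0 then \<beta> else 0) = (\<Sum>x\<in>{..J0} \<times> rests dl. \<beta>)"
    using finY J0_less by (intro sum.mono_neutral_cong_right) (auto simp: Y_def)
  also have "\<dots> = real (card (rests dl)) * (\<beta> * (real J0 + 1))"
    by (simp add: card_cartesian_product algebra_simps)
  also have "real (card (rests dl)) + \<dots> = real (card (rests dl)) * (1 + \<beta> * (real J0 + 1))" by (simp add: algebra_simps)
  also have "\<dots> \<le> (real m ^ (N - 2) * (real m ^ 2 - 1) * 2 ^ (al * dl)) * (1 + \<beta> * (real J0 + 1))"
    using card_rests[OF cn'] \<beta>0 by (intro mult_right_mono) auto
  also have "\<dots> = (real m ^ (N - 2) * 2 ^ (al * dl)) * ((real m ^ 2 - 1) * (1 + \<beta> * (real J0 + 1)))" by (simp add: algebra_simps)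
  also have "\<dots> \<le> (real m ^ (N - 2) * 2 ^ (al * dl)) * real m ^ 2"
  \<comment> \<open>If \<open>x * m ^ 2 \<le> 1\<close>, then (m^2 - 1)(1 + x) = m^2 - 1 + x m^2 - x
    is at most m^2: the excluded rank lists make up for the replaced coins.\<close>
  proof (rule mult_left_mono)
    have "real (J0 * (J0 + 1) * m ^ 2) \<le> real q" using J0_bound by (rule of_nat_mono)
    then have "\<beta> * (real J0 + 1) * real m ^ 2 \<le> 1" unfolding \<beta>_def by (simp add: divide_le_eq algebra_simps)
    moreover have "0 \<le> \<beta> * (real J0 + 1)" using \<beta>0 by simp
    ultimately show "(real m ^ 2 - 1) * (1 + \<beta> * (real J0 + 1)) \<le> real m ^ 2" by (simp add: algebra_simps)
  qed simp
  also have "\<dots> = real m ^ N * 2 ^ (al * dl)"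
  proof -
    have "N = (N - 2) + 2" using N2[OF cn'] by simp
    then have "real m ^ N = real m ^ (N - 2) * real m ^ 2" by (metis power_add)
    then show ?thesis by simp
  qed
  finally have "sum \<mu> T \<le> real m ^ N * 2 ^ (al * dl)" .
  moreover have "finite T" unfolding T_def using finY by simp
  moreover have "0 \<le> \<mu> s" for s unfolding \<mu>_def by (intro sum_nonneg v0)
  ultimately show ?thesis using key unfolding dl_def by blast
qed

lemma leak:
  "\<exists>T \<mu>. finite T \<and> (\<forall>s. 0 \<le> \<mu> s) \<and> (\<forall>ws\<in>strings. set_pmf (sketch_dist t ws) \<subseteq> T \<and> (\<forall>s. pmf (sketch_dist t ws) s \<le> \<mu> s)) \<and>
     sum \<mu> T \<le> real m ^ N * 2 ^ (al * ((2 * c - 1) * t))"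
proof (cases "t \<noteq> 0 \<and> \<not> n \<le> (2 * c - 1) * t")
  case True
  then show ?thesis using leak_main by blast
next
  \<comment> \<open>The sketch does not depend on the coins here, so counting its values suffices,
    with the trivial bound 1 for every probability.\<close>
  case False
  define Xs where "Xs = (if t = 0 then {[]} else strings)"
  define T where "T = to_bits (num_width F n d0) ` Xs"
  have fin: "finite Xs" unfolding Xs_def strings_def using finite_lists by simp
  have m1: "1 \<le> real m ^ N" by (intro one_le_power) simp
  have "card Xs \<le> 2 ^ (al * ((2 * c - 1) * t))"
  proof (cases "t = 0")
    case False
    have "F = F ^ 1" by simp
    also have "F ^ 1 \<le> F ^ c" using F c by (intro power_increasing) auto
    also have "\<dots> \<le> 2 ^ al" using pow_less by simp
    finally have "F ^ n \<le> (2 ^ al) ^ n" by (rule power_mono) simp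
    also have "\<dots> = 2 ^ (al * n)" by (simp add: power_mult)
    also have "\<dots> \<le> 2 ^ (al * ((2 * c - 1) * t))"
      using False \<open>\<not> (t \<noteq> 0 \<and> \<not> n \<le> (2 * c - 1) * t)\<close> by (intro power_increasing mult_left_mono) auto
    finally show ?thesis using False by (simp add: Xs_def strings_def card_lists)
  qed (simp add: Xs_def)
  then have "card T \<le> 2 ^ (al * ((2 * c - 1) * t))" unfolding T_def using card_image_le[OF fin] le_trans by blast
  then have "real (card T) \<le> 2 ^ (al * ((2 * c - 1) * t))" by (metis of_nat_le_iff of_nat_numeral of_nat_power)
  also have "\<dots> \<le> real m ^ N * 2 ^ (al * ((2 * c - 1) * t))" using mult_right_mono[OF m1, of "2 ^ (al * ((2 * c - 1) * t))"] by simp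
  finally have "sum (\<lambda>_. 1 :: real) T \<le> real m ^ N * 2 ^ (al * ((2 * c - 1) * t))" by simp
  moreover have "set_pmf (sketch_dist t ws) \<subseteq> T" if "ws \<in> strings" for ws
    using False that unfolding sketch_dist_def sketch_def sk_nums_def T_def Xs_def by auto
  moreover have "finite T" unfolding T_def using fin by simp
  ultimately show ?thesis by (intro exI[of _ T] exI[of _ "\<lambda>_. 1"]) (simp add: pmf_le_1)
qed

end

section \<open>Uniformly distributed coins\<close>

text \<open>The time bound holds for every outcome and not just on average, so bounds simply add up
  under composition; the expectation is bounded as a consequence.\<close>

definition bounded_run :: "('a \<times> nat) spmf \<Rightarrow> 'a pmf \<Rightarrow> nat \<Rightarrow> bool" where
  "bounded_run S \<mu> B \<longleftrightarrow> (\<exists>p. S = spmf_of_pmf p \<and> map_pmf fst p = \<mu> \<and> (\<forall>x\<in>set_pmf p. snd x \<le> B))"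

lemma bounded_run_return: "k \<le> B \<Longrightarrow> bounded_run (return_spmf (y, k)) (return_pmf y) B"
  unfolding bounded_run_def by (intro exI[of _ "return_pmf (y, k)"]) simp

lemma bounded_run_mono: "bounded_run S \<mu> B \<Longrightarrow> B \<le> C \<Longrightarrow> bounded_run S \<mu> C"
  unfolding bounded_run_def by (metis le_trans)

lemma bounded_run_bind:
  assumes S: "bounded_run S \<mu> B" and K: "\<And>y. y \<in> set_pmf \<mu> \<Longrightarrow> bounded_run (K y) (\<nu> y) C"
  shows "bounded_run (bind_spmf S (\<lambda>(y, i). bind_spmf (K y) (\<lambda>(z, j). return_spmf (g y z, a + i + j))))
     (bind_pmf \<mu> (\<lambda>y. map_pmf (g y) (\<nu> y))) (a + B + C)"
proof -
  obtain p where p: "S = spmf_of_pmf p" "map_pmf fst p = \<mu>" "\<And>x. x \<in> set_pmf p \<Longrightarrow> snd x \<le> B"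
    using S unfolding bounded_run_def by blast
  obtain k where k: "\<And>y. y \<in> set_pmf \<mu> \<Longrightarrow> K y = spmf_of_pmf (k y) \<and> map_pmf fst (k y) = \<nu> y \<and> (\<forall>x\<in>set_pmf (k y). snd x \<le> C)"
    using K unfolding bounded_run_def by metis
  have mem: "fst x \<in> set_pmf \<mu>" if "x \<in> set_pmf p" for x using that p(2) by auto
  let ?r = "bind_pmf p (\<lambda>x. map_pmf (\<lambda>z. (g (fst x) (fst z), a + snd x + snd z)) (k (fst x)))"
  have "bind_spmf S (\<lambda>(y, i). bind_spmf (K y) (\<lambda>(z, j). return_spmf (g y z, a + i + j))) = spmf_of_pmf ?r"
    unfolding p(1) bind_spmf_of_pmf spmf_of_pmf_bind
  proof (rule bind_pmf_cong[OF refl])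
    fix x assume "x \<in> set_pmf p"
    then have "K (fst x) = spmf_of_pmf (k (fst x))" using k mem by blast
    then show "(case x of (y, i) \<Rightarrow> bind_spmf (K y) (\<lambda>(z, j). return_spmf (g y z, a + i + j))) =
       spmf_of_pmf (map_pmf (\<lambda>z. (g (fst x) (fst z), a + snd x + snd z)) (k (fst x)))"
      by (simp add: case_prod_unfold bind_pmf_return_spmf)
  qed
  moreover have "map_pmf fst ?r = bind_pmf \<mu> (\<lambda>y. map_pmf (g y) (\<nu> y))"
  proof -
    have "map_pmf fst ?r = bind_pmf p (\<lambda>x. map_pmf (g (fst x)) (map_pmf fst (k (fst x))))"
      by (simp add: map_bind_pmf pmf.map_comp o_def)
    also have "\<dots> = bind_pmf p (\<lambda>x. map_pmf (g (fst x)) (\<nu> (fst x)))"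
      using k mem by (intro bind_pmf_cong) auto
    also have "\<dots> = bind_pmf \<mu> (\<lambda>y. map_pmf (g y) (\<nu> y))" unfolding p(2)[symmetric] by (simp add: bind_map_pmf)
    finally show ?thesis .
  qed
  moreover have "snd x \<le> a + B + C" if x: "x \<in> set_pmf ?r" for x
  proof -
    obtain y z where yz: "y \<in> set_pmf p" "z \<in> set_pmf (k (fst y))" "x = (g (fst y) (fst z), a + snd y + snd z)"
      using x unfolding set_bind_pmf set_map_pmf by blast
    have "snd z \<le> C" using k[OF mem[OF yz(1)]] yz(2) by blast
    then show ?thesis using p(3)[OF yz(1)] unfolding yz(3) by simp
  qed
  ultimately show ?thesis unfolding bounded_run_def by blast
qed

lemma bounded_run_unique: "bounded_run S \<mu> B \<Longrightarrow> bounded_run S \<nu> C \<Longrightarrow> \<mu> = \<nu>"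
proof -
  have "p = q" if "spmf_of_pmf p = spmf_of_pmf q" for p q :: "'x pmf"
    using that by (metis pmf_eqI spmf_spmf_of_pmf)
  then show "bounded_run S \<mu> B \<Longrightarrow> bounded_run S \<nu> C \<Longrightarrow> \<mu> = \<nu>" unfolding bounded_run_def by metis
qed

text \<open>The continuation is described in terms of the random choice \<open>r\<close> and not of
  the intermediate value \<open>h r\<close>. Where \<open>h\<close> identifies two choices, the
  distributions agree because a run determines its output distribution.\<close>

lemma bounded_run_bind':
  assumes S: "bounded_run S (map_pmf h R) B" and K: "\<And>r. r \<in> set_pmf R \<Longrightarrow> bounded_run (K (h r)) (\<nu> r) C"
  shows "bounded_run (bind_spmf S (\<lambda>(y, i). bind_spmf (K y) (\<lambda>(z, j). return_spmf (g y z, a + i + j))))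
     (bind_pmf R (\<lambda>r. map_pmf (g (h r)) (\<nu> r))) (a + B + C)"
proof -
  define \<nu>' where "\<nu>' y = (SOME \<nu>. bounded_run (K y) \<nu> C)" for y
  have 1: "bounded_run (K (h r)) (\<nu>' (h r)) C" if "r \<in> set_pmf R" for r unfolding \<nu>'_def by (rule someI) (rule K[OF that])
  then have "\<nu>' (h r) = \<nu> r" if "r \<in> set_pmf R" for r using bounded_run_unique K that by metis
  then have "bind_pmf (map_pmf h R) (\<lambda>y. map_pmf (g y) (\<nu>' y)) = bind_pmf R (\<lambda>r. map_pmf (g (h r)) (\<nu> r))"
    unfolding bind_map_pmf by (intro bind_pmf_cong) auto
  then show ?thesis using bounded_run_bind[OF S, of K \<nu>' C g a] 1 by auto
qed

text \<open>The first coin is the most significant bit, in accordance with a loop that doubles and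
  adds.\<close>

lemma unif_Suc: "pmf_of_set {..<2 ^ Suc j} =
   bind_pmf (pmf_of_set UNIV) (\<lambda>b. map_pmf (\<lambda>r. of_bool b * 2 ^ j + r) (pmf_of_set {..<(2::nat) ^ j}))"
proof (rule pmf_eqI)
  fix a :: nat
  have ne: "{..<(2::nat) ^ i} \<noteq> {}" for i by (metis lessThan_empty_iff power_not_zero bot_nat_def zero_neq_numeral)
  have "map_pmf (\<lambda>r. k + r) (pmf_of_set {..<(2::nat) ^ j}) = pmf_of_set {k..<k + 2 ^ j}" for k
  proof -
    have "(\<lambda>r. k + r) ` {..<(2::nat) ^ j} = {k..<k + 2 ^ j}"
      by (simp add: lessThan_atLeast0 image_add_atLeastLessThan add.commute)
    then show ?thesis using map_pmf_of_set_inj[of "\<lambda>r. k + r" "{..<(2::nat) ^ j}"] ne by simp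
  qed
  then have "pmf (bind_pmf (pmf_of_set UNIV) (\<lambda>b. map_pmf (\<lambda>r. of_bool b * 2 ^ j + r) (pmf_of_set {..<(2::nat) ^ j}))) a =
      (\<Sum>b\<in>UNIV. pmf (pmf_of_set {of_bool b * 2 ^ j..<of_bool b * 2 ^ j + (2::nat) ^ j}) a) / 2"
    by (simp add: pmf_bind integral_pmf_of_set sum_divide_distrib mult.commute)
  also have "\<dots> = pmf (pmf_of_set {..<2 ^ Suc j}) a"
  proof -
    have "pmf (pmf_of_set {..<2 ^ Suc j}) a = indicator {..<(2::nat) ^ Suc j} a / 2 ^ Suc j"
      using ne[of "Suc j"] by (simp add: pmf_of_set del: power_Suc)
    then show ?thesis by (simp add: UNIV_bool pmf_of_set indicator_def)
  qed
  finally show "pmf (pmf_of_set {..<2 ^ Suc j}) a =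
    pmf (bind_pmf (pmf_of_set UNIV) (\<lambda>b. map_pmf (\<lambda>r. of_bool b * 2 ^ j + r) (pmf_of_set {..<(2::nat) ^ j}))) a" ..
qed

text \<open>The list is a counter in unary, each of whose elements stands for a coin toss.\<close>

lemma coin_loop:
  fixes es :: "nat list \<times> nat \<Rightarrow> val"
  assumes Pb: "\<And>l a. Q l \<Longrightarrow> a < 2 ^ K \<Longrightarrow> \<exists>k\<le>B. run Pb (es (l, a)) = return_spmf (eB (l \<noteq> []), k)"
    and Pf: "\<And>x l a. Q (x # l) \<Longrightarrow> 2 * a + 1 < 2 ^ K \<Longrightarrow>
      bounded_run (run Pf (es (x # l, a))) (map_pmf (\<lambda>b. es (l, 2 * a + of_bool b)) (pmf_of_set UNIV)) B"
    and sz: "\<And>l a. Q l \<Longrightarrow> a < 2 ^ K \<Longrightarrow> vsize (es (l, a)) \<le> B"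
    and Q: "\<And>x l. Q (x # l) \<Longrightarrow> Q l"
  shows "Q l \<Longrightarrow> length l \<le> K \<Longrightarrow> a < 2 ^ (K - length l) \<Longrightarrow>
     bounded_run (loop (run Pb) (run Pf) (es (l, a))) (map_pmf (\<lambda>r. es ([], a * 2 ^ length l + r)) (pmf_of_set {..<2 ^ length l})) ((length l + 1) * (3 * B))"
proof (induction l arbitrary: a)
  case Nil
  then obtain k where "k \<le> B" "run Pb (es ([], a)) = return_spmf (eB False, k)" using Pb[of "[]" a] by auto
  moreover have "vsize (es ([], a)) \<le> B" using sz[of "[]" a] Nil by simp
  moreover have "pmf_of_set {..<1::nat} = return_pmf 0" by (simp add: lessThan_Suc pmf_of_set_singleton)
  ultimately show ?case by (subst loop.simps) (auto simp: eB_def intro!: bounded_run_return)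
next
  case (Cons x l)
  have aK: "a < 2 ^ K" using Cons.prems(3) by (rule less_le_trans) (intro power_increasing, auto)
  have "2 * a + 1 < 2 ^ Suc (K - length (x # l))" using Cons.prems(3) by simp
  also have "Suc (K - length (x # l)) = K - length l" using Cons.prems(2) by simp
  finally have a2: "2 * a + of_bool b < 2 ^ (K - length l)" for b by (cases b) simp_all
  have a2K: "2 * a + 1 < 2 ^ K"
  proof -
    have "2 * a + 1 < 2 ^ (K - length l)" using a2[of True] by simp
    also have "\<dots> \<le> 2 ^ K" by (intro power_increasing) auto
    finally show ?thesis .
  qed
  obtain k where k: "k \<le> B" "run Pb (es (x # l, a)) = return_spmf (eB True, k)" using Pb[of "x # l" a] Cons.prems aK by auto
  have IH: "bounded_run (loop (run Pb) (run Pf) (es (l, 2 * a + of_bool b)))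
     (map_pmf (\<lambda>r. es ([], (2 * a + of_bool b) * 2 ^ length l + r)) (pmf_of_set {..<2 ^ length l})) ((length l + 1) * (3 * B))" for b
    using Cons.IH[OF Q[OF Cons.prems(1)] _ a2] Cons.prems(2) by simp
  have "bounded_run (bind_spmf (run Pf (es (x # l, a))) (\<lambda>(y, j). bind_spmf (loop (run Pb) (run Pf) y)
       (\<lambda>(z, k'). return_spmf (z, (vsize (es (x # l, a)) + k) + j + k'))))
     (bind_pmf (pmf_of_set UNIV) (\<lambda>b. map_pmf (\<lambda>z. z)
       (map_pmf (\<lambda>r. es ([], (2 * a + of_bool b) * 2 ^ length l + r)) (pmf_of_set {..<2 ^ length l}))))
     (vsize (es (x # l, a)) + k + B + (length l + 1) * (3 * B))"
    by (rule bounded_run_bind'[OF Pf[OF Cons.prems(1) a2K]]) (rule IH)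
  moreover have "bind_spmf (run Pf (es (x # l, a))) (\<lambda>(y, j). bind_spmf (loop (run Pb) (run Pf) y)
       (\<lambda>(z, k'). return_spmf (z, (vsize (es (x # l, a)) + k) + j + k'))) = loop (run Pb) (run Pf) (es (x # l, a))"
    by (subst (2) loop.simps) (simp add: k eB_def)
  moreover have "bind_pmf (pmf_of_set UNIV) (\<lambda>b. map_pmf (\<lambda>z. z)
       (map_pmf (\<lambda>r. es ([], (2 * a + of_bool b) * 2 ^ length l + r)) (pmf_of_set {..<2 ^ length l}))) =
     map_pmf (\<lambda>r. es ([], a * 2 ^ length (x # l) + r)) (pmf_of_set {..<2 ^ length (x # l)})"
    unfolding length_Cons unif_Suc by (simp add: map_bind_pmf pmf.map_comp o_def algebra_simps)
  moreover have "vsize (es (x # l, a)) + k + B + (length l + 1) * (3 * B) \<le> (length (x # l) + 1) * (3 * B)"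
    using sz[OF Cons.prems(1) aK] k(1) by simp
  ultimately show ?case using bounded_run_mono by (metis (no_types, lifting))
qed

lemma bounded_run_Seq:
  assumes "bounded_run (run P v) (map_pmf h R) B" "\<And>r. r \<in> set_pmf R \<Longrightarrow> bounded_run (run P' (h r)) (\<nu> r) C"
  shows "bounded_run (run (Seq P P') v) (bind_pmf R \<nu>) (vsize v + B + C)"
  using bounded_run_bind'[where h = h and R = R and K = "run P'" and \<nu> = \<nu> and g = "\<lambda>y z. z" and a = "vsize v", OF assms] by simp

text \<open>The time bound depends only on an upper estimate \<open>S\<close> of the size, so it is
  uniform over all states of a loop.\<close>

lemma pt_power_bound:
  assumes "polytime e e' f"
  obtains P C where "\<And>x S. vsize (e x) \<le> S \<Longrightarrow> \<exists>k\<le>(S + 1) ^ C. run P (e x) = return_spmf (e' (f x), k)"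
proof -
  obtain P b where b: "poly_bounded e b" and P: "\<And>x. \<exists>k\<le>b x. run P (e x) = return_spmf (e' (f x), k)"
    using assms by (rule ptE) blast
  obtain C where C: "\<And>x. b x \<le> (vsize (e x) + 1) ^ C" using b unfolding poly_bounded_def by blast
  have "\<exists>k\<le>(S + 1) ^ C. run P (e x) = return_spmf (e' (f x), k)" if "vsize (e x) \<le> S" for x S
  proof -
    have "(vsize (e x) + 1) ^ C \<le> (S + 1) ^ C" using that by (intro power_mono) auto
    then have "b x \<le> (S + 1) ^ C" using C[of x] by linarith
    then show ?thesis using P[of x] by (meson le_trans)
  qed
  then show ?thesis by (rule that)
qed

text \<open>All randomness is drawn in advance by a loop that shifts \<open>k x\<close> coin tosses
  into a number; the rest is deterministic.\<close>

lemma coin_prog: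
  assumes k: "polytime e eN k" "poly_bounded e k" and h: "polytime (eP e eN) e' (\<lambda>p. h (fst p) (snd p))"
  shows "\<exists>P b. poly_bounded e b \<and> (\<forall>x. bounded_run (run P (e x)) (map_pmf (\<lambda>a. e' (h x a)) (pmf_of_set {..<2 ^ k x})) (b x))"
proof -
  let ?es = "eP (eP e (eL eN)) eN"
  have init: "polytime e ?es (\<lambda>x. ((x, [0..<k x]), 0))" by (rule pt_Pair pt_id pt_upt k pt_const_nat)+
  have cnd: "polytime ?es eB (\<lambda>p. \<not> snd (fst p) = [])" by (rule pt_not pt_null pt_snd pt_fst pt_id)+
  have nx: "polytime ?es (eP e (eL eN)) (\<lambda>p. (fst (fst p), tl (snd (fst p))))" by (rule pt_Pair pt_tl pt_snd pt_fst pt_id)+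
  have ad: "polytime (eP eN eN) eN (\<lambda>p. 2 * fst p + snd p)" by (rule pt_add pt_mult pt_const_nat pt_fst pt_snd pt_id)+
  have ac: "polytime ?es eN snd" using pt_snd[OF pt_id[of ?es]] by simp
  have "polytime ?es (eP e eN) (\<lambda>p. (fst (fst p), snd p))" by (rule pt_Pair pt_fst pt_snd pt_id)+
  from pt_comp[OF h this] have fin: "polytime ?es e' (\<lambda>p. h (fst (fst p)) (snd p))" by simp
  obtain Pi bi where bi: "poly_bounded e bi" and Pi: "\<And>x. \<exists>j\<le>bi x. run Pi (e x) = return_spmf (?es ((x, [0..<k x]), 0), j)"
    using init by (rule ptE) blast
  obtain Pb Cb where Pb: "\<And>p S. vsize (?es p) \<le> S \<Longrightarrow> \<exists>j\<le>(S + 1) ^ Cb. run Pb (?es p) = return_spmf (eB (\<not> snd (fst p) = []), j)"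
    using cnd by (rule pt_power_bound) blast
  obtain Pn Cn where Pn: "\<And>p S. vsize (?es p) \<le> S \<Longrightarrow> \<exists>j\<le>(S + 1) ^ Cn. run Pn (?es p) = return_spmf (eP e (eL eN) (fst (fst p), tl (snd (fst p))), j)"
    using nx by (rule pt_power_bound) blast
  obtain Pd Cd where Pd: "\<And>p S. vsize (eP eN eN p) \<le> S \<Longrightarrow> \<exists>j\<le>(S + 1) ^ Cd. run Pd (eP eN eN p) = return_spmf (eN (2 * fst p + snd p), j)"
    using ad by (rule pt_power_bound) blast
  obtain Pa Ca where Pa: "\<And>p S. vsize (?es p) \<le> S \<Longrightarrow> \<exists>j\<le>(S + 1) ^ Ca. run Pa (?es p) = return_spmf (eN (snd p), j)"
    using ac by (rule pt_power_bound) blast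
  obtain Pf Cf where Pf: "\<And>p S. vsize (?es p) \<le> S \<Longrightarrow> \<exists>j\<le>(S + 1) ^ Cf. run Pf (?es p) = return_spmf (e' (h (fst (fst p)) (snd p)), j)"
    using fin by (rule pt_power_bound) blast
  define body where "body = Fork Pn (Seq (Fork Pa Coin) Pd)"
  define V where "V x = vsize (eL eN [0..<k x])" for x
  define S where "S x = 4 + vsize (e x) + V x + k x" for x
  define B where "B x = 5 * S x + 10 + (S x + 1) ^ Cb + (S x + 1) ^ Cn + (S x + 1) ^ Cd + (S x + 1) ^ Ca" for x
  have V: "poly_bounded e V" unfolding V_def by (rule pt_size[OF pt_upt[OF k]])
  have S: "poly_bounded e S" unfolding S_def by (intro pb_intros V k)
  have B: "poly_bounded e B" unfolding B_def by (intro pb_intros S)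
  have sz: "vsize (?es ((x, l), a)) \<le> S x" if "vsize (eL eN l) \<le> V x" "a < 2 ^ k x" for x l a
    using that vsize_le[OF that(2)] unfolding S_def eP_def by simp
  have step: "bounded_run (run body (?es ((x, y # l), a))) (map_pmf (\<lambda>b. ?es ((x, l), 2 * a + of_bool b)) (pmf_of_set UNIV)) (B x)"
    if l: "vsize (eL eN (y # l)) \<le> V x" and a: "2 * a + 1 < 2 ^ k x" for x y l a
  proof -
    let ?s = "?es ((x, y # l), a)"
    have a': "a < 2 ^ k x" using a by simp
    have s: "vsize ?s \<le> S x" by (rule sz[OF l a'])
    obtain j1 where j1: "j1 \<le> (S x + 1) ^ Cn" "run Pn ?s = return_spmf (eP e (eL eN) (x, l), j1)" using Pn[OF s] by auto
    obtain j2 where j2: "j2 \<le> (S x + 1) ^ Ca" "run Pa ?s = return_spmf (eN a, j2)" using Pa[OF s] by auto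
    have b2: "vsize (VNat (of_bool b)) \<le> 2" for b using vsize_le[of "of_bool b" 1] by simp
    have "vsize (eP eN eN (a, of_bool b)) \<le> S x" for b
      using vsize_le[OF a'] b2[of b] unfolding S_def eP_def by (simp del: vsize.simps(1))
    from Pd[OF this] obtain j3 where j3: "\<And>b. j3 b \<le> (S x + 1) ^ Cd"
      "\<And>b. run Pd (VPair (VNat a) (VNat (of_bool b))) = return_spmf (eN (2 * a + of_bool b), j3 b)"
      unfolding eP_def fst_conv snd_conv by metis
    let ?c = "\<lambda>b. vsize ?s + j1 + (vsize ?s + (vsize ?s + j2 + (vsize ?s + vsize (VNat (of_bool b)))) + j3 b)"
    have "run body ?s = map_spmf (\<lambda>b. (?es ((x, l), 2 * a + of_bool b), ?c b)) coin_spmf"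
      unfolding body_def run.simps j1(2) j2(2)
      by (simp add: j3(2) bind_map_spmf o_def map_spmf_conv_bind_spmf del: vsize.simps) (simp add: eP_def)
    also have "\<dots> = spmf_of_pmf (map_pmf (\<lambda>b. (?es ((x, l), 2 * a + of_bool b), ?c b)) (pmf_of_set UNIV))"
      by (simp add: map_spmf_of_pmf[symmetric] del: map_spmf_of_pmf)
    finally have r: "run body ?s = spmf_of_pmf (map_pmf (\<lambda>b. (?es ((x, l), 2 * a + of_bool b), ?c b)) (pmf_of_set UNIV))" .
    have "?c b \<le> B x" for b using s j1(1) j2(1) j3(1)[of b] b2[of b] unfolding B_def by linarith
    then show ?thesis unfolding bounded_run_def r by (intro exI conjI refl) (auto simp: pmf.map_comp o_def)
  qed
  define T where "T x = vsize (e x) + bi x + (S x + (k x + 1) * (3 * B x) + (S x + 1) ^ Cf)" for x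
  have T: "poly_bounded e T" unfolding T_def by (intro pb_intros bi S B k)
  have "bounded_run (run (Seq Pi (Seq (While Pb body) Pf)) (e x)) (map_pmf (\<lambda>a. e' (h x a)) (pmf_of_set {..<2 ^ k x})) (T x)" for x
  proof -
    have "bounded_run (loop (run Pb) (run body) (?es ((x, [0..<k x]), 0)))
       (map_pmf (\<lambda>r. ?es ((x, []), 0 * 2 ^ length [0..<k x] + r)) (pmf_of_set {..<2 ^ length [0..<k x]})) ((length [0..<k x] + 1) * (3 * B x))"
    proof (rule coin_loop[where es = "\<lambda>(l, a). ?es ((x, l), a)" and Q = "\<lambda>l. vsize (eL eN l) \<le> V x" and K = "k x", unfolded split_conv])
      fix l :: "nat list" and a :: nat assume "vsize (eL eN l) \<le> V x" "a < 2 ^ k x"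
      then have s: "vsize (?es ((x, l), a)) \<le> S x" by (rule sz)
      then show "vsize (?es ((x, l), a)) \<le> B x" unfolding B_def by simp
      obtain j where "j \<le> (S x + 1) ^ Cb" "run Pb (?es ((x, l), a)) = return_spmf (eB (l \<noteq> []), j)" using Pb[OF s] by auto
      moreover from this(1) have "j \<le> B x" unfolding B_def by linarith
      ultimately show "\<exists>j\<le>B x. run Pb (?es ((x, l), a)) = return_spmf (eB (l \<noteq> []), j)" by blast
    next
      fix y l assume "vsize (eL eN (y # l)) \<le> V x"
      then show "vsize (eL eN l) \<le> V x" by simp
    qed (use step in \<open>auto simp: V_def\<close>)
    then have w: "bounded_run (run (While Pb body) (?es ((x, [0..<k x]), 0))) (map_pmf (\<lambda>r. ?es ((x, []), r)) (pmf_of_set {..<2 ^ k x})) ((k x + 1) * (3 * B x))"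
      by simp
    have Pf': "bounded_run (run Pf (?es ((x, []), r))) (return_pmf (e' (h x r))) ((S x + 1) ^ Cf)" if "r \<in> set_pmf (pmf_of_set {..<2 ^ k x})" for r
    proof -
      have "{..<(2::nat) ^ k x} \<noteq> {}" by (auto simp: lessThan_empty_iff bot_nat_def)
      then have "r < 2 ^ k x" using that by (simp add: set_pmf_of_set)
      then have "vsize (?es ((x, []), r)) \<le> S x" by (intro sz) (auto simp: V_def floorlog_def)
      from Pf[OF this] show ?thesis by (auto intro: bounded_run_return)
    qed
    have s0: "vsize (?es ((x, [0..<k x]), 0)) \<le> S x" by (rule sz) (auto simp: V_def)
    have "bounded_run (run (Seq (While Pb body) Pf) (?es ((x, [0..<k x]), 0))) (map_pmf (\<lambda>a. e' (h x a)) (pmf_of_set {..<2 ^ k x}))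
        (vsize (?es ((x, [0..<k x]), 0)) + (k x + 1) * (3 * B x) + (S x + 1) ^ Cf)"
      using bounded_run_Seq[OF w Pf'] by (simp add: map_pmf_def)
    then have 2: "bounded_run (run (Seq (While Pb body) Pf) (?es ((x, [0..<k x]), 0))) (map_pmf (\<lambda>a. e' (h x a)) (pmf_of_set {..<2 ^ k x}))
        (S x + (k x + 1) * (3 * B x) + (S x + 1) ^ Cf)"
      by (rule bounded_run_mono) (use s0 in simp)
    obtain j where "j \<le> bi x" "run Pi (e x) = return_spmf (?es ((x, [0..<k x]), 0), j)" using Pi by blast
    then have 1: "bounded_run (run Pi (e x)) (map_pmf (\<lambda>_. ?es ((x, [0..<k x]), 0)) (return_pmf ())) (bi x)" by (simp add: bounded_run_return)
    from bounded_run_Seq[OF 1 2] show ?thesis unfolding T_def by (simp add: bind_return_pmf)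
  qed
  then show ?thesis using T by blast
qed

section \<open>Programs for sketch and recovery\<close>

lemma pt_recode: "(\<And>x. e x = e' (f x)) \<Longrightarrow> polytime e e' f"
  using pt_id[of e] unfolding polytime_def by simp

text \<open>A field whose degree is logarithmic in a polynomially bounded number has polynomially
  many elements, so it can be searched exhaustively.\<close>

lemma pb_two_power_floorlog: assumes "poly_bounded e y" shows "poly_bounded e (\<lambda>x. 2 ^ floorlog 2 (y x))"
proof (rule pb_mono)
  show "poly_bounded e (\<lambda>x. 2 * y x + 1)" by (intro pb_intros assms)
  fix x
  show "2 ^ floorlog 2 (y x) \<le> 2 * y x + 1"
  proof (cases "y x = 0")
    case False
    define k where "k = floorlog 2 (y x)"
    have "2 ^ (k - 1) \<le> y x" using floorlog_bounds[of "y x" 2] False unfolding k_def by simp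
    then show ?thesis unfolding k_def[symmetric] by (cases k) auto
  qed (simp add: floorlog_def)
qed

lemma pb_two_power_field_bits:
  assumes "poly_bounded e n" "poly_bounded e al" shows "poly_bounded e (\<lambda>x. 2 ^ field_bits (n x) (al x))"
proof -
  have "poly_bounded e (\<lambda>x. (2 ^ floorlog 2 (2 * n x * al x + 1)) ^ 6)"
    by (intro pb_two_power_floorlog pb_intros assms)
  then show ?thesis by (simp add: field_bits_def power_mult[symmetric] mult.commute)
qed

lemma pb_two_power_hash_bits:
  assumes "poly_bounded e (\<lambda>x. 2 ^ d x)" "\<And>x. 0 < d x" shows "poly_bounded e (\<lambda>x. 2 ^ hash_bits (al x) (d x))"
proof (rule pb_mono)
  show "poly_bounded e (\<lambda>x. (2 ^ d x) ^ 2)" by (intro pb_intros assms)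
  fix x
  have "hash_bits (al x) (d x) \<le> d x * 2" unfolding hash_bits_def using mod_less_divisor[OF assms(2)[of x], of "al x"] by auto
  then have "2 ^ hash_bits (al x) (d x) \<le> (2::nat) ^ (d x * 2)" by (rule power_increasing) simp
  then show "(2::nat) ^ hash_bits (al x) (d x) \<le> (2 ^ d x) ^ 2" by (simp add: power_mult)
qed

lemma pb_less_two_power: "poly_bounded e (\<lambda>x. 2 ^ d x) \<Longrightarrow> poly_bounded e d"
  by (erule pb_mono) (simp add: less_imp_le)

lemma field_bits_pos: "0 < field_bits n al"
proof -
  have "1 < (2::nat) ^ floorlog 2 (2 * n * al + 1)" using less_two_power_floorlog[of "2 * n * al + 1"] by linarith
  then have "floorlog 2 (2 * n * al + 1) \<noteq> 0" by (intro notI) simp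
  then show ?thesis unfolding field_bits_def by simp
qed

definition args :: "'a \<times> 'b \<times> 'c \<times> 'd \<Rightarrow> 'd" where "args x = snd (snd (snd x))"

text \<open>The length of the string is not a component of the environment, so that it is bounded by
  the size of the input.\<close>

definition e_sk :: "nat \<times> nat \<times> nat \<times> nat list \<Rightarrow> val" where
  "e_sk x = vlist [VNat (fst x), VNat (length (args x)), VNat (fst (snd x)), VNat (fst (snd (snd x))), eL eN (args x)]"

definition e_rc :: "nat \<times> nat \<times> nat \<times> nat list \<times> bool list \<Rightarrow> val" where
  "e_rc x = vlist [VNat (fst x), VNat (length (fst (args x))), VNat (fst (snd x)), VNat (fst (snd (snd x))),
     eL eN (fst (args x)), eL eB (snd (args x))]"

text \<open>In an arbitrary environment \<open>c\<close> may exceed the length of the string.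
  Clamping bounds it polynomially, and admissible inputs are not affected.\<close>

lemma pt_params:
  assumes F: "polytime e eN F" and ws: "polytime e (eL eN) ws" and c: "polytime e eN c"
  defines "n \<equiv> \<lambda>x. length (ws x)" and "c' \<equiv> \<lambda>x. min (c x) (length (ws x))"
  defines "al \<equiv> \<lambda>x. shingle_bits (F x) (c' x)"
  defines "d \<equiv> \<lambda>x. field_bits (n x) (al x)"
  defines "d0 \<equiv> \<lambda>x. hash_bits (al x) (d x)"
  shows "polytime e eN n" "polytime e eN c'" "polytime e eN d" "polytime e eN d0"
    "poly_bounded e n" "poly_bounded e c'" "poly_bounded e d" "poly_bounded e d0" "poly_bounded e (\<lambda>x. 2 ^ d x)" "poly_bounded e (\<lambda>x. 2 ^ d0 x)"
proof -
  show n: "polytime e eN n" "poly_bounded e n" unfolding n_def by (rule pt_length pb_length ws)+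
  show c': "polytime e eN c'" "poly_bounded e c'" unfolding c'_def by (rule pt_min pb_min2 c n[unfolded n_def])+
  have al: "polytime e eN al" "poly_bounded e al" unfolding al_def by (rule pt_shingle_bits pb_shingle_bits F c')+
  show d: "polytime e eN d" unfolding d_def by (rule pt_field_bits n al)+
  show b: "poly_bounded e (\<lambda>x. 2 ^ d x)" unfolding d_def by (rule pb_two_power_field_bits n al)+
  show "polytime e eN d0" unfolding d0_def by (rule pt_hash_bits al d)+
  show b0: "poly_bounded e (\<lambda>x. 2 ^ d0 x)" unfolding d0_def by (rule pb_two_power_hash_bits[OF b]) (simp add: d_def field_bits_pos)
  show "poly_bounded e d" "poly_bounded e d0" using b b0 by (auto intro: pb_less_two_power)
qed

definition par_c :: "nat \<times> nat \<times> nat \<times> 'd \<Rightarrow> nat \<Rightarrow> nat" where "par_c x n = min (fst (snd x)) n"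
definition par_d :: "nat \<times> nat \<times> nat \<times> 'd \<Rightarrow> nat \<Rightarrow> nat" where "par_d x n = field_bits n (shingle_bits (fst x) (par_c x n))"
definition par_d0 :: "nat \<times> nat \<times> nat \<times> 'd \<Rightarrow> nat \<Rightarrow> nat" where "par_d0 x n = hash_bits (shingle_bits (fst x) (par_c x n)) (par_d x n)"

definition sk_out :: "nat \<times> nat \<times> nat \<times> nat list \<Rightarrow> nat \<Rightarrow> bool list" where
  "sk_out x a = sketch (fst x) (length (args x)) (par_c x (length (args x))) (fst (snd (snd x)))
     (par_d0 x (length (args x))) (par_d x (length (args x))) (args x) a"

definition rc_out :: "nat \<times> nat \<times> nat \<times> nat list \<times> bool list \<Rightarrow> nat list" where
  "rc_out x = recover_mod (fst x) (length (fst (args x))) (par_c x (length (fst (args x)))) (fst (snd (snd x)))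
     (par_d0 x (length (fst (args x)))) (par_d x (length (fst (args x)))) (fst (args x)) (snd (args x))"

lemma sketch_prog:
  "\<exists>P b. poly_bounded e_sk b \<and> (\<forall>x. bounded_run (run P (e_sk x)) (map_pmf (\<lambda>a. eL eB (sk_out x a)) (pmf_of_set {..<2 ^ par_d0 x (length (args x))})) (b x))"
proof -
  \<comment> \<open>The last component 0 is the end marker of \<open>vlist\<close>; projections then
    give access to the single arguments.\<close>
  have *: "polytime e_sk (eP eN (eP eN (eP eN (eP eN (eP (eL eN) eN)))))
     (\<lambda>x. (fst x, length (args x), fst (snd x), fst (snd (snd x)), args x, 0))"
    by (rule pt_recode) (simp add: e_sk_def eP_def vlist_def)
  have F: "polytime e_sk eN fst" using pt_fst[OF *] by simp
  have c: "polytime e_sk eN (\<lambda>x. fst (snd x))" using pt_fst[OF pt_snd[OF pt_snd[OF *]]] by simp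
  have t: "polytime e_sk eN (\<lambda>x. fst (snd (snd x)))" using pt_fst[OF pt_snd[OF pt_snd[OF pt_snd[OF *]]]] by simp
  have ws: "polytime e_sk (eL eN) args" using pt_fst[OF pt_snd[OF pt_snd[OF pt_snd[OF pt_snd[OF *]]]]] by simp
  note P = pt_params[OF F ws c]
  note p = P(1-4) and b = P(5-10)
  show ?thesis
    unfolding par_d0_def sk_out_def par_d_def par_c_def
    by (rule coin_prog p b pt_sketch pt_rules p[THEN pt_comp] b[THEN pb_ptcomp] F[THEN pt_comp] t[THEN pt_comp] ws[THEN pt_comp])+
qed

lemma recover_prog: "polytime e_rc (eL eN) rc_out"
proof -
  have *: "polytime e_rc (eP eN (eP eN (eP eN (eP eN (eP (eL eN) (eP (eL eB) eN))))))
     (\<lambda>x. (fst x, length (fst (args x)), fst (snd x), fst (snd (snd x)), fst (args x), snd (args x), 0))"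
    by (rule pt_recode) (simp add: e_rc_def eP_def vlist_def)
  have F: "polytime e_rc eN fst" using pt_fst[OF *] by simp
  have c: "polytime e_rc eN (\<lambda>x. fst (snd x))" using pt_fst[OF pt_snd[OF pt_snd[OF *]]] by simp
  have t: "polytime e_rc eN (\<lambda>x. fst (snd (snd x)))" using pt_fst[OF pt_snd[OF pt_snd[OF pt_snd[OF *]]]] by simp
  have ws: "polytime e_rc (eL eN) (\<lambda>x. fst (args x))" using pt_fst[OF pt_snd[OF pt_snd[OF pt_snd[OF pt_snd[OF *]]]]] by simp
  have s: "polytime e_rc (eL eB) (\<lambda>x. snd (args x))" using pt_fst[OF pt_snd[OF pt_snd[OF pt_snd[OF pt_snd[OF pt_snd[OF *]]]]]] by simp
  note P = pt_params[OF F ws c]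
  show ?thesis
    unfolding par_d0_def rc_out_def par_d_def par_c_def
    by (rule P F t ws s pt_recover_mod)+
qed

lemma bounded_run_expected_time:
  assumes "bounded_run (run P v) D B" "B \<le> poly T (vsize v)" shows "runs_in_expected_time P T v D"
proof -
  obtain p where p: "run P v = spmf_of_pmf p" "map_pmf fst p = D" "\<And>x. x \<in> set_pmf p \<Longrightarrow> snd x \<le> B"
    using assms(1) unfolding bounded_run_def by blast
  have "(\<integral>\<^sup>+ r. of_nat (snd r) \<partial>measure_pmf p) \<le> (\<integral>\<^sup>+ r. of_nat B \<partial>measure_pmf p)"
    by (intro nn_integral_mono_AE) (use p(3) in \<open>auto simp: AE_measure_pmf_iff\<close>)
  also have "\<dots> = of_nat B" by simp
  also have "\<dots> \<le> of_nat (poly T (vsize v))" using assms(2) by (rule of_nat_mono)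
  finally show ?thesis unfolding runs_in_expected_time_def using p(1,2) by simp
qed

lemma ceiling_log: assumes "1 \<le> u" shows "\<lceil>log 2 (real u + 1)\<rceil> = int (floorlog 2 u)"
proof (rule ceiling_unique)
  define k where "k = floorlog 2 u"
  have k: "2 ^ (k - 1) \<le> u" "u < 2 ^ k" using floorlog_bounds[of u 2] assms unfolding k_def by auto
  have "k \<noteq> 0" using k(2) assms by (intro notI) simp
  have "real u + 1 \<le> 2 ^ k" using k(2) by (metis Suc_leI add.commute of_nat_Suc of_nat_le_iff of_nat_numeral of_nat_power)
  then have "log 2 (real u + 1) \<le> log 2 (2 ^ k)" by (intro log_mono) auto
  then show "log 2 (real u + 1) \<le> real_of_int (int (floorlog 2 u))" unfolding k_def by simp
  have "(2::real) ^ (k - 1) < real u + 1" using k(1) by (metis less_add_one of_nat_le_iff of_nat_numeral of_nat_power order_le_less_trans)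
  then have "log 2 (2 ^ (k - 1)) < log 2 (real u + 1)" by (intro log_less) auto
  then show "real_of_int (int (floorlog 2 u)) - 1 < log 2 (real u + 1)" using \<open>k \<noteq> 0\<close> unfolding k_def[symmetric] by (simp add: of_nat_diff)
qed

context scheme
begin

lemma ceiling_num_blocks: "\<lceil>real n / real c\<rceil> = int (num_blocks n c)"
proof (rule ceiling_unique)
  have N: "num_blocks n c * c + (n + c - 1) mod c = n + c - 1" unfolding num_blocks_def by simp
  have "(n + c - 1) mod c < c" using c by simp
  then have "n \<le> num_blocks n c * c" "num_blocks n c * c < n + c" using N c by linarith+
  then have "real n \<le> real (num_blocks n c * c)" "real (num_blocks n c * c) < real (n + c)" by linarith+
  then show "real n / real c \<le> real_of_int (int (num_blocks n c))" "real_of_int (int (num_blocks n c)) - 1 < real n / real c"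
    using c by (simp_all add: divide_le_eq less_divide_eq algebra_simps)
qed

text \<open>\<open>al\<close> is the bit length of F^c, which equals the ceiling of the logarithm of
  F^c + 1; so the count of sketches has precisely the claimed logarithm.\<close>

lemma loss: "real m ^ N * 2 ^ (al * ((2 * c - 1) * t)) =
  2 powr (real_of_int \<lceil>real n / real c\<rceil> * log 2 (real n - real c + 1)
    + (2 * real c - 1) * real t * real_of_int \<lceil>log 2 (real F ^ c + 1)\<rceil>)"
proof -
  have "1 \<le> F ^ c" using F by simp
  from ceiling_log[OF this] have 1: "\<lceil>log 2 (real F ^ c + 1)\<rceil> = int al" unfolding al_def shingle_bits_def by simp
  have 2: "real n - real c + 1 = real m" using cn by (simp add: of_nat_diff)
  have 3: "(2 * real c - 1) * real t = real ((2 * c - 1) * t)" using c by (simp add: of_nat_diff)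
  have m: "0 < real m" using cn by simp
  have "2 powr (log 2 (real m) * real N) = (2 powr log 2 (real m)) powr real N" by (rule powr_powr[symmetric])
  also have "\<dots> = real m ^ N" using m by (simp add: powr_realpow)
  finally have "2 powr (real N * log 2 (real m)) = real m ^ N" by (simp only: mult.commute)
  moreover have "2 powr (real ((2 * c - 1) * t) * real al) = 2 ^ (al * ((2 * c - 1) * t))"
    by (simp only: of_nat_mult[symmetric] powr_realpow zero_less_numeral) (simp add: mult.commute)
  ultimately show ?thesis unfolding 1 2 3 ceiling_num_blocks by (simp add: powr_add)
qed

end

text \<open>The codes are the image of the shingle set under a function that does not depend on the
  string. Hence the bound on the symmetric difference carries over to them.\<close>

lemma shingle_nums_shingle_set:
  assumes "length w = n" "c \<le> n"
  shows "set (shingle_nums F n c (map code w)) = (\<lambda>l. 1 + undigits F c (\<lambda>j. nth_or 0 (map code l) j)) ` shingle_set c w"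
proof -
  have eq: "shingle_num F c (map code w) i = 1 + undigits F c (\<lambda>j. nth_or 0 (map code (take c (drop i w))) j)" if "i + c \<le> n" for i
    unfolding shingle_num_def undigits_def using that assms by (simp add: ac_simps)
  have "set (shingle_nums F n c (map code w)) = shingle_num F c (map code w) ` {i. i + c \<le> n}"
    unfolding shingle_nums_def using assms(2) by (auto simp del: upt_Suc)
  also have "\<dots> = (\<lambda>i. 1 + undigits F c (\<lambda>j. nth_or 0 (map code (take c (drop i w))) j)) ` {i. i + c \<le> n}"
    by (intro image_cong) (auto simp: eq)
  also have "\<dots> = (\<lambda>l. 1 + undigits F c (\<lambda>j. nth_or 0 (map code l) j)) ` shingle_set c w"
    unfolding shingle_set_def using assms(1) by auto
  finally show ?thesis .
qed

lemma enc_string_eL: "enc_string code w = eL eN (map code w)"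
  by (simp add: enc_string_def eL_def o_def)

lemma enc_bits_eL: "enc_bits s = eL eB s"
proof -
  have "eB = (\<lambda>b. VNat (of_bool b))" by (rule ext) (simp add: eB_def)
  then show ?thesis by (simp add: enc_bits_def eL_def)
qed

theorem theorem7p5:
  "\<exists>(P :: prog) (Q :: prog) (T :: nat poly).
     \<forall>(A :: 'a set) (code :: 'a \<Rightarrow> nat) (n :: nat) (m :: real) (t :: nat) (c :: nat).
       finite A \<longrightarrow> bij_betw code A {..<card A} \<longrightarrow> 1 \<le> c \<longrightarrow> c \<le> n \<longrightarrow>
       (\<exists>(SS :: 'a list \<Rightarrow> bool list pmf) (Rec :: 'a list \<Rightarrow> bool list \<Rightarrow> 'a list pmf).
          average_case_secure_sketch (Edit A n) (edit_dist A) m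
            (m - real_of_int \<lceil>real n / real c\<rceil> * log 2 (real n - real c + 1)
               - (2 * real c - 1) * real t * real_of_int \<lceil>log 2 (real (card A) ^ c + 1)\<rceil>)
            t SS Rec \<and>
          implements_sketch P Q T [card A, n, c, t] code (Edit A n) SS Rec)"
proof -
  obtain P bP where bP: "poly_bounded e_sk bP" and P: "\<And>x. bounded_run (run P (e_sk x)) (map_pmf (\<lambda>a. eL eB (sk_out x a)) (pmf_of_set {..<2 ^ par_d0 x (length (args x))})) (bP x)"
    using sketch_prog by blast
  obtain Q bQ where bQ: "poly_bounded e_rc bQ" and Q: "\<And>x. \<exists>k\<le>bQ x. run Q (e_rc x) = return_spmf (eL eN (rc_out x), k)"
    using recover_prog by (rule ptE) blast
  obtain C1 where C1: "\<And>x. bP x \<le> (vsize (e_sk x) + 1) ^ C1" using bP unfolding poly_bounded_def by blast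
  obtain C2 where C2: "\<And>x. bQ x \<le> (vsize (e_rc x) + 1) ^ C2" using bQ unfolding poly_bounded_def by blast
  \<comment> \<open>One polynomial has to serve both programs, so the exponents are added.\<close>
  define T :: "nat poly" where "T = [:1, 1:] ^ (C1 + C2)"
  have T: "poly T v = (v + 1) ^ (C1 + C2)" for v unfolding T_def by (simp add: poly_power add.commute)
  have TP: "bP x \<le> poly T (vsize (e_sk x))" for x
    unfolding T using C1[of x] by (rule order_trans) (intro power_increasing, auto)
  have TQ: "bQ x \<le> poly T (vsize (e_rc x))" for x
    unfolding T using C2[of x] by (rule order_trans) (intro power_increasing, auto)
  show ?thesis
  proof (rule exI[of _ P], rule exI[of _ Q], rule exI[of _ T], intro allI impI)
    fix A :: "'a set" and code :: "'a \<Rightarrow> nat" and n :: nat and m :: real and t c :: nat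
    assume A: "finite A" "bij_betw code A {..<card A}" and cA: "1 \<le> c" "c \<le> n"
    define F where "F = card A"
    define ds where "ds = field_bits n (shingle_bits F c)"
    define db where "db = hash_bits (shingle_bits F c) ds"
    define SS where "SS w = map_pmf (\<lambda>a. sketch F n c t db ds (map code w) a) (pmf_of_set {..<2 ^ db})" for w
    define Rec where "Rec w' s = return_pmf (map (inv_into A code) (recover_mod F n c t db ds (map code w') s))" for w' s
    \<comment> \<open>A string of length \<open>n \<ge> c \<ge> 1\<close> is nonempty, so the
      alphabet is. For an empty alphabet there is no string and no distribution to consider.\<close>
    have F1: "1 \<le> F" if "w \<in> Edit A n" for w
    proof -
      have "w \<noteq> []" "set w \<subseteq> A" using that cA unfolding Edit_def by auto
      then have "A \<noteq> {}" by auto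
      then show ?thesis unfolding F_def using A(1) by (simp add: Suc_le_eq card_gt_0_iff)
    qed
    have cw: "set (map code w) \<subseteq> {..<F}" if "w \<in> Edit A n" for w
      using that A(2) unfolding Edit_def bij_betw_def F_def by auto
    have inv: "map (inv_into A code) (map code w) = w" if "w \<in> Edit A n" for w
      using that A(2) unfolding Edit_def bij_betw_def by (auto intro!: map_idI simp: inv_into_f_f subset_iff)
    have corr: "bind_pmf (SS w) (\<lambda>s. Rec w' s) = return_pmf w"
      if w: "w \<in> Edit A n" "w' \<in> Edit A n" and dist: "edit_dist A w w' \<le> t" for w w'
    proof -
      interpret scheme F n c using F1[OF w(1)] cA by unfold_locales
      have dd: "d = ds" "d0 = db" unfolding d_def d0_def al_def ds_def db_def by auto
      have len: "length w = n" "length w' = n" using w unfolding Edit_def by auto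
      have path: "(edit_step A ^^ edit_dist A w w') w w'" using w(2) unfolding Edit_def by (intro edit_path) auto
      have "card (sdiff (set (shingle_nums F n c (map code w))) (set (shingle_nums F n c (map code w')))) \<le> card (sdiff (shingle_set c w) (shingle_set c w'))"
        unfolding shingle_nums_shingle_set[OF len(1) cA(2)] shingle_nums_shingle_set[OF len(2) cA(2)] by (intro card_sdiff_image finite_shingle_set)
      also have "\<dots> \<le> (2 * c - 1) * edit_dist A w w'" by (rule shingle_set_edit_steps[OF cA(1) path])
      also have "\<dots> \<le> (2 * c - 1) * t" using dist by simp
      finally have card: "card (sdiff (set (shingle_nums F n c (map code w))) (set (shingle_nums F n c (map code w')))) \<le> (2 * c - 1) * t" .
      have "t = 0 \<Longrightarrow> w' = w" using path dist by simp
      then have "recover_mod F n c t db ds (map code w') (sketch F n c t db ds (map code w) a) = map code w" if "a < 2 ^ db" for a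
        using recover_correct[OF _ card, of a] cw[OF w(1)] len that unfolding dd strings_def by auto
      then have "bind_pmf (SS w) (\<lambda>s. Rec w' s) = bind_pmf (pmf_of_set {..<(2::nat) ^ db}) (\<lambda>a. return_pmf w)"
        unfolding SS_def Rec_def bind_map_pmf using inv[OF w(1)] J0_less
        by (intro bind_pmf_cong refl) (auto simp: dd set_pmf_of_set lessThan_empty_iff bot_nat_def)
      then show ?thesis by simp
    qed
    have secure: "avg_min_entropy (bind_pmf D (\<lambda>(w, i). map_pmf (\<lambda>s. (w, (s, i))) (SS w))) \<ge>
        m - real_of_int \<lceil>real n / real c\<rceil> * log 2 (real n - real c + 1)
          - (2 * real c - 1) * real t * real_of_int \<lceil>log 2 (real (card A) ^ c + 1)\<rceil>"
      if D: "fst ` set_pmf D \<subseteq> Edit A n" "avg_min_entropy D \<ge> m" for D :: "('a list \<times> bool list) pmf"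
    proof -
      obtain x where "x \<in> set_pmf D" using set_pmf_not_empty[of D] by blast
      then have "fst x \<in> Edit A n" using D(1) by auto
      from F1[OF this] interpret scheme F n c using cA by unfold_locales
      have dd: "d = ds" "d0 = db" unfolding d_def d0_def al_def ds_def db_def by auto
      obtain T \<mu> where T: "finite T" "\<And>s. 0 \<le> \<mu> s" "\<And>ws. ws \<in> strings \<Longrightarrow> set_pmf (sketch_dist t ws) \<subseteq> T"
        "\<And>ws s. ws \<in> strings \<Longrightarrow> pmf (sketch_dist t ws) s \<le> \<mu> s" and sum: "sum \<mu> T \<le> real (n - c + 1) ^ num_blocks n c * 2 ^ (al * ((2 * c - 1) * t))"
        using leak[of t] by metis
      have sketch_dist: "SS w = sketch_dist t (map code w)" for w unfolding SS_def sketch_dist_def dd ..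
      have st: "map code w \<in> strings" if "w \<in> Edit A n" for w using cw[OF that] that unfolding strings_def Edit_def by auto
      have "avg_min_entropy D - (real_of_int \<lceil>real n / real c\<rceil> * log 2 (real n - real c + 1)
          + (2 * real c - 1) * real t * real_of_int \<lceil>log 2 (real F ^ c + 1)\<rceil>) \<le>
        avg_min_entropy (bind_pmf D (\<lambda>(w, i). map_pmf (\<lambda>s. (w, (s, i))) (SS w)))"
        by (rule entropy_loss[OF D(1) T(1) _ _ T(2)]) (use T(3,4) st sum loss[of t] sketch_dist in auto)
      then show ?thesis using D(2) unfolding F_def by linarith
    qed
    have prog1: "runs_in_expected_time P T (vlist (map VNat [card A, n, c, t] @ [enc_string code w])) (map_pmf enc_bits (SS w))"
      if w: "w \<in> Edit A n" for w
    proof -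
      define x where "x = (F, c, t, map code w)"
      have len: "length w = n" using w unfolding Edit_def by simp
      have e: "vlist (map VNat [card A, n, c, t] @ [enc_string code w]) = e_sk x"
        by (simp add: e_sk_def x_def args_def enc_string_eL len F_def)
      have "map_pmf enc_bits (SS w) = map_pmf (\<lambda>a. eL eB (sk_out x a)) (pmf_of_set {..<2 ^ par_d0 x (length (args x))})"
        using cA(2) by (simp add: SS_def sk_out_def x_def args_def par_d0_def par_d_def par_c_def len ds_def db_def pmf.map_comp o_def enc_bits_eL min_def)
      then show ?thesis unfolding e using bounded_run_expected_time[OF P TP] by simp
    qed
    have prog2: "runs_in_expected_time Q T (vlist (map VNat [card A, n, c, t] @ [enc_string code w', enc_bits s])) (map_pmf (enc_string code) (Rec w' s))"
      if w: "w' \<in> Edit A n" for w' s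
    proof -
      define x where "x = (F, c, t, map code w', s)"
      have len: "length w' = n" using w unfolding Edit_def by simp
      have e: "vlist (map VNat [card A, n, c, t] @ [enc_string code w', enc_bits s]) = e_rc x"
        by (simp add: e_rc_def x_def args_def enc_string_eL enc_bits_eL len F_def)
      have rc: "rc_out x = recover_mod F n c t db ds (map code w') s"
        using cA(2) by (simp add: rc_out_def x_def args_def par_d0_def par_d_def par_c_def len ds_def db_def min_def)
      \<comment> \<open>This is where the reduction modulo \<open>F\<close> matters: on an arbitrary
        bit string, too, the numbers in the output are codes of characters.\<close>
      have "code (inv_into A code v) = v" if "v \<in> set (rc_out x)" for v
      proof (rule f_inv_into_f)
        have "v < F" using that F1[OF w] unfolding rc recover_mod_def by auto
        then show "v \<in> code ` A" using A(2) unfolding bij_betw_def F_def by auto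
      qed
      then have "map code (map (inv_into A code) (rc_out x)) = rc_out x" by (simp add: map_idI o_def)
      then have r: "map_pmf (enc_string code) (Rec w' s) = return_pmf (eL eN (rc_out x))"
        unfolding Rec_def rc[symmetric] by (simp add: enc_string_eL)
      obtain k where "k \<le> bQ x" "run Q (e_rc x) = return_spmf (eL eN (rc_out x), k)" using Q by blast
      then have "bounded_run (run Q (e_rc x)) (return_pmf (eL eN (rc_out x))) (bQ x)" by (simp add: bounded_run_return)
      from bounded_run_expected_time[OF this TQ] show ?thesis unfolding e r .
    qed
    show "\<exists>(SS :: 'a list \<Rightarrow> bool list pmf) (Rec :: 'a list \<Rightarrow> bool list \<Rightarrow> 'a list pmf).
          average_case_secure_sketch (Edit A n) (edit_dist A) m
            (m - real_of_int \<lceil>real n / real c\<rceil> * log 2 (real n - real c + 1)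
               - (2 * real c - 1) * real t * real_of_int \<lceil>log 2 (real (card A) ^ c + 1)\<rceil>)
            t SS Rec \<and>
          implements_sketch P Q T [card A, n, c, t] code (Edit A n) SS Rec"
      unfolding average_case_secure_sketch_def implements_sketch_def
      using corr secure prog1 prog2 by (intro exI[of _ SS] exI[of _ Rec]) blast
  qed
qed

end
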